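(* Let $(X_n)_{n\in\mathbb{N}_0}$ and $\Phi=(\phi_n)_{n\in\mathbb{N}_0}$ be as in the standing setting, with associated spaces $J(\Phi)\subseteq\hat J(\Phi)$. (i) If each $X_n$ is subprojective, then every closed infinite-dimensional subspace of $J(\Phi)$ contains an infinite-dimensional subspace complemented in $\hat J(\Phi)$. (ii) If each $X_n$ is hereditarily $\ell_2$, then $J(\Phi)$ is hereditarily $\ell_2$. (iii) If each $X_n$ is subprojective and hereditarily $\ell_2$, then every closed infinite-dimensional subspace of $J(\Phi)$ contains a copy of $\ell_2$ complemented in $\hat J(\Phi)$.
   Context: Standing setting. Let $\mathbb{N}_0=\mathbb{N}\cup\{0\}$ and let $\wp$ be the set of all non-empty finite subsets of $\mathbb{N}_0$. Let $(X_n,\|\cdot\|_n)_{n\in\mathbb{N}_0}$ be a sequence of Banach spaces with $\dim X_0=0$, and let $\Phi=(\phi_n)_{n\in\mathbb{N}_0}$ be a sequence of operators (bounded linear maps) $\phi_n\colon X_n\to X_{n+1}$ with $\|\phi_n\|\le 1$. For $n\le m$ put $\phi_n^m=\phi_{m-1}\circ\cdots\circ\phi_n\colon X_n\to X_m$, with $\phi_n^n=I_{X_n}$. Let $\Pi=\prod_{n\in\mathbb{N}_0}X_n$. For $x=(x_n)_{n\in\mathbb{N}_0}\in\Pi$ and $S=\{p_0<\cdots<p_k\}\in\wp$ define $$\rho(x,S)=\Bigl(\sum_{i=1}^k\bigl\|\phi_{p_{i-1}}^{p_i}(x_{p_{i-1}})-x_{p_i}\bigr\|_{p_i}^2+\|x_{p_k}\|_{p_k}^2\Bigr)^{1/2},$$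 and $\|x\|_J=\frac{1}{\sqrt2}\sup_{S\in\wp}\rho(x,S)$. Let $\hat J(\Phi)=\{x\in\Pi:\|x\|_J<\infty\}$, a Banach space with norm $\|\cdot\|_J$, and let $J(\Phi)=\{(x_n)_{n\in\mathbb{N}_0}\in\hat J(\Phi):\lim_n\|x_n\|_n=0\}$, a closed subspace of $\hat J(\Phi)$ (equivalently, the closure of the finitely non-zero sequences of $\Pi$ in $\|\cdot\|_J$). A Banach space $X$ is subprojective if every closed infinite-dimensional subspace of $X$ contains an infinite-dimensional subspace complemented in $X$ (finite-dimensional spaces are trivially subprojective). A Banach space $X$ is hereditarily $\ell_2$ if every closed infinite-dimensional subspace of $X$ contains a copy of $\ell_2$. A copy of $\ell_2$ is a closed subspace isomorphic to $\ell_2$. A subspace is complemented in a Banach space if it is the range of a bounded linear projection on that space. *)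

theory Defs
  imports "HOL-Analysis.Analysis" "HOL-Library.Function_Algebras"
begin

section \<open>Scalars\<close>

text \<open>
  The scalar field is \<open>\<real>\<close> or \<open>\<complex>\<close>. The class consists of exactly these two fields: if
  \<open>j = 0\<close> every scalar is real, and if \<open>j\<^sup>2 = -1\<close> the field is a copy of \<open>\<complex>\<close>, whose only
  multiplicative norm extending the absolute value is the modulus.
\<close>

class real_or_complex = real_normed_field +
  assumes real_or_complex:
    "\<exists>j. (j = 0 \<or> j * j = - 1) \<and> (\<forall>z. \<exists>a b. z = scaleR a 1 + scaleR b j)"

instance real :: real_or_complex
  by standard (rule exI[of _ 0], auto)

instance complex :: real_or_complex
  by standard (rule exI[of _ imaginary_unit], auto simp: complex_eq_iff)

section \<open>Normed and Banach spaces on carriers\<close>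

text \<open>
  A normed space is a linear subspace \<open>V\<close> of a vector space with a norm \<open>N\<close> that matters on \<open>V\<close>
  only; the surrounding vector space carries no norm. So a sequence of unrelated normed
  spaces can be given by subspaces of one vector space (for instance of their product).
\<close>

locale normed_space_on = vector_space smul
  for smul :: "'k::real_or_complex \<Rightarrow> 'a::ab_group_add \<Rightarrow> 'a" +
  fixes V :: "'a set" and N :: "'a \<Rightarrow> real"
  assumes subspace_carrier: "subspace V"
    and N_eq_zero: "x \<in> V \<Longrightarrow> N x = 0 \<longleftrightarrow> x = 0"
    and N_triangle: "x \<in> V \<Longrightarrow> y \<in> V \<Longrightarrow> N (x + y) \<le> N x + N y"
    and N_scale: "x \<in> V \<Longrightarrow> N (smul c x) = norm c * N x"

locale banach_space_on = normed_space_on smul V N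
  for smul :: "'k::real_or_complex \<Rightarrow> 'a::ab_group_add \<Rightarrow> 'a" and V N +
  assumes complete:
    "range f \<subseteq> V \<Longrightarrow> (\<forall>e>0. \<exists>n0. \<forall>m\<ge>n0. \<forall>n\<ge>n0. N (f m - f n) < e) \<Longrightarrow>
      \<exists>l\<in>V. (\<lambda>n. N (f n - l)) \<longlonglongrightarrow> 0"

definition closed_subspace ::
  "('k::real_or_complex \<Rightarrow> 'a::ab_group_add \<Rightarrow> 'a) \<Rightarrow> 'a set \<Rightarrow> ('a \<Rightarrow> real) \<Rightarrow> 'a set \<Rightarrow> bool" where
  "closed_subspace smul V N M \<longleftrightarrow>
     module.subspace smul M \<and> M \<subseteq> V \<and>
     (\<forall>f l. range f \<subseteq> M \<longrightarrow> l \<in> V \<longrightarrow> (\<lambda>n. N (f n - l)) \<longlonglongrightarrow> 0 \<longrightarrow> l \<in> M)"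

text \<open>To be applied to linear subspaces \<open>M\<close>.\<close>

definition infinite_dimensional ::
  "('k::real_or_complex \<Rightarrow> 'a::ab_group_add \<Rightarrow> 'a) \<Rightarrow> 'a set \<Rightarrow> bool" where
  "infinite_dimensional smul M \<longleftrightarrow> \<not> (\<exists>B. finite B \<and> module.span smul B = M)"

definition bounded_operator ::
  "('k::real_or_complex \<Rightarrow> 'a::ab_group_add \<Rightarrow> 'a) \<Rightarrow> 'a set \<Rightarrow> ('a \<Rightarrow> real) \<Rightarrow>
   ('k \<Rightarrow> 'b::ab_group_add \<Rightarrow> 'b) \<Rightarrow> 'b set \<Rightarrow> ('b \<Rightarrow> real) \<Rightarrow> ('a \<Rightarrow> 'b) \<Rightarrow> bool" where
  "bounded_operator smul V N smul' V' N' T \<longleftrightarrow>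
     T ` V \<subseteq> V' \<and>
     (\<forall>x\<in>V. \<forall>y\<in>V. T (x + y) = T x + T y) \<and>
     (\<forall>c. \<forall>x\<in>V. T (smul c x) = smul' c (T x)) \<and>
     (\<exists>C. \<forall>x\<in>V. N' (T x) \<le> C * N x)"

definition operator_norm ::
  "'a set \<Rightarrow> ('a \<Rightarrow> real) \<Rightarrow> ('b \<Rightarrow> real) \<Rightarrow> ('a \<Rightarrow> 'b) \<Rightarrow> real" where
  "operator_norm V N N' T = (SUP x\<in>{x\<in>V. N x \<le> 1}. N' (T x))"

definition complemented_in ::
  "('k::real_or_complex \<Rightarrow> 'a::ab_group_add \<Rightarrow> 'a) \<Rightarrow> 'a set \<Rightarrow> ('a \<Rightarrow> real) \<Rightarrow> 'a set \<Rightarrow> bool" where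
  "complemented_in smul V N W \<longleftrightarrow>
     (\<exists>P. bounded_operator smul V N smul V N P \<and> (\<forall>x\<in>V. P (P x) = P x) \<and> P ` V = W)"

definition isomorphic_spaces ::
  "('k::real_or_complex \<Rightarrow> 'a::ab_group_add \<Rightarrow> 'a) \<Rightarrow> 'a set \<Rightarrow> ('a \<Rightarrow> real) \<Rightarrow>
   ('k \<Rightarrow> 'b::ab_group_add \<Rightarrow> 'b) \<Rightarrow> 'b set \<Rightarrow> ('b \<Rightarrow> real) \<Rightarrow> bool" where
  "isomorphic_spaces smul V N smul' V' N' \<longleftrightarrow>
     (\<exists>T. bij_betw T V V' \<and>
          bounded_operator smul V N smul' V' N' T \<and>
          bounded_operator smul' V' N' smul V N (inv_into V T))"

section \<open>Sequences and \<open>\<ell>\<^sub>2\<close>\<close>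

text \<open>Addition of sequences is pointwise, as defined in \<open>HOL-Library.Function_Algebras\<close>.\<close>

definition seq_scale :: "('k \<Rightarrow> 'a \<Rightarrow> 'a) \<Rightarrow> 'k \<Rightarrow> (nat \<Rightarrow> 'a) \<Rightarrow> nat \<Rightarrow> 'a" where
  "seq_scale smul c x = (\<lambda>n. smul c (x n))"

definition ell2 :: "(nat \<Rightarrow> 'k::real_or_complex) set" where
  "ell2 = {a. summable (\<lambda>n. (norm (a n))\<^sup>2)}"

definition ell2_norm :: "(nat \<Rightarrow> 'k::real_or_complex) \<Rightarrow> real" where
  "ell2_norm a = sqrt (\<Sum>n. (norm (a n))\<^sup>2)"

definition copy_of_ell2 ::
  "('k::real_or_complex \<Rightarrow> 'a::ab_group_add \<Rightarrow> 'a) \<Rightarrow> 'a set \<Rightarrow> ('a \<Rightarrow> real) \<Rightarrow> 'a set \<Rightarrow> bool" where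
  "copy_of_ell2 smul V N W \<longleftrightarrow>
     closed_subspace smul V N W \<and>
     isomorphic_spaces (seq_scale (*)) (ell2 :: (nat \<Rightarrow> 'k) set) ell2_norm smul W N"

definition subprojective ::
  "('k::real_or_complex \<Rightarrow> 'a::ab_group_add \<Rightarrow> 'a) \<Rightarrow> 'a set \<Rightarrow> ('a \<Rightarrow> real) \<Rightarrow> bool" where
  "subprojective smul V N \<longleftrightarrow>
     (\<forall>M. closed_subspace smul V N M \<and> infinite_dimensional smul M \<longrightarrow>
        (\<exists>W\<subseteq>M. infinite_dimensional smul W \<and> complemented_in smul V N W))"

definition hereditarily_ell2 ::
  "('k::real_or_complex \<Rightarrow> 'a::ab_group_add \<Rightarrow> 'a) \<Rightarrow> 'a set \<Rightarrow> ('a \<Rightarrow> real) \<Rightarrow> bool" where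
  "hereditarily_ell2 smul V N \<longleftrightarrow>
     (\<forall>M. closed_subspace smul V N M \<and> infinite_dimensional smul M \<longrightarrow>
        (\<exists>W\<subseteq>M. copy_of_ell2 smul V N W))"

section \<open>The spaces \<open>J(\<Phi>)\<close>\<close>

text \<open>\<open>phi_comp \<phi> n m\<close> is \<open>\<phi>\<^sub>m\<^sub>-\<^sub>1 \<circ> \<dots> \<circ> \<phi>\<^sub>n\<close>; it is used for \<open>n \<le> m\<close> only.\<close>

definition phi_comp :: "(nat \<Rightarrow> 'a \<Rightarrow> 'a) \<Rightarrow> nat \<Rightarrow> nat \<Rightarrow> 'a \<Rightarrow> 'a" where
  "phi_comp \<phi> n m = fold \<phi> [n..<m]"

definition rho ::
  "(nat \<Rightarrow> 'a::ab_group_add \<Rightarrow> real) \<Rightarrow> (nat \<Rightarrow> 'a \<Rightarrow> 'a) \<Rightarrow> (nat \<Rightarrow> 'a) \<Rightarrow> nat set \<Rightarrow> real" where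
  "rho N \<phi> x S =
     (let p = (\<lambda>i. sorted_list_of_set S ! i); k = card S - 1 in
       sqrt ((\<Sum>i=1..k. (N (p i) (phi_comp \<phi> (p (i - 1)) (p i) (x (p (i - 1))) - x (p i)))\<^sup>2)
             + (N (p k) (x (p k)))\<^sup>2))"

definition finite_nonempty_sets :: "nat set set" where
  "finite_nonempty_sets = {S. finite S \<and> S \<noteq> {}}"

text \<open>
  The supremum is taken in \<open>\<real>\<close>, so \<open>J_norm\<close> is meaningful only where it is finite, that is,
  on \<open>J_hat\<close>, whose members are the \<open>x \<in> \<Prod>\<^sub>n X\<^sub>n\<close> with bounded \<open>S \<mapsto> \<rho>(x,S)\<close>.
\<close>

definition J_norm ::
  "(nat \<Rightarrow> 'a::ab_group_add \<Rightarrow> real) \<Rightarrow> (nat \<Rightarrow> 'a \<Rightarrow> 'a) \<Rightarrow> (nat \<Rightarrow> 'a) \<Rightarrow> real" where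
  "J_norm N \<phi> x = 1 / sqrt 2 * (SUP S\<in>finite_nonempty_sets. rho N \<phi> x S)"

definition J_hat ::
  "(nat \<Rightarrow> 'a set) \<Rightarrow> (nat \<Rightarrow> 'a::ab_group_add \<Rightarrow> real) \<Rightarrow> (nat \<Rightarrow> 'a \<Rightarrow> 'a) \<Rightarrow> (nat \<Rightarrow> 'a) set" where
  "J_hat X N \<phi> = {x. (\<forall>n. x n \<in> X n) \<and> bdd_above (rho N \<phi> x ` finite_nonempty_sets)}"

definition J_space ::
  "(nat \<Rightarrow> 'a set) \<Rightarrow> (nat \<Rightarrow> 'a::ab_group_add \<Rightarrow> real) \<Rightarrow> (nat \<Rightarrow> 'a \<Rightarrow> 'a) \<Rightarrow> (nat \<Rightarrow> 'a) set" where
  "J_space X N \<phi> = {x \<in> J_hat X N \<phi>. (\<lambda>n. N n (x n)) \<longlonglongrightarrow> 0}"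

end

theory Submission
  imports Defs
begin

text \<open>
  Because \<open>X\<^sub>0 = 0\<close>, the norm of \<open>J(\<Phi>)\<close> is equivalent to the quadratic variation \<open>\<nu>\<close>, which drops
  the last summand of \<open>\<rho>\<close>; complementation, closedness and copies of \<open>\<ell>\<^sub>2\<close> are the same for
  both norms. For \<open>\<nu>\<close> there is a dichotomy for a closed infinite-dimensional \<open>M \<subseteq> J(\<Phi>)\<close>
  (\<open>coordinate_or_system\<close>).

  Either some coordinate map \<open>x \<mapsto> x\<^sub>n\<close> is bounded below on a closed infinite-dimensional
  \<open>L \<subseteq> M\<close>. Then \<open>L\<close> is isomorphic to a closed subspace of \<open>X\<^sub>n\<close>, and what the hypothesis on
  \<open>X\<^sub>n\<close> provides there pulls back to \<open>L\<close>: if \<open>S\<close> is the inverse of the embedding and \<open>Q\<close> a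
  projection of \<open>X\<^sub>n\<close> onto a subspace of the image, then \<open>x \<mapsto> S (Q x\<^sub>n)\<close> is a projection defined
  on all of the large space (locale \<open>embedding_on\<close>).

  Or no coordinate map is bounded below on such a subspace. Then every \<open>x \<mapsto> x\<^sub>n\<close> is arbitrarily
  small on suitable infinite-dimensional subspaces (\<open>small_seminorm_subspace\<close>), so \<open>M\<close> contains
  unit vectors with negligible beginnings, and by \<open>x\<^sub>n \<rightarrow> 0\<close> also with negligible tails
  (\<open>tail_small\<close>). Up to a small error \<open>M\<close> thus contains a sequence of blocks \<open>u\<^sub>k\<close> that vanish at
  both ends of consecutive intervals \<open>[e\<^sub>k, e\<^sub>k\<^sub>+\<^sub>1]\<close>. Disjoint supports give an upper \<open>\<ell>\<^sub>2\<close>-estimate.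
  The variations over the intervals are seminorms whose squares add up to at most \<open>\<nu>\<^sup>2\<close>, and
  each block is normed by the variation over its own interval; Hahn-Banach functionals dominated
  by these seminorms are therefore biorthogonal to the blocks and satisfy a Bessel inequality.
  Such a biorthogonal system spans a complemented copy of \<open>\<ell>\<^sub>2\<close>, and it survives small
  perturbations, so \<open>M\<close> itself contains one (\<open>gliding_hump\<close>, \<open>ell2_system_perturb\<close>,
  \<open>ell2_system_span\<close>).

  For the third statement the two hypotheses have to be combined: a complemented subspace of
  \<open>X\<^sub>n\<close> found inside a copy of \<open>\<ell>\<^sub>2\<close> must contain a copy of \<open>\<ell>\<^sub>2\<close> that is complemented as well.
  This is a statement about \<open>\<ell>\<^sub>2\<close>, which is itself the space \<open>J\<close> of the chain of scalar fields
  with zero maps; the second alternative of the dichotomy always holds there, since an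
  infinite-dimensional space does not embed into the scalars.
\<close>

section \<open>Bounded functionals from seminorms\<close>

definition linear_map_on ::
  "('k \<Rightarrow> 'a::ab_group_add \<Rightarrow> 'a) \<Rightarrow> ('k \<Rightarrow> 'b::ab_group_add \<Rightarrow> 'b) \<Rightarrow> 'a set \<Rightarrow> ('a \<Rightarrow> 'b) \<Rightarrow> bool"
  where "linear_map_on smul smul' V T \<longleftrightarrow>
    (\<forall>x\<in>V. \<forall>y\<in>V. T (x + y) = T x + T y) \<and> (\<forall>c. \<forall>x\<in>V. T (smul c x) = smul' c (T x))"

definition seminorm_on ::
  "('k::real_normed_field \<Rightarrow> 'a::ab_group_add \<Rightarrow> 'a) \<Rightarrow> 'a set \<Rightarrow> ('a \<Rightarrow> real) \<Rightarrow> bool"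
  where "seminorm_on smul V p \<longleftrightarrow>
    (\<forall>x\<in>V. \<forall>y\<in>V. p (x + y) \<le> p x + p y) \<and> (\<forall>c. \<forall>x\<in>V. p (smul c x) = norm c * p x)"

locale linear_carrier = vector_space smul
  for smul :: "'k::real_or_complex \<Rightarrow> 'a::ab_group_add \<Rightarrow> 'a" +
  fixes V :: "'a set"
  assumes carrier: "subspace V"
begin

lemma zero_in [simp]: "0 \<in> V"
  and add_in: "x \<in> V \<Longrightarrow> y \<in> V \<Longrightarrow> x + y \<in> V"
  and scale_in: "x \<in> V \<Longrightarrow> smul c x \<in> V"
  and minus_in: "x \<in> V \<Longrightarrow> - x \<in> V"
  and diff_in: "x \<in> V \<Longrightarrow> y \<in> V \<Longrightarrow> x - y \<in> V"
  using carrier by (simp_all add: subspace_0 subspace_add subspace_scale subspace_neg subspace_diff)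

lemma sum_in: "(\<And>i. i \<in> I \<Longrightarrow> x i \<in> V) \<Longrightarrow> sum x I \<in> V"
  using carrier by (rule subspace_sum)

lemma smul_minus_one: "smul (- 1) x = - x"
  by simp

lemma linear_map_zero: "linear_map_on smul smul' V T \<Longrightarrow> T 0 = 0"
  by (metis add_cancel_right_left linear_map_on_def zero_in)

lemma linear_map_minus: "linear_map_on smul smul' V T \<Longrightarrow> x \<in> V \<Longrightarrow> T (- x) = - T x"
proof -
  assume T: "linear_map_on smul smul' V T" and x: "x \<in> V"
  have "T (x + - x) = T x + T (- x)" using T x minus_in[OF x] unfolding linear_map_on_def by blast
  then show ?thesis using linear_map_zero[OF T] by (simp add: eq_neg_iff_add_eq_0 add.commute)
qed

lemma linear_map_diff:
  "linear_map_on smul smul' V T \<Longrightarrow> x \<in> V \<Longrightarrow> y \<in> V \<Longrightarrow> T (x - y) = T x - T y"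
proof -
  assume T: "linear_map_on smul smul' V T" and x: "x \<in> V" "y \<in> V"
  have "T (x + - y) = T x + T (- y)"
    using T x minus_in[of y] unfolding linear_map_on_def by blast
  then show ?thesis using linear_map_minus[OF T] x by simp
qed

lemma linear_map_sum:
  assumes "linear_map_on smul smul' V T" and "finite I" and "\<And>i. i \<in> I \<Longrightarrow> x i \<in> V"
  shows "T (sum x I) = (\<Sum>i\<in>I. T (x i))"
  using assms(2,3)
proof (induction I rule: finite_induct)
  case empty
  then show ?case using linear_map_zero[OF assms(1)] by simp
next
  case (insert i I)
  then have "T (x i + sum x I) = T (x i) + T (sum x I)"
    using assms(1) sum_in[of I x] by (simp add: linear_map_on_def)
  then show ?case using insert by simp
qed

lemma seminorm_zero: "seminorm_on smul V p \<Longrightarrow> p 0 = 0"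
  using zero_in unfolding seminorm_on_def by (metis mult_zero_left norm_zero scale_zero_left)

lemma seminorm_minus: "seminorm_on smul V p \<Longrightarrow> x \<in> V \<Longrightarrow> p (- x) = p x"
  unfolding seminorm_on_def by (metis mult_1 norm_minus_cancel norm_one smul_minus_one)

lemma seminorm_nonneg: "seminorm_on smul V p \<Longrightarrow> x \<in> V \<Longrightarrow> 0 \<le> p x"
proof -
  assume p: "seminorm_on smul V p" and x: "x \<in> V"
  have "p (x + - x) \<le> p x + p (- x)"
    using p x minus_in[OF x] unfolding seminorm_on_def by blast
  then show ?thesis using seminorm_zero[OF p] seminorm_minus[OF p x] by simp
qed

lemma seminorm_diff: "seminorm_on smul V p \<Longrightarrow> x \<in> V \<Longrightarrow> y \<in> V \<Longrightarrow> p (x - y) \<le> p x + p y"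
proof -
  assume p: "seminorm_on smul V p" and x: "x \<in> V" "y \<in> V"
  have "p (x + - y) \<le> p x + p (- y)"
    using p x minus_in[of y] unfolding seminorm_on_def by blast
  then show ?thesis using seminorm_minus[OF p] x by simp
qed

lemma seminorm_sum:
  assumes p: "seminorm_on smul V p" and "finite I" and "\<And>i. i \<in> I \<Longrightarrow> x i \<in> V"
  shows "p (sum x I) \<le> (\<Sum>i\<in>I. p (x i))"
  using assms(2,3)
proof (induction I rule: finite_induct)
  case empty
  then show ?case using seminorm_zero[OF p] by simp
next
  case (insert i I)
  then have "p (x i + sum x I) \<le> p (x i) + p (sum x I)"
    using p sum_in[of I x] by (simp add: seminorm_on_def)
  then show ?case using insert by simp
qed

text \<open>
  Sublinearity over the reals, also when the scalars are complex: a functional is first found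
  with real values and is made linear over the scalars afterwards.
\<close>

definition sublinear :: "('a \<Rightarrow> real) \<Rightarrow> bool" where
  "sublinear q \<longleftrightarrow> (\<forall>x\<in>V. \<forall>y\<in>V. q (x + y) \<le> q x + q y) \<and>
     (\<forall>r\<ge>0. \<forall>x\<in>V. q (smul (of_real r) x) = r * q x)"

lemma sublinear_add: "sublinear q \<Longrightarrow> x \<in> V \<Longrightarrow> y \<in> V \<Longrightarrow> q (x + y) \<le> q x + q y"
  and sublinear_scale: "sublinear q \<Longrightarrow> 0 \<le> r \<Longrightarrow> x \<in> V \<Longrightarrow> q (smul (of_real r) x) = r * q x"
  by (auto simp: sublinear_def)

lemma sublinear_zero: "sublinear q \<Longrightarrow> q 0 = 0"
  using sublinear_scale[of q 0 0] by simp

lemma sublinear_lower: "sublinear q \<Longrightarrow> x \<in> V \<Longrightarrow> - q (- x) \<le> q x"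
  using sublinear_add[of q x "- x"] sublinear_zero[of q] minus_in by simp

text \<open>
  For a sublinear \<open>q\<close> the tilt along \<open>y\<close> is a sublinear functional below \<open>q\<close> that takes a value at
  most \<open>- q y\<close> at \<open>- y\<close>. So a sublinear functional that lies below all of its tilts is additive.
\<close>

definition tilt :: "('a \<Rightarrow> real) \<Rightarrow> 'a \<Rightarrow> 'a \<Rightarrow> real" where
  "tilt q y x = (INF t\<in>{0..}. q (x + smul (of_real t) y) - t * q y)"

lemma tilt_lower:
  assumes "sublinear q" "x \<in> V" "y \<in> V" "0 \<le> t"
  shows "- q (- x) \<le> q (x + smul (of_real t) y) - t * q y"
  using sublinear_add[of q "x + smul (of_real t) y" "- x"] sublinear_scale[of q t y]
    add_in minus_in scale_in assms by simp

lemma tilt_le: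
  assumes "sublinear q" "x \<in> V" "y \<in> V" "0 \<le> t"
  shows "tilt q y x \<le> q (x + smul (of_real t) y) - t * q y"
  unfolding tilt_def
proof (rule cINF_lower)
  show "bdd_below ((\<lambda>t. q (x + smul (of_real t) y) - t * q y) ` {0..})"
    using tilt_lower[OF assms(1-3)] by (intro bdd_belowI2[of _ "- q (- x)"]) auto
qed (use assms in auto)

lemma tilt_ge:
  assumes "\<And>t. 0 \<le> t \<Longrightarrow> b \<le> q (x + smul (of_real t) y) - t * q y"
  shows "b \<le> tilt q y x"
  unfolding tilt_def by (rule cINF_greatest) (use assms in auto)

lemma tilt_sublinear:
  assumes q: "sublinear q" and y: "y \<in> V"
  shows "sublinear (tilt q y)"
proof -
  have scale_le: "r * tilt q y x \<le> tilt q y (smul (of_real r) x)" if "r > 0" "x \<in> V" for r x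
  proof (rule tilt_ge)
    fix t :: real assume t: "0 \<le> t"
    have "smul (of_real r) x + smul (of_real t) y
        = smul (of_real r) (x + smul (of_real (t / r)) y)"
      using that by (simp add: scale_right_distrib)
    then have "q (smul (of_real r) x + smul (of_real t) y) - t * q y
        = r * (q (x + smul (of_real (t / r)) y) - (t / r) * q y)"
      using sublinear_scale[OF q, of r] that y by (simp add: add_in scale_in right_diff_distrib)
    moreover have "tilt q y x \<le> q (x + smul (of_real (t / r)) y) - (t / r) * q y"
      using that t y by (intro tilt_le[OF q]) auto
    ultimately show "r * tilt q y x \<le> q (smul (of_real r) x + smul (of_real t) y) - t * q y"
      using that by simp
  qed
  have scale: "tilt q y (smul (of_real r) x) = r * tilt q y x" if "r > 0" "x \<in> V" for r x
  proof (rule antisym)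
    have "(1 / r) * tilt q y (smul (of_real r) x) \<le> tilt q y (smul (of_real (1 / r)) (smul (of_real r) x))"
      using that by (intro scale_le) (auto intro: scale_in)
    also have "smul (of_real (1 / r)) (smul (of_real r) x) = x"
      using that by simp
    finally show "tilt q y (smul (of_real r) x) \<le> r * tilt q y x"
      using that by (simp add: field_simps)
  qed (rule scale_le[OF that])
  have zero: "tilt q y 0 = 0"
  proof (rule antisym)
    show "tilt q y 0 \<le> 0" using tilt_le[OF q, of 0 y 0] y sublinear_zero[OF q] by simp
    show "0 \<le> tilt q y 0"
      by (rule tilt_ge) (use sublinear_scale[OF q] y in simp)
  qed
  have add: "tilt q y (x + x') \<le> tilt q y x + tilt q y x'" if x: "x \<in> V" "x' \<in> V" for x x'
  proof -
    have "tilt q y (x + x') - (q (x' + smul (of_real s) y) - s * q y) \<le> tilt q y x" if s: "0 \<le> s" for s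
    proof (rule tilt_ge)
      fix t :: real assume t: "0 \<le> t"
      have "tilt q y (x + x') \<le> q ((x + x') + smul (of_real (t + s)) y) - (t + s) * q y"
        using s t x y by (intro tilt_le[OF q]) (auto intro: add_in)
      also have "(x + x') + smul (of_real (t + s)) y = (x + smul (of_real t) y) + (x' + smul (of_real s) y)"
        by (simp add: scale_left_distrib algebra_simps)
      also have "q \<dots> \<le> q (x + smul (of_real t) y) + q (x' + smul (of_real s) y)"
        using x y by (intro sublinear_add[OF q] add_in scale_in)
      finally show "tilt q y (x + x') - (q (x' + smul (of_real s) y) - s * q y)
          \<le> q (x + smul (of_real t) y) - t * q y"
        by (simp add: algebra_simps)
    qed
    then have "tilt q y (x + x') - tilt q y x \<le> tilt q y x'"
      by (intro tilt_ge) (simp add: algebra_simps)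
    then show ?thesis by simp
  qed
  show ?thesis unfolding sublinear_def
    using add scale zero by (metis less_eq_real_def mult_zero_left of_real_0 scale_zero_left)
qed

text \<open>
  Zorn's lemma applies because a chain of sublinear functionals below \<open>p\<close> is bounded below at
  each point \<open>x\<close> by \<open>- p (- x)\<close>, so that its pointwise infimum is sublinear again.
\<close>

lemma minimal_sublinear:
  assumes p: "sublinear p"
  obtains g where "sublinear g" "\<And>x. x \<in> V \<Longrightarrow> g x \<le> p x"
    "\<And>q. sublinear q \<Longrightarrow> \<forall>x\<in>V. q x \<le> g x \<Longrightarrow> \<forall>x\<in>V. q x = g x"
proof -
  \<comment> \<open>Functions on the carrier are normalised to 0 outside, which makes the pointwise order antisymmetric.\<close>
  define A where "A = {q. sublinear q \<and> (\<forall>x\<in>V. q x \<le> p x) \<and> (\<forall>x. x \<notin> V \<longrightarrow> q x = 0)}"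
  define P where "P = (\<lambda>a b :: 'a \<Rightarrow> real. \<forall>x. b x \<le> a x)"
  have restr: "sublinear (\<lambda>x. if x \<in> V then q x else 0)" if "sublinear q" for q
    using that by (auto simp: sublinear_def add_in scale_in)
  have po: "partial_order_on A (relation_of P A)"
  proof (rule partial_order_on_relation_ofI)
    show "P a a" for a by (simp add: P_def)
    show "P a c" if "P a b" "P b c" for a b c
      using that unfolding P_def by (meson order_trans)
    show "a = b" if "P a b" "P b a" for a b
      using that unfolding P_def by (intro ext antisym) auto
  qed
  have "\<exists>m\<in>A. \<forall>a\<in>A. P m a \<longrightarrow> a = m"
  proof (rule predicate_Zorn[OF po])
    fix C assume C: "C \<in> Chains (relation_of P A)"
    show "\<exists>u\<in>A. \<forall>a\<in>C. P a u"
    proof (cases "C = {}")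
      case True
      have "(\<lambda>x. if x \<in> V then p x else 0) \<in> A" using restr[OF p] by (auto simp: A_def)
      with True show ?thesis by blast
    next
      case False
      have CA: "C \<subseteq> A" using C by (rule Chains_relation_of)
      have cmp: "P a b \<or> P b a" if "a \<in> C" "b \<in> C" for a b
        using C that unfolding Chains_def relation_of_def by auto
      define u where "u = (\<lambda>x. INF q\<in>C. q x)"
      have lower: "- p (- x) \<le> q x" if "q \<in> C" "x \<in> V" for q x
        using that CA sublinear_lower[of q x] minus_in[of x] unfolding A_def by force
      have u_le: "u x \<le> q x" if "q \<in> C" "x \<in> V" for q x
        unfolding u_def using that lower by (intro cINF_lower bdd_belowI2[of _ "- p (- x)"]) auto
      have u_ge: "b \<le> u x" if "\<And>q. q \<in> C \<Longrightarrow> b \<le> q x" for b x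
        unfolding u_def using False that by (intro cINF_greatest) auto
      have out: "u x = 0" if "x \<notin> V" for x
      proof -
        have "q x = 0" if "q \<in> C" for q using CA that \<open>x \<notin> V\<close> by (auto simp: A_def)
        then have "(\<lambda>q. q x) ` C = {0}" using False by (auto simp: image_iff)
        then show ?thesis by (simp add: u_def)
      qed
      have sub: "sublinear u" unfolding sublinear_def
      proof (intro conjI ballI allI impI)
        fix x y assume xy: "x \<in> V" "y \<in> V"
        have "u (x + y) - q' y \<le> u x" if q': "q' \<in> C" for q'
        proof (rule u_ge)
          fix q assume q: "q \<in> C"
          obtain r where r: "r \<in> C" "r x \<le> q x" "r y \<le> q' y"
            using cmp[OF q q'] q q' unfolding P_def by (metis order_refl)
          have "u (x + y) \<le> r (x + y)" using r xy by (intro u_le) (auto intro: add_in)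
          also have "\<dots> \<le> r x + r y" using r CA xy unfolding A_def by (auto intro: sublinear_add)
          finally show "u (x + y) - q' y \<le> q x" using r by linarith
        qed
        then have "u (x + y) - u x \<le> u y" by (intro u_ge) (simp add: algebra_simps)
        then show "u (x + y) \<le> u x + u y" by simp
      next
        fix r :: real and x assume r: "0 \<le> r" and x: "x \<in> V"
        have sc: "q (smul (of_real r) x) = r * q x" if "q \<in> C" for q
          using that CA r x by (auto simp: A_def sublinear_scale)
        show "u (smul (of_real r) x) = r * u x"
        proof (cases "r = 0")
          case True
          have "(\<lambda>q. q 0) ` C = {0}" using False CA
            by (force simp: A_def sublinear_zero image_iff)
          then show ?thesis using True by (simp add: u_def)
        next
          case rp: False
          show ?thesis
          proof (rule antisym)
            have "u (smul (of_real r) x) / r \<le> u x"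
              using u_le[OF _ scale_in[OF x]] sc r rp by (intro u_ge) (simp add: field_simps)
            then show "u (smul (of_real r) x) \<le> r * u x" using r rp by (simp add: field_simps)
            show "r * u x \<le> u (smul (of_real r) x)"
              using mult_left_mono[OF u_le[OF _ x] r] sc by (intro u_ge) simp
          qed
        qed
      qed
      have "u x \<le> p x" if "x \<in> V" for x
        using False u_le that CA unfolding A_def by (force intro: order_trans)
      then have "u \<in> A" using sub out by (simp add: A_def)
      moreover have "P a u" if "a \<in> C" for a
        unfolding P_def using u_le[OF that] out CA that by (force simp: A_def)
      ultimately show ?thesis by blast
    qed
  qed
  then obtain m where m: "m \<in> A" "\<And>a. a \<in> A \<Longrightarrow> P m a \<Longrightarrow> a = m" by blast
  show thesis
  proof
    show "sublinear m" "\<And>x. x \<in> V \<Longrightarrow> m x \<le> p x" using m(1) by (auto simp: A_def)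
    fix q assume q: "sublinear q" "\<forall>x\<in>V. q x \<le> m x"
    define q' where "q' = (\<lambda>x. if x \<in> V then q x else 0)"
    have "q' \<in> A" using restr[OF q(1)] q(2) m(1) unfolding A_def q'_def
      by (auto intro: order_trans)
    moreover have "P m q'" using q(2) m(1) by (auto simp: P_def q'_def A_def)
    ultimately have "q' = m" using m(2) by blast
    then show "\<forall>x\<in>V. q x = m x" by (auto simp: q'_def)
  qed
qed

text \<open>
  The Hahn-Banach theorem. A minimal sublinear functional agrees with all of its tilts and is
  therefore linear. Minimising below the tilt of \<open>p\<close> along \<open>u\<close> instead of below \<open>p\<close> forces the
  value \<open>p u\<close> at \<open>u\<close>.
\<close>

lemma dominated_real_functional:
  assumes p: "sublinear p" and u: "u \<in> V"
  obtains g where "\<And>x y. x \<in> V \<Longrightarrow> y \<in> V \<Longrightarrow> g (x + y) = g x + g y"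
    "\<And>r x. x \<in> V \<Longrightarrow> g (smul (of_real r) x) = r * g x"
    "\<And>x. x \<in> V \<Longrightarrow> g x \<le> p x" "g u = p u"
proof -
  obtain g where g: "sublinear g" "\<And>x. x \<in> V \<Longrightarrow> g x \<le> tilt p u x"
    and min: "\<And>q. sublinear q \<Longrightarrow> \<forall>x\<in>V. q x \<le> g x \<Longrightarrow> \<forall>x\<in>V. q x = g x"
    by (rule minimal_sublinear[OF tilt_sublinear[OF p u]], rule that)
  have le: "g x \<le> p x" if "x \<in> V" for x
    using g(2)[OF that] tilt_le[OF p that u, of 0] by simp
  have add: "g (x + y) = g x + g y" if xy: "x \<in> V" "y \<in> V" for x y
  proof (rule antisym)
    have "tilt g y z \<le> g z" if "z \<in> V" for z
      using tilt_le[OF g(1) that xy(2), of 0] by simp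
    then have "tilt g y x = g x" using min[OF tilt_sublinear[OF g(1) xy(2)]] xy by blast
    then show "g x + g y \<le> g (x + y)"
      using tilt_le[OF g(1) xy, of 1] by simp
  qed (use g(1) xy in \<open>rule sublinear_add\<close>)
  have neg: "g (- x) = - g x" if "x \<in> V" for x
    using add[OF that minus_in[OF that]] sublinear_zero[OF g(1)] by simp
  have scale: "g (smul (of_real r) x) = r * g x" if x: "x \<in> V" for r x
  proof (cases "0 \<le> r")
    case False
    have "g (smul (of_real r) x) = g (- smul (of_real (- r)) x)" by simp
    also have "\<dots> = - g (smul (of_real (- r)) x)" using x by (intro neg scale_in)
    also have "\<dots> = r * g x" using False x by (simp add: sublinear_scale[OF g(1)] del: of_real_minus)
    finally show ?thesis .
  qed (use sublinear_scale[OF g(1)] x in simp)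
  have "- g u \<le> - p u"
  proof -
    have "- g u = g (- u)" using neg u by simp
    also have "\<dots> \<le> tilt p u (- u)" using g(2) minus_in[OF u] by blast
    also have "\<dots> \<le> p (- u + smul (of_real 1) u) - 1 * p u"
      using u minus_in by (intro tilt_le[OF p]) auto
    finally show ?thesis using sublinear_zero[OF p] by simp
  qed
  then have "g u = p u" using le[OF u] by simp
  then show thesis using that add scale le by blast
qed

end

text \<open>
  Only \<open>j\<^sup>2 = - 1\<close> is known about \<open>j\<close>, so the factor \<open>a - b j\<close> takes the role of the complex
  conjugate; the triangle inequality for it costs the constant 2.
\<close>

lemma norm_scalar_lower:
  fixes j :: "'k::real_or_complex"
  assumes j: "j * j = - 1"
  shows "\<bar>a\<bar> + \<bar>b\<bar> \<le> 2 * norm (of_real a + of_real b * j)"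
proof -
  have nj: "norm j = 1"
  proof -
    have "norm j * norm j = 1" using j by (metis norm_minus_cancel norm_mult norm_one)
    then show ?thesis by (metis abs_norm_cancel abs_square_eq_1 power2_eq_square)
  qed
  let ?z = "of_real a + of_real b * j"
  have "?z * (of_real a - of_real b * j) = of_real (a\<^sup>2 + b\<^sup>2)"
  proof -
    have "?z * (of_real a - of_real b * j) = of_real a * of_real a - of_real b * of_real b * (j * j)"
      by (simp add: algebra_simps)
    then show ?thesis using j by (simp add: power2_eq_square)
  qed
  then have "norm ?z * norm (of_real a - of_real b * j) = a\<^sup>2 + b\<^sup>2"
    by (metis abs_of_nonneg norm_mult norm_of_real sum_power2_ge_zero)
  moreover have "norm (of_real a - of_real b * j) \<le> \<bar>a\<bar> + \<bar>b\<bar>"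
    by (rule order_trans[OF norm_triangle_ineq4]) (simp add: norm_mult nj)
  ultimately have "a\<^sup>2 + b\<^sup>2 \<le> norm ?z * (\<bar>a\<bar> + \<bar>b\<bar>)"
    by (metis mult_left_mono norm_ge_zero)
  moreover have "(\<bar>a\<bar> + \<bar>b\<bar>) * (\<bar>a\<bar> + \<bar>b\<bar>) \<le> 2 * (a\<^sup>2 + b\<^sup>2)"
    using sum_squares_bound[of "\<bar>a\<bar>" "\<bar>b\<bar>"] by (simp add: power2_eq_square algebra_simps)
  ultimately have "(\<bar>a\<bar> + \<bar>b\<bar>) * (\<bar>a\<bar> + \<bar>b\<bar>) \<le> (2 * norm ?z) * (\<bar>a\<bar> + \<bar>b\<bar>)" by simp
  moreover have "S \<le> B" if "S * S \<le> B * S" "0 \<le> S" "0 \<le> B" for S B :: real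
    using that mult_right_le_imp_le[of S S B] by (cases "S = 0") auto
  ultimately show ?thesis by (meson add_nonneg_nonneg abs_ge_zero norm_ge_zero mult_nonneg_nonneg zero_le_numeral)
qed

context linear_carrier begin

text \<open>
  The real functional \<open>g\<close> becomes linear over the scalars as \<open>f x = g x - j g (j x)\<close>; for real
  scalars \<open>j = 0\<close> and \<open>f = g\<close>. The factor 4 comes from the crude comparison of \<open>f\<close> with
  \<open>g\<close> in both directions; what matters later is that it does not depend on \<open>u\<close>.
\<close>

lemma dominated_functional:
  assumes p: "seminorm_on smul V p" and u: "u \<in> V" and pu: "p u > 0"
  obtains f where "linear_map_on smul (*) V f" "f u = 1"
    "\<And>x. x \<in> V \<Longrightarrow> norm (f x) \<le> 4 / p u * p x"
proof -
  obtain j :: 'k where j: "j = 0 \<or> j * j = - 1" and rep: "\<And>z. \<exists>a b. z = scaleR a 1 + scaleR b j"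
    using real_or_complex by metis
  have sub: "sublinear p" using p by (auto simp: sublinear_def seminorm_on_def)
  obtain g where add: "\<And>x y. x \<in> V \<Longrightarrow> y \<in> V \<Longrightarrow> g (x + y) = g x + g y"
    and scale: "\<And>r x. x \<in> V \<Longrightarrow> g (smul (of_real r) x) = r * g x"
    and le: "\<And>x. x \<in> V \<Longrightarrow> g x \<le> p x" and gu: "g u = p u"
    by (rule dominated_real_functional[OF sub u], rule that)
  have g0: "g 0 = 0" using scale[of 0 0] by simp
  have abs: "\<bar>g x\<bar> \<le> p x" if x: "x \<in> V" for x
    using le[OF x] le[OF minus_in[OF x]] scale[OF x, of "- 1"] seminorm_minus[OF p x] by simp
  have nj: "norm j \<le> 1"
  proof (cases "j = 0")
    case False
    then have "norm j * norm j = 1" using j by (metis norm_minus_cancel norm_mult norm_one)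
    then show ?thesis by (metis abs_norm_cancel abs_square_eq_1 power2_eq_square order_refl)
  qed simp
  define h where "h x = of_real (g x) - j * of_real (g (smul j x))" for x
  have h_add: "h (x + y) = h x + h y" if "x \<in> V" "y \<in> V" for x y
    using that by (simp add: h_def add scale_in scale_right_distrib algebra_simps)
  have h_real: "h (smul (of_real r) x) = of_real r * h x" if "x \<in> V" for r x
  proof -
    have "smul j (smul (of_real r) x) = smul (of_real r) (smul j x)" by (simp add: mult.commute)
    then show ?thesis using that by (simp add: h_def scale scale_in algebra_simps del: scale_scale)
  qed
  have h_j: "h (smul j x) = j * h x" if x: "x \<in> V" for x
  proof (cases "j = 0")
    case True
    then show ?thesis by (simp add: h_def g0)
  next
    case False
    then have jj: "j * j = - 1" using j by blast
    have "smul j (smul j x) = - x" using jj by simp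
    moreover have "g (- x) = - g x" using scale[OF x, of "- 1"] by simp
    moreover have "j * (j * z) = - z" for z :: 'k using jj by (metis mult.assoc mult_minus1)
    ultimately show ?thesis by (simp add: h_def right_diff_distrib del: scale_scale)
  qed
  have h_scale: "h (smul c x) = c * h x" if x: "x \<in> V" for c x
  proof -
    obtain a b where c: "c = of_real a + of_real b * j"
      using rep[of c] by (auto simp: scaleR_conv_of_real)
    have "smul c x = smul (of_real a) x + smul (of_real b) (smul j x)"
      by (simp add: c scale_left_distrib)
    then have "h (smul c x) = of_real a * h x + of_real b * (j * h x)"
      using x by (simp add: h_add h_real h_j scale_in del: scale_scale)
    then show ?thesis by (simp add: c algebra_simps)
  qed
  have h_bound: "norm (h x) \<le> 2 * p x" if x: "x \<in> V" for x
  proof -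
    have "norm (h x) \<le> norm (of_real (g x) :: 'k) + norm (j * of_real (g (smul j x)))"
      unfolding h_def by (rule norm_triangle_ineq4)
    also have "\<dots> = \<bar>g x\<bar> + norm j * \<bar>g (smul j x)\<bar>" by (simp add: norm_mult)
    also have "\<dots> \<le> p x + 1 * p x"
    proof (intro add_mono mult_mono)
      have "\<bar>g (smul j x)\<bar> \<le> p (smul j x)" using x by (intro abs scale_in)
      also have "\<dots> = norm j * p x" using p x by (simp add: seminorm_on_def)
      also have "\<dots> \<le> p x"
        using nj seminorm_nonneg[OF p x] by (simp add: mult_left_le_one_le)
      finally show "\<bar>g (smul j x)\<bar> \<le> p x" .
    qed (use abs x nj in auto)
    finally show ?thesis by simp
  qed
  have hu: "p u \<le> 2 * norm (h u)"
  proof (cases "j = 0")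
    case True
    then show ?thesis using gu pu by (simp add: h_def)
  next
    case False
    then have "j * j = - 1" using j by blast
    from norm_scalar_lower[OF this, of "g u" "- g (smul j u)"]
    have "\<bar>g u\<bar> \<le> 2 * norm (h u)" by (simp add: h_def mult.commute)
    then show ?thesis using gu pu by simp
  qed
  show thesis
  proof
    show "linear_map_on smul (*) V (\<lambda>x. h x / h u)"
      by (simp add: linear_map_on_def h_add h_scale add_divide_distrib)
    show "h u / h u = 1" using hu pu by auto
    fix x assume x: "x \<in> V"
    have "norm (h x / h u) \<le> (2 * p x) / (p u / 2)"
      unfolding norm_divide using h_bound[OF x] hu pu seminorm_nonneg[OF p x]
      by (intro frac_le) auto
    then show "norm (h x / h u) \<le> 4 / p u * p x" by simp
  qed
qed

end

section \<open>Infinite-dimensional subspaces\<close>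

lemma (in linear_carrier) linear_map_image_subspace:
  assumes "vector_space smul'" and "linear_map_on smul smul' V T"
  shows "module.subspace smul' (T ` V)"
proof -
  interpret W: vector_space smul' by fact
  have add: "T x + T y = T (x + y)" and sc: "smul' c (T x) = T (smul c x)"
    if "x \<in> V" "y \<in> V" for x y c
    using assms(2) that by (simp_all add: linear_map_on_def)
  show ?thesis
  proof (rule W.subspaceI)
    show "0 \<in> T ` V" using linear_map_zero[OF assms(2)] by (metis image_eqI zero_in)
  qed (use add sc add_in scale_in in auto)
qed

lemma linear_map_on_subset: "linear_map_on smul smul' V T \<Longrightarrow> M \<subseteq> V \<Longrightarrow> linear_map_on smul smul' M T"
  by (simp add: linear_map_on_def subset_iff)

lemma (in linear_carrier) infinite_dimensional_image:
  assumes W: "vector_space smul'" and T: "linear_map_on smul smul' V T" and inj: "inj_on T V"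
    and inf: "infinite_dimensional smul V"
  shows "infinite_dimensional smul' (T ` V)"
  unfolding infinite_dimensional_def
proof
  interpret W: vector_space smul' by fact
  assume "\<exists>B. finite B \<and> W.span B = T ` V"
  then obtain B where B: "finite B" "W.span B = T ` V" by blast
  have sub: "B \<subseteq> T ` V" using B(2) W.span_superset[of B] by simp
  let ?C = "inv_into V T ` B"
  have CV: "?C \<subseteq> V" using sub by (auto intro: inv_into_into)
  then have span: "span ?C \<subseteq> V" using carrier by (rule span_minimal)
  have "module.subspace smul' (T ` span ?C)"
  proof -
    interpret C: linear_carrier smul "span ?C" by unfold_locales simp
    show ?thesis using W T span by (intro C.linear_map_image_subspace linear_map_on_subset[OF T])
  qed
  moreover have "B \<subseteq> T ` span ?C"
  proof
    fix b assume "b \<in> B"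
    then have "b = T (inv_into V T b)" "inv_into V T b \<in> span ?C"
      using sub span_superset[of ?C] by (auto simp: f_inv_into_f)
    then show "b \<in> T ` span ?C" by blast
  qed
  ultimately have "T ` V \<subseteq> T ` span ?C" using W.span_minimal B by metis
  then have "V \<subseteq> span ?C" using inj_on_image_subset_iff[OF inj order_refl span] by simp
  with span have "span ?C = V" by blast
  with B inf show False unfolding infinite_dimensional_def by blast
qed

lemma (in linear_carrier) kernel_subspace:
  assumes "linear_map_on smul (*) V f"
  shows "subspace {x \<in> V. f x = 0}"
  using assms linear_map_zero[OF assms] unfolding linear_map_on_def subspace_def
  by (auto intro: add_in scale_in)

text \<open>
  A finite set spanning the kernel would span everything after adding one vector outside.
\<close>

lemma (in linear_carrier) infinite_dimensional_kernel:
  assumes f: "linear_map_on smul (*) V f" and inf: "infinite_dimensional smul V"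
  shows "infinite_dimensional smul {x \<in> V. f x = 0}"
  unfolding infinite_dimensional_def
proof
  assume "\<exists>B. finite B \<and> span B = {x \<in> V. f x = 0}"
  then obtain B where B: "finite B" "span B = {x \<in> V. f x = 0}" by blast
  show False
  proof (cases "\<forall>x\<in>V. f x = 0")
    case True
    then have "{x \<in> V. f x = 0} = V" by auto
    with B inf show False by (auto simp: infinite_dimensional_def)
  next
    case False
    then obtain y where y: "y \<in> V" "f y \<noteq> 0" by blast
    have "V \<subseteq> span (insert y B)"
    proof
      fix x assume x: "x \<in> V"
      let ?z = "x - smul (f x / f y) y"
      have "f (smul (f x / f y) y) = f x" using f y by (simp add: linear_map_on_def)
      then have "f ?z = 0" using linear_map_diff[OF f x scale_in[OF y(1)]] by simp
      then have "?z \<in> span B" using B x y by (auto intro: diff_in scale_in)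
      then show "x \<in> span (insert y B)" using span_breakdown_eq by blast
    qed
    moreover have "span (insert y B) \<subseteq> V"
      using B y span_superset[of B] by (intro span_minimal carrier) auto
    ultimately show False using B(1) inf by (auto simp: infinite_dimensional_def)
  qed
qed

text \<open>
  The functional \<open>g k\<close> separates \<open>y k\<close> from the span of all later \<open>y j\<close>, so the \<open>y k\<close> are linearly
  independent. Triangularity suffices, which is all that a step-by-step choice of vectors in
  successive kernels provides.
\<close>

lemma (in linear_carrier) infinite_dimensional_if_triangular:
  assumes y: "\<And>k. y k \<in> V" and g: "\<And>k. linear_map_on smul (*) V (g k)"
    and diag: "\<And>k :: nat. g k (y k) \<noteq> 0" and tri: "\<And>k j. k < j \<Longrightarrow> g k (y j) = 0"
  shows "infinite_dimensional smul V"
  unfolding infinite_dimensional_def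
proof
  assume "\<exists>B. finite B \<and> span B = V"
  then obtain B where B: "finite B" "span B = V" by blast
  have notin: "y k \<notin> span (y ` {k<..<n})" for k n
  proof
    assume "y k \<in> span (y ` {k<..<n})"
    moreover have "span (y ` {k<..<n}) \<subseteq> {x \<in> V. g k x = 0}"
      using y tri by (intro span_minimal kernel_subspace[OF g]) auto
    ultimately show False using diag by blast
  qed
  have ind: "independent (y ` {n - m..<n})" if "m \<le> n" for m n
    using that
  proof (induction m)
    case 0
    then show ?case by (simp add: independent_empty)
  next
    case (Suc m)
    then have "{n - Suc m..<n} = insert (n - Suc m) {n - Suc m<..<n}" "{n - Suc m<..<n} = {n - m..<n}"
      by auto
    then show ?case using Suc notin[of "n - Suc m" n]
      by (simp add: independent_insert)
  qed
  have inj: "inj y"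
  proof (rule linorder_injI)
    fix i j :: nat assume "i < j"
    then show "y i \<noteq> y j" using diag[of i] tri[of i j] by metis
  qed
  let ?n = "Suc (card B)"
  have "independent (y ` {0..<?n})" using ind[of ?n ?n] by simp
  then have "card (y ` {0..<?n}) \<le> card B"
    using independent_span_bound[OF B(1)] y B(2) by blast
  moreover have "card (y ` {0..<?n}) = ?n"
    using inj by (subst card_image) (auto intro: inj_on_subset)
  ultimately show False by simp
qed

section \<open>Closed subspaces and series\<close>

sublocale normed_space_on \<subseteq> linear_carrier smul V
  by unfold_locales (rule subspace_carrier)

context normed_space_on begin

lemma seminorm_N: "seminorm_on smul V N"
  by (auto simp: seminorm_on_def N_triangle N_scale)

lemmas N_zero = seminorm_zero[OF seminorm_N]
  and N_minus = seminorm_minus[OF seminorm_N]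
  and N_nonneg = seminorm_nonneg[OF seminorm_N]
  and N_diff = seminorm_diff[OF seminorm_N]
  and N_sum = seminorm_sum[OF seminorm_N]

lemma N_diff_commute: "x \<in> V \<Longrightarrow> y \<in> V \<Longrightarrow> N (x - y) = N (y - x)"
  using N_minus[of "x - y"] diff_in by simp

lemma N_triangle_via: "x \<in> V \<Longrightarrow> y \<in> V \<Longrightarrow> z \<in> V \<Longrightarrow> N (x - z) \<le> N (x - y) + N (y - z)"
  using N_triangle[of "x - y" "y - z"] by (simp add: diff_in)

lemma N_le_add_diff: "x \<in> V \<Longrightarrow> y \<in> V \<Longrightarrow> N x \<le> N y + N (x - y)"
  using N_triangle[of y "x - y"] by (simp add: diff_in)

lemma limit_unique:
  assumes "\<And>n. f n \<in> V" "x \<in> V" "y \<in> V"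
    and "(\<lambda>n. N (f n - x)) \<longlonglongrightarrow> 0" "(\<lambda>n. N (f n - y)) \<longlonglongrightarrow> 0"
  shows "x = y"
proof -
  have "(\<lambda>n. N (f n - x) + N (f n - y)) \<longlonglongrightarrow> 0"
    using tendsto_add[OF assms(4,5)] by simp
  moreover have "N (x - y) \<le> N (f n - x) + N (f n - y)" for n
    using N_triangle_via[of x "f n" y] N_diff_commute[of x "f n"] assms by simp
  ultimately have "N (x - y) \<le> 0" by (meson LIMSEQ_le_const)
  then have "N (x - y) = 0" using N_nonneg[of "x - y"] assms diff_in by force
  then show ?thesis using N_eq_zero[of "x - y"] assms diff_in by simp
qed

text \<open>
  Passing to the limit in an estimate for a continuous seminorm; the bound may vary along the
  sequence.
\<close>

lemma seminorm_limit_le: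
  assumes p: "seminorm_on smul V p" and pC: "\<And>x. x \<in> V \<Longrightarrow> p x \<le> C * N x"
    and f: "\<And>n. f n \<in> V" "x \<in> V" "(\<lambda>n. N (f n - x)) \<longlonglongrightarrow> 0"
    and b: "b \<longlonglongrightarrow> B" "\<And>n. p (f n) \<le> b n"
  shows "p x \<le> B"
proof (rule LIMSEQ_le_const)
  show "(\<lambda>n. b n + C * N (f n - x)) \<longlonglongrightarrow> B"
    using tendsto_add[OF b(1) tendsto_mult_left[OF f(3), of C]] by simp
  have "p x \<le> b n + C * N (f n - x)" for n
  proof -
    have "p (f n - (f n - x)) \<le> p (f n) + p (f n - x)"
      using f by (intro seminorm_diff[OF p] diff_in)
    then show ?thesis using b(2)[of n] pC[OF diff_in[OF f(1)[of n] f(2)]] by simp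
  qed
  then show "\<exists>n0. \<forall>n\<ge>n0. p x \<le> b n + C * N (f n - x)" by blast
qed

lemma functional_limit:
  assumes g: "linear_map_on smul (*) V g" and gC: "\<And>x. x \<in> V \<Longrightarrow> norm (g x) \<le> C * N x"
    and f: "\<And>n. f n \<in> V" "x \<in> V" "(\<lambda>n. N (f n - x)) \<longlonglongrightarrow> 0"
  shows "(\<lambda>n. g (f n)) \<longlonglongrightarrow> g x"
proof (rule LIM_zero_cancel, rule Lim_null_comparison)
  show "(\<lambda>n. C * N (f n - x)) \<longlonglongrightarrow> 0" using tendsto_mult_left[OF f(3), of C] by simp
  show "\<forall>\<^sub>F n in sequentially. norm (g (f n) - g x) \<le> C * N (f n - x)"
    using gC[OF diff_in[OF f(1) f(2)]] linear_map_diff[OF g f(1) f(2)] by simp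
qed

lemma closed_subspaceD:
  assumes "closed_subspace smul V N M"
  shows "subspace M" "M \<subseteq> V"
    "(\<And>n. f n \<in> M) \<Longrightarrow> l \<in> V \<Longrightarrow> (\<lambda>n. N (f n - l)) \<longlonglongrightarrow> 0 \<Longrightarrow> l \<in> M"
  using assms unfolding closed_subspace_def by (blast, blast, blast)

lemma closed_subspaceI:
  assumes "subspace M" "M \<subseteq> V"
    "\<And>f l. (\<And>n. f n \<in> M) \<Longrightarrow> l \<in> V \<Longrightarrow> (\<lambda>n. N (f n - l)) \<longlonglongrightarrow> 0 \<Longrightarrow> l \<in> M"
  shows "closed_subspace smul V N M"
  using assms unfolding closed_subspace_def by blast

lemma closed_kernel:
  assumes M: "closed_subspace smul V N M"
    and g: "linear_map_on smul (*) V g" and gC: "\<And>x. x \<in> V \<Longrightarrow> norm (g x) \<le> C * N x"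
  shows "closed_subspace smul V N {x \<in> M. g x = 0}"
proof (rule closed_subspaceI)
  note D = closed_subspaceD[OF M]
  interpret M: linear_carrier smul M by unfold_locales (rule D)
  show "subspace {x \<in> M. g x = 0}" by (rule M.kernel_subspace[OF linear_map_on_subset[OF g D(2)]])
  show "{x \<in> M. g x = 0} \<subseteq> V" using D by blast
  fix f l assume f: "\<And>n. f n \<in> {x \<in> M. g x = 0}" and l: "l \<in> V" "(\<lambda>n. N (f n - l)) \<longlonglongrightarrow> 0"
  have "(\<lambda>n. g (f n)) \<longlonglongrightarrow> g l"
    using f l D(2) by (intro functional_limit[OF g gC]) auto
  moreover have "(\<lambda>n. g (f n)) = (\<lambda>n. 0)" using f by simp
  ultimately have "g l = 0" by (metis LIMSEQ_const_iff)
  then show "l \<in> {x \<in> M. g x = 0}" using D(3)[of f l] f l by simp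
qed

definition closed_span :: "'a set \<Rightarrow> 'a set" where
  "closed_span S = {x \<in> V. \<forall>e>0. \<exists>y\<in>span S. N (x - y) < e}"

lemma closed_span_seq:
  assumes "x \<in> closed_span S" and S: "S \<subseteq> V"
  obtains f where "\<And>n. f n \<in> span S" "(\<lambda>n. N (f n - x)) \<longlonglongrightarrow> 0"
proof -
  have sub: "span S \<subseteq> V" using S carrier by (rule span_minimal)
  have "\<exists>y\<in>span S. N (x - y) < inverse (real (Suc n))" for n
    using assms by (simp add: closed_span_def)
  then obtain f where f: "\<And>n. f n \<in> span S" "\<And>n. N (x - f n) < inverse (real (Suc n))"
    by metis
  have x: "x \<in> V" using assms by (simp add: closed_span_def)
  have fV: "f n \<in> V" for n using f sub by blast
  have "(\<lambda>n. N (f n - x)) \<longlonglongrightarrow> 0"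
  proof (rule Lim_null_comparison[OF _ LIMSEQ_inverse_real_of_nat])
    have "norm (N (f n - x)) \<le> inverse (real (Suc n))" for n
      using f(2)[of n] N_diff_commute[OF x fV] N_nonneg[OF diff_in[OF fV x]]
      by (simp add: less_imp_le)
    then show "\<forall>\<^sub>F n in sequentially. norm (N (f n - x)) \<le> inverse (real (Suc n))" by simp
  qed
  with f that show ?thesis by blast
qed

lemma closed_span_minimal:
  assumes M: "closed_subspace smul V N M" and S: "S \<subseteq> M"
  shows "closed_span S \<subseteq> M"
proof
  fix x assume x: "x \<in> closed_span S"
  note D = closed_subspaceD[OF M]
  obtain f where f: "\<And>n. f n \<in> span S" "(\<lambda>n. N (f n - x)) \<longlonglongrightarrow> 0"
    using closed_span_seq[OF x] S D(2) by blast
  have "span S \<subseteq> M" using S D(1) by (rule span_minimal)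
  then show "x \<in> M" using f x D(3)[of f x] by (auto simp: closed_span_def)
qed

lemma span_subset_closed_span: "S \<subseteq> V \<Longrightarrow> span S \<subseteq> closed_span S"
  using span_minimal[OF _ carrier, of S] N_zero by (force simp: closed_span_def)

lemma closed_closed_span:
  assumes S: "S \<subseteq> V"
  shows "closed_subspace smul V N (closed_span S)"
proof (rule closed_subspaceI)
  have sub: "span S \<subseteq> V" using S carrier by (rule span_minimal)
  show "subspace (closed_span S)"
  proof (rule subspaceI)
    show "0 \<in> closed_span S" using span_subset_closed_span[OF S] span_zero by blast
  next
    fix x y assume xy: "x \<in> closed_span S" "y \<in> closed_span S"
    then have V: "x \<in> V" "y \<in> V" by (auto simp: closed_span_def)
    show "x + y \<in> closed_span S" unfolding closed_span_def
    proof (intro CollectI conjI allI impI)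
      fix e :: real assume "e > 0"
      then have "e / 2 > 0" by simp
      then obtain a b where ab: "a \<in> span S" "b \<in> span S" "N (x - a) < e / 2" "N (y - b) < e / 2"
        using xy unfolding closed_span_def by blast
      have "N ((x + y) - (a + b)) \<le> N (x - a) + N (y - b)"
        using N_triangle[of "x - a" "y - b"] V ab sub by (auto simp: algebra_simps diff_in subset_iff)
      then show "\<exists>z\<in>span S. N (x + y - z) < e"
        using ab by (intro bexI[of _ "a + b"]) (auto intro: span_add)
    qed (use V in \<open>rule add_in\<close>)
  next
    fix c x assume x: "x \<in> closed_span S"
    then have V: "x \<in> V" by (auto simp: closed_span_def)
    show "smul c x \<in> closed_span S" unfolding closed_span_def
    proof (intro CollectI conjI allI impI)
      fix e :: real assume e: "e > 0"
      have "norm c + 1 > 0" by (simp add: add_nonneg_pos)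
      then have "e / (norm c + 1) > 0" using e by simp
      then obtain a where a: "a \<in> span S" "N (x - a) < e / (norm c + 1)"
        using x unfolding closed_span_def by blast
      have aV: "x - a \<in> V" using a sub V diff_in by blast
      have "N (smul c x - smul c a) = norm c * N (x - a)"
        using N_scale[OF aV] by (simp add: scale_right_diff_distrib)
      also have "\<dots> \<le> (norm c + 1) * N (x - a)" using N_nonneg[OF aV] by (simp add: mult_right_mono)
      also have "\<dots> < e" using a(2) \<open>norm c + 1 > 0\<close> by (simp add: field_simps)
      finally show "\<exists>z\<in>span S. N (smul c x - z) < e" using a span_scale by blast
    qed (use V in \<open>rule scale_in\<close>)
  qed
  show "closed_span S \<subseteq> V" by (auto simp: closed_span_def)
  fix f l assume f: "\<And>n. f n \<in> closed_span S" and l: "l \<in> V" "(\<lambda>n. N (f n - l)) \<longlonglongrightarrow> 0"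
  show "l \<in> closed_span S" unfolding closed_span_def
  proof (intro CollectI conjI allI impI)
    fix e :: real assume "e > 0"
    then have e2: "e / 2 > 0" by simp
    have "\<forall>\<^sub>F n in sequentially. N (f n - l) < e / 2"
      using order_tendstoD(2)[OF l(2) e2] .
    then obtain n where n: "N (f n - l) < e / 2" by (auto simp: eventually_sequentially)
    obtain y where y: "y \<in> span S" "N (f n - y) < e / 2"
      using f[of n] e2 unfolding closed_span_def by blast
    have fn: "f n \<in> V" using f[of n] by (simp add: closed_span_def)
    have "y \<in> V" using y sub by blast
    then have "N (l - y) \<le> N (f n - l) + N (f n - y)"
      using N_triangle_via[OF l(1) fn, of y] N_diff_commute[OF l(1) fn] by simp
    then show "\<exists>z\<in>span S. N (l - z) < e" using n y by force
  qed (rule l)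
qed

lemma span_range_sum:
  fixes y :: "nat \<Rightarrow> 'a"
  assumes "x \<in> span (range y)"
  obtains a n where "x = (\<Sum>k<n. smul (a k) (y k))"
proof -
  have "\<exists>a n. x = (\<Sum>k<n. smul (a k) (y k))"
    using assms
  proof (induction rule: span_induct_alt)
    case base
    then show ?case by (intro exI[of _ "\<lambda>_. 0"] exI[of _ 0]) simp
  next
    case (step c z x)
    then obtain j a n where z: "z = y j" and x: "x = (\<Sum>k<n. smul (a k) (y k))" by blast
    let ?b = "\<lambda>k. (if k = j then c else 0) + (if k < n then a k else 0)" and ?m = "max n (Suc j)"
    have "(\<Sum>k<?m. smul (?b k) (y k))
        = (\<Sum>k<?m. if k = j then smul c (y k) else 0) + (\<Sum>k<?m. if k \<in> {..<n} then smul (a k) (y k) else 0)"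
      unfolding sum.distrib[symmetric] by (intro sum.cong) (auto simp: scale_left_distrib)
    also have "(\<Sum>k<?m. if k = j then smul c (y k) else 0) = smul c (y j)" by (simp add: less_max_iff_disj)
    also have "(\<Sum>k<?m. if k \<in> {..<n} then smul (a k) (y k) else 0) = (\<Sum>k<n. smul (a k) (y k))"
      by (subst sum.inter_restrict[symmetric]) (auto intro: sum.cong)
    finally have "smul c z + x = (\<Sum>k<?m. smul (?b k) (y k))" by (simp add: z x)
    then show ?case by (intro exI[of _ ?b] exI[of _ ?m])
  qed
  with that show thesis by blast
qed

end

context banach_space_on begin

lemma summable_converges:
  assumes z: "\<And>k. z k \<in> V" and s: "summable b" and zb: "\<And>k. N (z k) \<le> b k"
  obtains l where "l \<in> V" "(\<lambda>n. N ((\<Sum>k<n. z k) - l)) \<longlonglongrightarrow> 0" "N l \<le> suminf b"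
proof -
  let ?S = "\<lambda>n. \<Sum>k<n. z k"
  have b0: "0 \<le> b k" for k using zb[of k] N_nonneg[OF z[of k]] by simp
  have SV: "?S n \<in> V" for n using z by (intro sum_in)
  have diff: "N (?S n - ?S m) \<le> (\<Sum>k\<in>{m..<n}. b k)" if "m \<le> n" for m n
  proof -
    have "?S n - ?S m = (\<Sum>k\<in>{m..<n}. z k)"
      using that by (simp add: sum_diff_nat_ivl lessThan_atLeast0)
    also have "N \<dots> \<le> (\<Sum>k\<in>{m..<n}. N (z k))" using z by (intro N_sum) auto
    also have "\<dots> \<le> (\<Sum>k\<in>{m..<n}. b k)" using zb by (intro sum_mono)
    finally show ?thesis .
  qed
  have "\<exists>l\<in>V. (\<lambda>n. N (?S n - l)) \<longlonglongrightarrow> 0"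
  proof (rule complete)
    show "\<forall>e>0. \<exists>n0. \<forall>m\<ge>n0. \<forall>n\<ge>n0. N (?S m - ?S n) < e"
    proof (intro allI impI)
      fix e :: real assume "e > 0"
      then obtain n0 where n0: "\<And>m n. m \<ge> n0 \<Longrightarrow> norm (\<Sum>k\<in>{m..<n}. b k) < e"
        using s unfolding summable_Cauchy by blast
      have "N (?S m - ?S n) < e" if "n0 \<le> n" "n \<le> m" for m n
        using diff[OF that(2)] n0[OF that(1), of m] by simp
      then show "\<exists>n0. \<forall>m\<ge>n0. \<forall>n\<ge>n0. N (?S m - ?S n) < e"
        using N_diff_commute[OF SV SV] by (metis nle_le)
    qed
  qed (use SV in auto)
  then obtain l where l: "l \<in> V" "(\<lambda>n. N (?S n - l)) \<longlonglongrightarrow> 0" by blast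
  moreover have "N l \<le> suminf b"
  proof (rule seminorm_limit_le[OF seminorm_N, of 1 ?S])
    show "N (?S n) \<le> suminf b" for n
    proof -
      have "N (?S n) \<le> (\<Sum>k<n. b k)" using diff[of 0 n] by (simp add: lessThan_atLeast0)
      also have "\<dots> \<le> suminf b" using s b0 by (intro sum_le_suminf) auto
      finally show ?thesis .
    qed
  qed (use l SV in auto)
  ultimately show thesis using that by blast
qed

end

section \<open>Strictly singular seminorms\<close>

context normed_space_on begin

text \<open>
  The standard fact that a strictly singular operator has arbitrarily small restrictions. Choose
  \<open>y k\<close> of norm one with \<open>p (y k)\<close> tiny, always inside the kernels of functionals \<open>g j\<close>, \<open>j < k\<close>,
  with \<open>g j (y j) = 1\<close> and norm at most 4. Applying the \<open>g k\<close> one after the other bounds the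
  coefficients of \<open>x = \<Sum> a k y k\<close> by a fixed exponential sequence times the norm of \<open>x\<close>. If the
  \<open>p (y k)\<close> decrease faster than these bounds grow, \<open>p\<close> is small on the whole closed span.
\<close>

lemma small_seminorm_subspace:
  assumes M: "closed_subspace smul V N M" "infinite_dimensional smul M"
    and p: "seminorm_on smul V p" and pC: "\<And>x. x \<in> V \<Longrightarrow> p x \<le> C * N x"
    and sing: "\<And>M' c. M' \<subseteq> M \<Longrightarrow> closed_subspace smul V N M' \<Longrightarrow> infinite_dimensional smul M' \<Longrightarrow>
      c > 0 \<Longrightarrow> \<exists>x\<in>M'. p x < c * N x"
    and d: "d > 0"
  obtains M' where "M' \<subseteq> M" "closed_subspace smul V N M'" "infinite_dimensional smul M'"
    "\<And>x. x \<in> M' \<Longrightarrow> p x \<le> d * N x"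
proof -
  \<comment> \<open>Coefficients can grow like \<open>4 * 5 ^ k\<close>; this choice leaves the series of \<open>d / 2 ^ Suc k\<close>.\<close>
  define e where "e k = d / (8 * 10 ^ k)" for k :: nat
  have e: "e k > 0" for k using d by (simp add: e_def)
  define good where "good k = (\<lambda>(L, y, g). L \<subseteq> M \<and> closed_subspace smul V N L \<and>
    infinite_dimensional smul L \<and> y \<in> L \<and> N y = 1 \<and> p y < e k \<and> linear_map_on smul (*) V g \<and>
    g y = 1 \<and> (\<forall>x\<in>V. norm (g x) \<le> 4 * N x))" for k
  have pick: "\<exists>y g. good k (L, y, g)"
    if L: "L \<subseteq> M" "closed_subspace smul V N L" "infinite_dimensional smul L" for L k
  proof -
    note D = closed_subspaceD[OF L(2)]
    obtain x where x: "x \<in> L" "p x < e k * N x" using sing[OF L e] by blast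
    have xV: "x \<in> V" using x D by blast
    have "0 \<le> p x" using seminorm_nonneg[OF p xV] .
    then have Nx: "N x > 0" using x(2) e[of k] by (smt (verit) N_nonneg mult_nonneg_nonpos xV)
    define y where "y = smul (of_real (1 / N x)) x"
    have y: "y \<in> L" "y \<in> V" using x D(1) xV by (auto simp: y_def subspace_scale scale_in)
    have Ny: "N y = 1" using Nx N_scale[OF xV, of "of_real (1 / N x)"] by (simp add: y_def norm_divide)
    have "p y = p x / N x" using p xV Nx by (simp add: y_def seminorm_on_def norm_divide)
    then have py: "p y < e k" using x(2) Nx by (simp add: divide_less_eq mult.commute)
    obtain g where "linear_map_on smul (*) V g" "g y = 1" "\<And>x. x \<in> V \<Longrightarrow> norm (g x) \<le> 4 / N y * N x"
      using dominated_functional[OF seminorm_N y(2)] Ny by auto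
    then have "good k (L, y, g)" using L y Ny py by (auto simp: good_def)
    then show ?thesis by blast
  qed
  have "\<exists>F. \<forall>k. good k (F k) \<and> fst (F (Suc k)) = {x \<in> fst (F k). snd (snd (F k)) x = 0}"
  proof (rule dependent_nat_choice)
    show "\<exists>s. good 0 s" using pick[OF order_refl M] by blast
    fix s k assume s: "good k s"
    obtain L y g where s': "s = (L, y, g)" by (cases s)
    then have L: "L \<subseteq> M" "closed_subspace smul V N L" "infinite_dimensional smul L"
      and g: "linear_map_on smul (*) V g" "\<And>x. x \<in> V \<Longrightarrow> norm (g x) \<le> 4 * N x"
      using s by (auto simp: good_def)
    note D = closed_subspaceD[OF L(2)]
    interpret L: linear_carrier smul L by unfold_locales (rule D)
    have "\<exists>y' g'. good (Suc k) ({x \<in> L. g x = 0}, y', g')"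
    proof (rule pick)
      show "{x \<in> L. g x = 0} \<subseteq> M" using L by blast
      show "closed_subspace smul V N {x \<in> L. g x = 0}" by (rule closed_kernel[OF L(2) g])
      show "infinite_dimensional smul {x \<in> L. g x = 0}"
        by (rule L.infinite_dimensional_kernel[OF linear_map_on_subset[OF g(1) D(2)] L(3)])
    qed
    then show "\<exists>t. good (Suc k) t \<and> fst t = {x \<in> fst s. snd (snd s) x = 0}"
      using s' by fastforce
  qed
  then obtain F where F: "\<And>k. good k (F k)"
    "\<And>k. fst (F (Suc k)) = {x \<in> fst (F k). snd (snd (F k)) x = 0}" by blast
  define L where "L k = fst (F k)" for k
  define y where "y k = fst (snd (F k))" for k
  define g where "g k = snd (snd (F k))" for k
  have Lk: "L k \<subseteq> M" and yL: "y k \<in> L k" and Ny: "N (y k) = 1" and py: "p (y k) < e k"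
    and glin: "linear_map_on smul (*) V (g k)" and gy: "g k (y k) = 1"
    and gb: "\<And>x. x \<in> V \<Longrightarrow> norm (g k x) \<le> 4 * N x" for k
    using F(1)[of k] by (auto simp: good_def L_def y_def g_def split: prod.splits)
  have LSuc: "L (Suc k) = {x \<in> L k. g k x = 0}" for k
    using F(2)[of k] by (simp add: L_def g_def)
  have anti: "L k \<subseteq> L j" if "j \<le> k" for j k
    by (rule lift_Suc_antimono_le[of L, OF _ that]) (auto simp: LSuc)
  have tri: "g k (y j) = 0" if "k < j" for k j
    using anti[of "Suc k" j] yL[of j] that by (auto simp: LSuc)
  have yV: "y k \<in> V" and yM: "y k \<in> M" for k
    using yL Lk closed_subspaceD(2)[OF M(1)] by blast+
  have coeff: "norm (a k) \<le> 4 * 5 ^ k * N (\<Sum>j<n. smul (a j) (y j))" if "k < n" for a n k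
    using that
  proof (induction k rule: less_induct)
    case (less k)
    let ?x = "\<Sum>j<n. smul (a j) (y j)"
    have xV: "?x \<in> V" by (intro sum_in scale_in yV)
    have geo: "(\<Sum>j<k. 4 * 5 ^ j) = (5 ^ k - 1 :: real)" for k :: nat
      by (induction k) auto
    have "g k ?x = (\<Sum>j<n. a j * g k (y j))"
      using glin yV scale_in by (simp add: linear_map_sum[OF glin] linear_map_on_def)
    also have "\<dots> = (\<Sum>j<Suc k. a j * g k (y j))"
      using less.prems tri by (intro sum.mono_neutral_right) auto
    also have "\<dots> = (\<Sum>j<k. a j * g k (y j)) + a k" using gy by simp
    finally have "a k = g k ?x - (\<Sum>j<k. a j * g k (y j))" by simp
    then have "norm (a k) \<le> norm (g k ?x) + norm (\<Sum>j<k. a j * g k (y j))"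
      using norm_triangle_ineq4 by metis
    also have "\<dots> \<le> 4 * N ?x + (\<Sum>j<k. (4 * 5 ^ j * N ?x) * 4)"
    proof (intro add_mono gb xV order_trans[OF norm_sum] sum_mono)
      fix j assume j: "j \<in> {..<k}"
      have "norm (g k (y j)) \<le> 4" using gb[OF yV, of k j] Ny by simp
      moreover have "norm (a j) \<le> 4 * 5 ^ j * N ?x" using less j by auto
      ultimately show "norm (a j * g k (y j)) \<le> 4 * 5 ^ j * N ?x * 4"
        unfolding norm_mult using N_nonneg[OF xV] by (intro mult_mono) auto
    qed
    also have "\<dots> = 4 * N ?x * (1 + (\<Sum>j<k. 4 * 5 ^ j))"
      by (simp add: distrib_left sum_distrib_left mult_ac)
    also have "\<dots> = 4 * 5 ^ k * N ?x" by (simp only: geo) simp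
    finally show ?case .
  qed
  have small: "p x \<le> d * N x" if x: "x \<in> span (range y)" for x
  proof -
    obtain a n where x: "x = (\<Sum>k<n. smul (a k) (y k))" using span_range_sum[OF x] .
    have xV: "x \<in> V" unfolding x by (intro sum_in scale_in yV)
    have "p x \<le> (\<Sum>k<n. p (smul (a k) (y k)))" unfolding x by (intro seminorm_sum[OF p] scale_in yV) auto
    also have "\<dots> = (\<Sum>k<n. norm (a k) * p (y k))" using p yV by (simp add: seminorm_on_def)
    also have "\<dots> \<le> (\<Sum>k<n. (4 * 5 ^ k * N x) * e k)"
      using coeff[of _ n a] py e seminorm_nonneg[OF p yV] N_nonneg[OF xV]
      by (intro sum_mono mult_mono) (auto simp: x less_imp_le)
    also have "\<dots> = (\<Sum>k<n. (1/2) ^ Suc k) * (d * N x)"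
    proof -
      have "(4 * 5 ^ k * N x) * e k = (1/2) ^ Suc k * (d * N x)" for k
      proof -
        have "(10 :: real) ^ k = 5 ^ k * 2 ^ k" by (simp flip: power_mult_distrib)
        then show ?thesis by (simp add: e_def field_simps)
      qed
      then show ?thesis by (simp only: sum_distrib_right)
    qed
    also have "\<dots> \<le> 1 * (d * N x)"
    proof (rule mult_right_mono)
      show "(\<Sum>k<n. (1/2) ^ Suc k) \<le> (1 :: real)"
      proof -
        have "(\<Sum>k<n. (1/2) ^ Suc k) = 1 - (1/2 :: real) ^ n"
          by (induction n) auto
        then show ?thesis by simp
      qed
    qed (use d N_nonneg[OF xV] in simp)
    finally show ?thesis by simp
  qed
  have rV: "range y \<subseteq> V" using yV by blast
  note cl = closed_closed_span[OF rV]
  note D = closed_subspaceD[OF cl]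
  show thesis
  proof
    show "closed_span (range y) \<subseteq> M" by (rule closed_span_minimal[OF M(1)]) (use yM in blast)
    interpret Y: linear_carrier smul "closed_span (range y)" by unfold_locales (rule D)
    have "y k \<in> closed_span (range y)" for k
      using span_subset_closed_span[OF rV] span_superset by blast
    then show "infinite_dimensional smul (closed_span (range y))"
      using linear_map_on_subset[OF glin D(2)] gy tri
      by (intro Y.infinite_dimensional_if_triangular[where y=y and g=g]) auto
    fix x assume x: "x \<in> closed_span (range y)"
    obtain f where f: "\<And>n. f n \<in> span (range y)" "(\<lambda>n. N (f n - x)) \<longlonglongrightarrow> 0"
      using closed_span_seq[OF x rV] by blast
    have fV: "f n \<in> V" for n using f(1) span_minimal[OF rV carrier] by blast
    have xV: "x \<in> V" using x D by blast
    show "p x \<le> d * N x"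
    proof (rule seminorm_limit_le[OF p pC fV xV f(2)])
      show "(\<lambda>n. d * (N x + N (f n - x))) \<longlonglongrightarrow> d * N x"
        using tendsto_mult_left[OF tendsto_add[OF tendsto_const[of "N x"] f(2)], of d] by simp
      show "p (f n) \<le> d * (N x + N (f n - x))" for n
        using small[OF f(1)[of n]] mult_left_mono[OF N_le_add_diff[OF fV[of n] xV], of d] d by linarith
    qed
  qed (rule cl)
qed

end

section \<open>Biorthogonal systems spanning copies of \<open>\<ell>\<^sub>2\<close>\<close>

text \<open>
  A biorthogonal system with an upper \<open>\<ell>\<^sub>2\<close>-estimate for the vectors and a Bessel inequality for
  the functionals. The two estimates say that synthesis \<open>a \<mapsto> \<Sum> a k u k\<close> and analysis
  \<open>x \<mapsto> (f k x)\<close> are bounded between \<open>\<ell>\<^sub>2\<close> and the whole space; so the notion covers both the copy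
  of \<open>\<ell>\<^sub>2\<close> and its projection, and it is easy to carry from one space to another.
\<close>

definition ell2_system ::
  "('k::real_or_complex \<Rightarrow> 'a::ab_group_add \<Rightarrow> 'a) \<Rightarrow> 'a set \<Rightarrow> ('a \<Rightarrow> real) \<Rightarrow>
    (nat \<Rightarrow> 'a) \<Rightarrow> (nat \<Rightarrow> 'a \<Rightarrow> 'k) \<Rightarrow> bool" where
  "ell2_system smul V N u f \<longleftrightarrow>
     (\<forall>k. u k \<in> V \<and> linear_map_on smul (*) V (f k)) \<and>
     (\<forall>k l. f k (u l) = (if k = l then 1 else 0)) \<and>
     (\<exists>C\<ge>0. (\<forall>a n. N (\<Sum>k<n. smul (a k) (u k)) \<le> C * L2_set (\<lambda>k. norm (a k)) {..<n}) \<and>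
       (\<forall>x\<in>V. \<forall>n. L2_set (\<lambda>k. norm (f k x)) {..<n} \<le> C * N x))"

lemma ell2_bounded_partial:
  assumes "\<And>n. L2_set (\<lambda>k. norm (a k)) {..<n} \<le> B"
  shows "a \<in> ell2" "ell2_norm a \<le> B"
proof -
  have B: "0 \<le> B" using assms[of 0] by simp
  have le: "(\<Sum>k<n. (norm (a k))\<^sup>2) \<le> B\<^sup>2" for n
    using assms[of n] B by (simp add: L2_set_def real_le_lsqrt sqrt_le_D)
  have s: "summable (\<lambda>n. (norm (a n))\<^sup>2)"
    by (rule summableI_nonneg_bounded[OF _ le]) simp
  then show "a \<in> ell2" by (simp add: ell2_def)
  have "(\<Sum>n. (norm (a n))\<^sup>2) \<le> B\<^sup>2" using suminf_le_const[OF s] le by blast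
  then show "ell2_norm a \<le> B" using B by (simp add: ell2_norm_def real_le_lsqrt)
qed

lemma ell2_partial_le: "a \<in> ell2 \<Longrightarrow> L2_set (\<lambda>k. norm (a k)) {..<n} \<le> ell2_norm a"
  unfolding L2_set_def ell2_norm_def ell2_def
  by (intro real_sqrt_le_mono sum_le_suminf) auto

lemma ell2_add: "a \<in> ell2 \<Longrightarrow> b \<in> ell2 \<Longrightarrow> a + b \<in> ell2"
proof (rule ell2_bounded_partial(1)[of _ "ell2_norm a + ell2_norm b"])
  fix n assume ab: "a \<in> ell2" "b \<in> ell2"
  have "L2_set (\<lambda>k. norm ((a + b) k)) {..<n} \<le> L2_set (\<lambda>k. norm (a k) + norm (b k)) {..<n}"
    by (intro L2_set_mono) (auto simp: norm_triangle_ineq)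
  also have "\<dots> \<le> L2_set (\<lambda>k. norm (a k)) {..<n} + L2_set (\<lambda>k. norm (b k)) {..<n}"
    by (rule L2_set_triangle_ineq)
  finally show "L2_set (\<lambda>k. norm ((a + b) k)) {..<n} \<le> ell2_norm a + ell2_norm b"
    using ell2_partial_le[OF ab(1), of n] ell2_partial_le[OF ab(2), of n] by linarith
qed

lemma ell2_scale: "a \<in> ell2 \<Longrightarrow> seq_scale (*) c a \<in> ell2"
  unfolding ell2_def seq_scale_def by (simp add: norm_mult power_mult_distrib summable_mult)

context normed_space_on begin

lemma tendsto_add_N:
  assumes "\<And>n. f n \<in> V" "x \<in> V" "(\<lambda>n. N (f n - x)) \<longlonglongrightarrow> 0"
    and "\<And>n. g n \<in> V" "y \<in> V" "(\<lambda>n. N (g n - y)) \<longlonglongrightarrow> 0"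
  shows "(\<lambda>n. N ((f n + g n) - (x + y))) \<longlonglongrightarrow> 0"
proof (rule Lim_null_comparison)
  show "(\<lambda>n. N (f n - x) + N (g n - y)) \<longlonglongrightarrow> 0" using tendsto_add[OF assms(3,6)] by simp
  have "N ((f n + g n) - (x + y)) \<le> N (f n - x) + N (g n - y)" for n
    using N_triangle[of "f n - x" "g n - y"] assms diff_in by (simp add: algebra_simps)
  then show "\<forall>\<^sub>F n in sequentially. norm (N ((f n + g n) - (x + y))) \<le> N (f n - x) + N (g n - y)"
    using N_nonneg assms add_in diff_in by simp
qed

lemma tendsto_scale_N:
  assumes "\<And>n. f n \<in> V" "x \<in> V" "(\<lambda>n. N (f n - x)) \<longlonglongrightarrow> 0"
  shows "(\<lambda>n. N (smul c (f n) - smul c x)) \<longlonglongrightarrow> 0"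
proof -
  have "N (smul c (f n) - smul c x) = norm c * N (f n - x)" for n
    using N_scale[OF diff_in[OF assms(1,2)], of c] by (simp add: scale_right_diff_distrib)
  then show ?thesis using tendsto_mult_left[OF assms(3), of "norm c"] by simp
qed

lemma complemented_closed:
  assumes "complemented_in smul V N W"
  shows "closed_subspace smul V N W"
proof -
  obtain P where P: "bounded_operator smul V N smul V N P" "\<And>x. x \<in> V \<Longrightarrow> P (P x) = P x" "P ` V = W"
    using assms unfolding complemented_in_def by blast
  have lin: "linear_map_on smul smul V P" and PV: "\<And>x. x \<in> V \<Longrightarrow> P x \<in> V"
    using P(1) by (auto simp: bounded_operator_def linear_map_on_def)
  obtain C where C: "\<And>x. x \<in> V \<Longrightarrow> N (P x) \<le> C * N x"
    using P(1) unfolding bounded_operator_def by blast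
  have fix_W: "P w = w" if "w \<in> W" for w using that P(2,3) by blast
  have WV: "W \<subseteq> V" using P(3) PV by blast
  show ?thesis
  proof (rule closed_subspaceI[OF _ WV])
    show "subspace W" using linear_map_image_subspace[OF _ lin] P(3) vector_space_axioms by blast
    fix f l assume f: "\<And>n. f n \<in> W" and l: "l \<in> V" "(\<lambda>n. N (f n - l)) \<longlonglongrightarrow> 0"
    have fV: "f n \<in> V" for n using f WV by blast
    have "(\<lambda>n. N (f n - P l)) \<longlonglongrightarrow> 0"
    proof (rule Lim_null_comparison)
      show "(\<lambda>n. C * N (f n - l)) \<longlonglongrightarrow> 0" using tendsto_mult_left[OF l(2), of C] by simp
      have "N (f n - P l) \<le> C * N (f n - l)" for n
        using C[OF diff_in[OF fV l(1)], of n] linear_map_diff[OF lin fV l(1), of n] fix_W[OF f, of n] by simp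
      then show "\<forall>\<^sub>F n in sequentially. norm (N (f n - P l)) \<le> C * N (f n - l)"
        using N_nonneg diff_in[OF fV PV[OF l(1)]] by simp
    qed
    then have "P l = l" using limit_unique[OF fV PV[OF l(1)] l(1) _ l(2)] by blast
    then show "l \<in> W" using P(3) l(1) by (metis imageI)
  qed
qed

end

context banach_space_on begin

text \<open>
  With synthesis \<open>T\<close> and analysis \<open>F\<close>, biorthogonality gives \<open>F (T a) = a\<close>. So \<open>T\<close> is an isomorphism
  onto its range, and \<open>T \<circ> F\<close> projects onto that range.
\<close>

lemma ell2_system_span:
  assumes sys: "ell2_system smul V N u f" and M: "closed_subspace smul V N M" and uM: "\<And>k. u k \<in> M"
  obtains W where "W \<subseteq> M" "complemented_in smul V N W" "copy_of_ell2 smul V N W"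
    "infinite_dimensional smul W"
proof -
  have uV: "u k \<in> V" and lin: "linear_map_on smul (*) V (f k)"
    and bi: "f k (u l) = (if k = l then 1 else 0)" for k l
    using sys by (auto simp: ell2_system_def)
  obtain C where C0: "C \<ge> 0"
    and upper: "\<And>a n. N (\<Sum>k<n. smul (a k) (u k)) \<le> C * L2_set (\<lambda>k. norm (a k)) {..<n}"
    and bessel: "\<And>x n. x \<in> V \<Longrightarrow> L2_set (\<lambda>k. norm (f k x)) {..<n} \<le> C * N x"
    using sys by (auto simp: ell2_system_def)
  define S where "S a n = (\<Sum>k<n. smul (a k) (u k))" for a n
  have SV: "S a n \<in> V" for a n unfolding S_def by (intro sum_in scale_in uV)
  have f_bound: "norm (f k x) \<le> C * N x" if "x \<in> V" for k x
    using member_le_L2_set[of "{..<Suc k}" k "\<lambda>k. norm (f k x)"] bessel[OF that, of "Suc k"] by simp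
  have "\<exists>l\<in>V. (\<lambda>n. N (S a n - l)) \<longlonglongrightarrow> 0" if a: "a \<in> ell2" for a
  proof (rule complete)
    have diff: "N (S a n - S a m) \<le> C * sqrt (\<Sum>k\<in>{m..<n}. (norm (a k))\<^sup>2)" if "m \<le> n" for m n
    proof -
      let ?b = "\<lambda>k. if m \<le> k then a k else 0"
      have "S a n - S a m = (\<Sum>k\<in>{m..<n}. smul (a k) (u k))"
        using that unfolding S_def by (simp add: sum_diff_nat_ivl lessThan_atLeast0)
      also have "\<dots> = (\<Sum>k<n. smul (?b k) (u k))"
        by (rule sum.mono_neutral_cong_left) auto
      finally have "N (S a n - S a m) \<le> C * L2_set (\<lambda>k. norm (?b k)) {..<n}" using upper by simp
      also have "L2_set (\<lambda>k. norm (?b k)) {..<n} = sqrt (\<Sum>k\<in>{m..<n}. (norm (a k))\<^sup>2)"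
        unfolding L2_set_def by (intro arg_cong[of _ _ sqrt] sum.mono_neutral_cong_right) auto
      finally show ?thesis .
    qed
    show "\<forall>e>0. \<exists>n0. \<forall>m\<ge>n0. \<forall>n\<ge>n0. N (S a m - S a n) < e"
    proof (intro allI impI)
      fix e :: real assume e: "e > 0"
      define e' where "e' = (e / (C + 1))\<^sup>2"
      have "e' > 0" using e C0 by (simp add: e'_def)
      then obtain n0 where n0: "\<And>m n. m \<ge> n0 \<Longrightarrow> norm (\<Sum>k\<in>{m..<n}. (norm (a k))\<^sup>2) < e'"
        using a unfolding ell2_def summable_Cauchy by blast
      have small: "N (S a n - S a m) < e" if "n0 \<le> m" "m \<le> n" for m n
      proof -
        have "(\<Sum>k\<in>{m..<n}. (norm (a k))\<^sup>2) < e'"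
          using n0[OF that(1), of n] by (simp add: sum_nonneg)
        then have "sqrt (\<Sum>k\<in>{m..<n}. (norm (a k))\<^sup>2) < e / (C + 1)"
          using e C0 real_sqrt_less_mono[of _ e'] by (simp add: e'_def)
        then have "(C + 1) * sqrt (\<Sum>k\<in>{m..<n}. (norm (a k))\<^sup>2) < e"
          using C0 by (simp add: field_simps)
        moreover have "C * sqrt (\<Sum>k\<in>{m..<n}. (norm (a k))\<^sup>2) \<le> (C + 1) * sqrt (\<Sum>k\<in>{m..<n}. (norm (a k))\<^sup>2)"
          by (intro mult_right_mono) (auto intro: sum_nonneg)
        ultimately show ?thesis using diff[OF that(2)] by linarith
      qed
      have "N (S a m - S a n) < e" if "n0 \<le> m" "n0 \<le> n" for m n
        using small[of m n] small[of n m] that N_diff_commute[OF SV SV, of a m a n] by (cases "m \<le> n") auto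
      then show "\<exists>n0. \<forall>m\<ge>n0. \<forall>n\<ge>n0. N (S a m - S a n) < e" by blast
    qed
  qed (use SV in blast)
  then obtain T where TV: "\<And>a. a \<in> ell2 \<Longrightarrow> T a \<in> V"
    and T: "\<And>a. a \<in> ell2 \<Longrightarrow> (\<lambda>n. N (S a n - T a)) \<longlonglongrightarrow> 0" by metis
  have T_bound: "N (T a) \<le> C * ell2_norm a" if a: "a \<in> ell2" for a
  proof (rule seminorm_limit_le[where C=1, OF seminorm_N _ SV TV[OF a] T[OF a]])
    show "N (S a n) \<le> C * ell2_norm a" for n
      using upper[where n=n and a=a] mult_left_mono[OF ell2_partial_le[OF a, of n] C0] by (simp add: S_def)
  qed auto
  have fT: "f k (T a) = a k" if a: "a \<in> ell2" for a k
  proof -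
    have "(\<lambda>n. f k (S a n)) \<longlonglongrightarrow> f k (T a)"
      by (rule functional_limit[OF lin f_bound SV TV[OF a] T[OF a]])
    moreover have "f k (S a n) = a k" if "n > k" for n
    proof -
      have "f k (S a n) = (\<Sum>l<n. a l * f k (u l))"
        unfolding S_def using lin uV scale_in by (simp add: linear_map_sum[OF lin] linear_map_on_def)
      then show ?thesis using that by (simp add: bi if_distrib[of "(*) _"] cong: if_cong)
    qed
    then have "(\<lambda>n. f k (S a n)) \<longlonglongrightarrow> a k"
      by (intro tendsto_eventually) (auto simp: eventually_at_top_dense)
    ultimately show ?thesis using LIMSEQ_unique by blast
  qed
  have T_add: "T (a + b) = T a + T b" if ab: "a \<in> ell2" "b \<in> ell2" for a b
  proof (rule limit_unique[OF SV TV[OF ell2_add[OF ab]] _ T[OF ell2_add[OF ab]]])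
    show "T a + T b \<in> V" using TV ab by (intro add_in)
    have "S (a + b) n = S a n + S b n" for n by (simp add: S_def scale_left_distrib sum.distrib)
    then show "(\<lambda>n. N (S (a + b) n - (T a + T b))) \<longlonglongrightarrow> 0"
      using tendsto_add_N[OF SV TV T SV TV T] ab by simp
  qed
  have T_scale: "T (seq_scale (*) c a) = smul c (T a)" if a: "a \<in> ell2" for a c
  proof (rule limit_unique[OF SV TV[OF ell2_scale[OF a]] _ T[OF ell2_scale[OF a]]])
    show "smul c (T a) \<in> V" using TV a by (intro scale_in)
    have "S (seq_scale (*) c a) n = smul c (S a n)" for n
      by (simp add: S_def seq_scale_def scale_sum_right)
    then show "(\<lambda>n. N (S (seq_scale (*) c a) n - smul c (T a))) \<longlonglongrightarrow> 0"
      using tendsto_scale_N[OF SV TV T] a by simp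
  qed
  define F where "F x = (\<lambda>k. f k x)" for x
  have F: "F x \<in> ell2" and F_bound: "ell2_norm (F x) \<le> C * N x" if "x \<in> V" for x
    using ell2_bounded_partial[of "F x" "C * N x"] bessel[OF that] by (auto simp: F_def)
  have F_add: "F (x + y) = F x + F y" and F_scale: "F (smul c x) = seq_scale (*) c (F x)"
    if "x \<in> V" "y \<in> V" for x y c
    using lin that by (auto simp: F_def linear_map_on_def seq_scale_def)
  have FT: "F (T a) = a" if "a \<in> ell2" for a using fT[OF that] by (simp add: F_def)
  define W where "W = T ` ell2"
  have WV: "W \<subseteq> V" using TV by (auto simp: W_def)
  have compl: "complemented_in smul V N W" unfolding complemented_in_def
  proof (intro exI conjI ballI)
    show "(T \<circ> F) ` V = W"
    proof
      show "(T \<circ> F) ` V \<subseteq> W" using F by (auto simp: W_def)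
      show "W \<subseteq> (T \<circ> F) ` V"
      proof
        fix w assume "w \<in> W"
        then obtain a where "a \<in> ell2" "w = T a" by (auto simp: W_def)
        then have "w = (T \<circ> F) (T a)" "T a \<in> V" using FT TV by auto
        then show "w \<in> (T \<circ> F) ` V" by blast
      qed
    qed
    show "(T \<circ> F) ((T \<circ> F) x) = (T \<circ> F) x" if "x \<in> V" for x using that F FT by simp
    have "N ((T \<circ> F) x) \<le> C * C * N x" if "x \<in> V" for x
      using T_bound[OF F[OF that]] mult_left_mono[OF F_bound[OF that] C0] by simp
    then show "bounded_operator smul V N smul V N (T \<circ> F)"
      using TV F T_add T_scale F_add F_scale unfolding bounded_operator_def by auto
  qed
  have "copy_of_ell2 smul V N W" unfolding copy_of_ell2_def isomorphic_spaces_def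
  proof (intro conjI exI)
    show "closed_subspace smul V N W" by (rule complemented_closed[OF compl])
    have inj: "inj_on T ell2" using FT by (rule inj_on_inverseI)
    then show "bij_betw T ell2 W" by (simp add: W_def bij_betw_def)
    show "bounded_operator (seq_scale (*)) ell2 ell2_norm smul W N T"
      using T_add T_scale T_bound unfolding bounded_operator_def W_def by blast
    have inv: "inv_into ell2 T w = F w" if "w \<in> W" for w
      using that inj FT by (auto simp: W_def)
    have "w + w' \<in> W" and "smul c w \<in> W" if "w \<in> W" "w' \<in> W" for w w' c
      using closed_subspaceD(1)[OF complemented_closed[OF compl]] that
      by (auto intro: subspace_add subspace_scale)
    then show "bounded_operator smul W N (seq_scale (*)) ell2 ell2_norm (inv_into ell2 T)"
      using WV F F_add F_scale F_bound unfolding bounded_operator_def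
      by (auto simp: inv subset_iff intro!: exI[of _ C])
  qed
  moreover have "infinite_dimensional smul W"
  proof -
    note D = closed_subspaceD[OF complemented_closed[OF compl]]
    interpret W: linear_carrier smul W by unfold_locales (rule D)
    have Fu: "F (u k) \<in> ell2" for k using F uV by blast
    show ?thesis
    proof (rule W.infinite_dimensional_if_triangular[where y="\<lambda>k. T (F (u k))" and g=f])
      show "T (F (u k)) \<in> W" for k using Fu by (auto simp: W_def)
      show "linear_map_on smul (*) W (f k)" for k by (rule linear_map_on_subset[OF lin WV])
    qed (auto simp: fT[OF Fu], auto simp: F_def bi)
  qed
  moreover have "W \<subseteq> M"
  proof
    fix w assume "w \<in> W"
    then obtain a where a: "a \<in> ell2" "w = T a" by (auto simp: W_def)
    note D = closed_subspaceD[OF M]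
    have "S a n \<in> M" for n unfolding S_def using D(1) uM by (intro subspace_sum subspace_scale)
    then show "w \<in> M" using D(3)[of "S a" w] a T TV by blast
  qed
  ultimately show thesis using that compl by blast
qed

text \<open>
  The Neumann series for the inverse of \<open>1 + K\<close>.
\<close>

lemma inverse_of_small_perturbation:
  assumes KV: "\<And>x. x \<in> V \<Longrightarrow> K x \<in> V" and K: "linear_map_on smul smul V K"
    and K_bound: "\<And>x. x \<in> V \<Longrightarrow> N (K x) \<le> 1/2 * N x"
  obtains G where "\<And>y. y \<in> V \<Longrightarrow> G y \<in> V" "linear_map_on smul smul V G"
    "\<And>y. y \<in> V \<Longrightarrow> N (G y) \<le> 2 * N y" "\<And>x. x \<in> V \<Longrightarrow> G (x + K x) = x"
proof -
  have ex: "\<exists>x\<in>V. x + K x = y \<and> N x \<le> 2 * N y" if y: "y \<in> V" for y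
  proof -
    define z where "z i = ((\<lambda>w. - K w) ^^ i) y" for i
    have zV: "z i \<in> V" for i unfolding z_def by (induction i) (use y KV minus_in in auto)
    have z_Suc: "K (z i) = - z (Suc i)" for i by (simp add: z_def)
    have z_bound: "N (z i) \<le> (1/2) ^ i * N y" for i
    proof (induction i)
      case 0 show ?case by (simp add: z_def)
    next
      case (Suc i)
      have "N (z (Suc i)) = N (K (z i))" using N_minus[OF zV] z_Suc by simp
      with K_bound[OF zV[of i]] Suc show ?case by simp
    qed
    have geo: "(\<lambda>i. (1/2) ^ i * N y) sums (2 * N y)"
      using sums_mult2[OF geometric_sums[of "1/2 :: real"], of "N y"] by simp
    obtain x where x: "x \<in> V" "(\<lambda>n. N ((\<Sum>k<n. z k) - x)) \<longlonglongrightarrow> 0" "N x \<le> 2 * N y"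
      using summable_converges[OF zV sums_summable[OF geo] z_bound] sums_unique[OF geo] by metis
    let ?S = "\<lambda>n. \<Sum>k<n. z k"
    have SV: "?S n \<in> V" for n using zV by (intro sum_in)
    have "(\<lambda>n. N (K (?S n) - K x)) \<longlonglongrightarrow> 0"
    proof (rule Lim_null_comparison)
      show "(\<lambda>n. 1/2 * N (?S n - x)) \<longlonglongrightarrow> 0" using tendsto_mult_left[OF x(2), of "1/2"] by simp
      show "\<forall>\<^sub>F n in sequentially. norm (N (K (?S n) - K x)) \<le> 1/2 * N (?S n - x)"
        using K_bound[OF diff_in[OF SV x(1)]] linear_map_diff[OF K SV x(1)]
          N_nonneg[OF diff_in[OF KV[OF SV] KV[OF x(1)]]] by simp
    qed
    moreover have "K (?S n) = y - ?S (Suc n)" for n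
    proof -
      have "K (?S n) = (\<Sum>k<n. - z (Suc k))" using linear_map_sum[OF K, of "{..<n}" z] zV z_Suc by simp
      also have "\<dots> = y - ?S (Suc n)"
        by (subst sum.lessThan_Suc_shift) (simp add: sum_negf z_def)
      finally show ?thesis .
    qed
    moreover have "(\<lambda>n. N ((y - ?S (Suc n)) - (y - x))) \<longlonglongrightarrow> 0"
    proof -
      have "(y - s) - (y - x) = x - s" for s by (simp add: algebra_simps)
      then have "N ((y - ?S (Suc n)) - (y - x)) = N (?S (Suc n) - x)" for n
        using N_diff_commute[OF x(1) SV[of "Suc n"]] by (simp only:)
      then show ?thesis using LIMSEQ_Suc[OF x(2)] by (simp only:)
    qed
    ultimately have "(\<lambda>n. N (K (?S n) - K x)) \<longlonglongrightarrow> 0" "(\<lambda>n. N (K (?S n) - (y - x))) \<longlonglongrightarrow> 0"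
      by (simp_all only:)
    then have "K x = y - x"
      by (rule limit_unique[OF KV[OF SV] KV[OF x(1)] diff_in[OF y x(1)]])
    then have "x + K x = y" by (simp add: algebra_simps)
    then show ?thesis using x by blast
  qed
  then obtain G where G: "\<And>y. y \<in> V \<Longrightarrow> G y \<in> V" "\<And>y. y \<in> V \<Longrightarrow> G y + K (G y) = y"
    "\<And>y. y \<in> V \<Longrightarrow> N (G y) \<le> 2 * N y" by metis
  have inj: "x = x'" if x: "x \<in> V" "x' \<in> V" and eq: "x + K x = x' + K x'" for x x'
  proof -
    have "x - x' = - (K x - K x')" using eq by (simp add: algebra_simps)
    then have "x - x' = - K (x - x')" using linear_map_diff[OF K x] by simp
    then have "N (x - x') = N (K (x - x'))" using N_minus[OF KV[OF diff_in[OF x]]] by simp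
    then have "N (x - x') = 0" using K_bound[OF diff_in[OF x]] N_nonneg[OF diff_in[OF x]] by simp
    then show ?thesis using N_eq_zero[OF diff_in[OF x]] by simp
  qed
  show thesis
  proof
    show "G (x + K x) = x" if "x \<in> V" for x
    proof -
      have y: "x + K x \<in> V" using add_in[OF that KV[OF that]] .
      show ?thesis by (rule inj[OF G(1)[OF y] that G(2)[OF y]])
    qed
    show "linear_map_on smul smul V G" unfolding linear_map_on_def
    proof (intro conjI ballI allI)
      fix x y assume xy: "x \<in> V" "y \<in> V"
      show "G (x + y) = G x + G y"
      proof (rule inj)
        have "K (G x + G y) = K (G x) + K (G y)" using K G(1) xy by (simp add: linear_map_on_def)
        then have "G x + G y + K (G x + G y) = (G x + K (G x)) + (G y + K (G y))" by (simp add: algebra_simps)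
        then show "G (x + y) + K (G (x + y)) = G x + G y + K (G x + G y)"
          using G(2) xy add_in by simp
      qed (use G xy add_in in auto)
    next
      fix c x assume x: "x \<in> V"
      show "G (smul c x) = smul c (G x)"
      proof (rule inj)
        have "K (smul c (G x)) = smul c (K (G x))" using K G(1) x by (simp add: linear_map_on_def)
        then have "smul c (G x) + K (smul c (G x)) = smul c (G x + K (G x))"
          by (simp add: scale_right_distrib)
        then show "G (smul c x) + K (G (smul c x)) = smul c (G x) + K (smul c (G x))"
          using G(2) x scale_in by simp
      qed (use G x scale_in in auto)
    qed
  qed (use G in auto)
qed

text \<open>
  The operator \<open>K y = \<Sum> f k y (x k - u k)\<close> has norm at most one half, and \<open>1 + K\<close> maps \<open>u k\<close> to
  \<open>x k\<close>. Composing the functionals \<open>f k\<close> with the inverse of \<open>1 + K\<close> makes them biorthogonal to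
  the \<open>x k\<close>.
\<close>

lemma ell2_system_perturb:
  assumes sys: "ell2_system smul V N u f" and xV: "\<And>k. x k \<in> V"
    and fB: "\<And>k y. y \<in> V \<Longrightarrow> norm (f k y) \<le> B * N y"
    and d: "summable d" "\<And>k. N (x k - u k) \<le> d k" "B * suminf d \<le> 1/2"
  obtains f' where "ell2_system smul V N x f'"
proof -
  have uV: "u k \<in> V" and lin: "linear_map_on smul (*) V (f k)"
    and bi: "f k (u l) = (if k = l then 1 else 0)" for k l
    using sys by (auto simp: ell2_system_def)
  obtain C where C0: "C \<ge> 0"
    and upper: "\<And>a n. N (\<Sum>k<n. smul (a k) (u k)) \<le> C * L2_set (\<lambda>k. norm (a k)) {..<n}"
    and bessel: "\<And>x n. x \<in> V \<Longrightarrow> L2_set (\<lambda>k. norm (f k x)) {..<n} \<le> C * N x"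
    using sys by (auto simp: ell2_system_def)
  have wV: "x k - u k \<in> V" for k using xV uV diff_in by blast
  define S where "S y n = (\<Sum>k<n. smul (f k y) (x k - u k))" for y n
  have SV: "S y n \<in> V" for y n unfolding S_def by (intro sum_in scale_in wV)
  have "\<exists>l\<in>V. (\<lambda>n. N (S y n - l)) \<longlonglongrightarrow> 0 \<and> N l \<le> 1/2 * N y" if y: "y \<in> V" for y
  proof -
    have bound: "N (smul (f k y) (x k - u k)) \<le> (B * N y) * d k" for k
      using fB[OF y, of k] d(2)[of k] N_nonneg[OF wV[of k]] N_scale[OF wV]
      by (simp add: mult_mono order_trans[OF norm_ge_zero])
    obtain l where l: "l \<in> V" "(\<lambda>n. N (S y n - l)) \<longlonglongrightarrow> 0" "N l \<le> (\<Sum>k. (B * N y) * d k)"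
      unfolding S_def
      by (rule summable_converges[OF scale_in[OF wV] summable_mult[OF d(1)] bound])
    have "(\<Sum>k. (B * N y) * d k) = (B * suminf d) * N y"
      using suminf_mult[OF d(1), of "B * N y"] by simp
    also have "\<dots> \<le> 1/2 * N y" using d(3) N_nonneg[OF y] by (rule mult_right_mono)
    finally show ?thesis using l by (intro bexI[of _ l]) auto
  qed
  then obtain K where KV: "\<And>y. y \<in> V \<Longrightarrow> K y \<in> V"
    and K: "\<And>y. y \<in> V \<Longrightarrow> (\<lambda>n. N (S y n - K y)) \<longlonglongrightarrow> 0"
    and K_bound: "\<And>y. y \<in> V \<Longrightarrow> N (K y) \<le> 1/2 * N y" by metis
  have K_lin: "linear_map_on smul smul V K" unfolding linear_map_on_def
  proof (intro conjI ballI allI)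
    fix y z assume yz: "y \<in> V" "z \<in> V"
    have "S (y + z) n = S y n + S z n" for n
      using lin yz by (simp add: S_def linear_map_on_def scale_left_distrib sum.distrib)
    then have "(\<lambda>n. N (S (y + z) n - (K y + K z))) \<longlonglongrightarrow> 0"
      using tendsto_add_N[OF SV KV K SV KV K] yz by simp
    then show "K (y + z) = K y + K z"
      using limit_unique[OF SV KV _ K] yz add_in KV by metis
  next
    fix c y assume y: "y \<in> V"
    have "S (smul c y) n = smul c (S y n)" for n
      using lin y by (simp add: S_def linear_map_on_def scale_sum_right)
    then have "(\<lambda>n. N (S (smul c y) n - smul c (K y))) \<longlonglongrightarrow> 0"
      using tendsto_scale_N[OF SV KV K] y by simp
    then show "K (smul c y) = smul c (K y)"
      using limit_unique[OF SV KV _ K] y scale_in KV by metis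
  qed
  have Ku: "K (u l) = x l - u l" for l
  proof (rule limit_unique[OF SV KV[OF uV] wV K[OF uV]])
    have "S (u l) n = x l - u l" if "n > l" for n
      using that by (simp add: S_def bi if_distrib[of "\<lambda>c. smul c _"] cong: if_cong)
    then show "(\<lambda>n. N (S (u l) n - (x l - u l))) \<longlonglongrightarrow> 0"
      by (intro tendsto_eventually) (auto simp: eventually_at_top_dense N_zero intro!: exI[of _ l])
  qed
  obtain G where GV: "\<And>y. y \<in> V \<Longrightarrow> G y \<in> V" and G: "linear_map_on smul smul V G"
    and G_bound: "\<And>y. y \<in> V \<Longrightarrow> N (G y) \<le> 2 * N y" and GK: "\<And>y. y \<in> V \<Longrightarrow> G (y + K y) = y"
    using inverse_of_small_perturbation[OF KV K_lin K_bound] by blast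
  have Gx: "G (x l) = u l" for l using GK[OF uV, of l] by (simp add: Ku)
  show thesis
  proof
    show "ell2_system smul V N x (\<lambda>k y. f k (G y))" unfolding ell2_system_def
    proof (intro conjI allI exI[of _ "2 * C"] ballI)
      show "linear_map_on smul (*) V (\<lambda>y. f k (G y))" for k
        using G lin GV by (simp add: linear_map_on_def)
      fix a :: "nat \<Rightarrow> 'k" and n
      let ?s = "\<Sum>k<n. smul (a k) (u k)"
      have sV: "?s \<in> V" by (intro sum_in scale_in uV)
      have "K ?s = (\<Sum>k<n. smul (a k) (x k - u k))"
        using K_lin uV scale_in Ku by (simp add: linear_map_sum[OF K_lin] linear_map_on_def)
      then have "(\<Sum>k<n. smul (a k) (x k)) = ?s + K ?s"
        by (simp add: scale_right_diff_distrib sum_subtractf)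
      then have "N (\<Sum>k<n. smul (a k) (x k)) \<le> N ?s + N (K ?s)"
        using N_triangle[OF sV KV[OF sV]] by simp
      also have "\<dots> \<le> 2 * N ?s" using K_bound[OF sV] N_nonneg[OF sV] by simp
      also have "\<dots> \<le> 2 * (C * L2_set (\<lambda>k. norm (a k)) {..<n})" using upper by simp
      finally show "N (\<Sum>k<n. smul (a k) (x k)) \<le> 2 * C * L2_set (\<lambda>k. norm (a k)) {..<n}" by simp
    next
      fix y n assume y: "y \<in> V"
      show "L2_set (\<lambda>k. norm (f k (G y))) {..<n} \<le> 2 * C * N y"
        using bessel[OF GV[OF y], of n] mult_left_mono[OF G_bound[OF y] C0] by simp
    qed (use xV bi Gx C0 in auto)
  qed
qed

end

text \<open>
  Functionals are pulled back along an operator \<open>R\<close> on the whole space. For the vectors it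
  suffices to lift \<open>y k\<close> through \<open>R\<close> with control of the norms on their linear span.
\<close>

lemma (in normed_space_on) ell2_system_transport:
  assumes sys: "ell2_system smul' V' N' y h"
    and R: "linear_map_on smul smul' V R" "R ` V \<subseteq> V'" "\<And>x. x \<in> V \<Longrightarrow> N' (R x) \<le> c * N x"
    and z: "\<And>k. z k \<in> V" "\<And>k. R (z k) = y k"
    and zy: "\<And>a n. N (\<Sum>k<n. smul (a k) (z k)) \<le> c' * N' (\<Sum>k<n. smul' (a k) (y k))"
    and c: "0 \<le> c" "0 \<le> c'"
  shows "ell2_system smul V N z (\<lambda>k x. h k (R x))"
proof -
  have lin: "linear_map_on smul' (*) V' (h k)"
    and bi: "h k (y l) = (if k = l then 1 else 0)" for k l
    using sys by (auto simp: ell2_system_def)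
  obtain C where C0: "C \<ge> 0"
    and upper: "\<And>a n. N' (\<Sum>k<n. smul' (a k) (y k)) \<le> C * L2_set (\<lambda>k. norm (a k)) {..<n}"
    and bessel: "\<And>x n. x \<in> V' \<Longrightarrow> L2_set (\<lambda>k. norm (h k x)) {..<n} \<le> C * N' x"
    using sys by (auto simp: ell2_system_def)
  let ?C = "C * c + c' * C"
  show ?thesis unfolding ell2_system_def
  proof (intro conjI allI exI[of _ ?C] ballI)
    show "linear_map_on smul (*) V (\<lambda>x. h k (R x))" for k
      using R(1,2) lin[of k] by (simp add: linear_map_on_def image_subset_iff)
    fix a :: "nat \<Rightarrow> 'k" and n
    have "N (\<Sum>k<n. smul (a k) (z k)) \<le> (c' * C) * L2_set (\<lambda>k. norm (a k)) {..<n}"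
      using zy[where a=a and n=n] mult_left_mono[OF upper[where n=n and a=a] c(2)] by simp
    also have "\<dots> \<le> ?C * L2_set (\<lambda>k. norm (a k)) {..<n}" using C0 c by (intro mult_right_mono) auto
    finally show "N (\<Sum>k<n. smul (a k) (z k)) \<le> ?C * L2_set (\<lambda>k. norm (a k)) {..<n}" .
  next
    fix x n assume x: "x \<in> V"
    have "L2_set (\<lambda>k. norm (h k (R x))) {..<n} \<le> C * N' (R x)" using R(2) x by (intro bessel) auto
    also have "\<dots> \<le> (C * c) * N x" using mult_left_mono[OF R(3)[OF x] C0] by simp
    also have "\<dots> \<le> ?C * N x" using C0 c N_nonneg[OF x] by (intro mult_right_mono) auto
    finally show "L2_set (\<lambda>k. norm (h k (R x))) {..<n} \<le> ?C * N x" .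
  qed (use z bi C0 c in auto)
qed

section \<open>The quadratic variation norm\<close>

definition jump ::
  "(nat \<Rightarrow> 'a::ab_group_add \<Rightarrow> real) \<Rightarrow> (nat \<Rightarrow> 'a \<Rightarrow> 'a) \<Rightarrow> (nat \<Rightarrow> 'a) \<Rightarrow> nat \<Rightarrow> nat \<Rightarrow> real" where
  "jump N \<phi> x p q = N q (phi_comp \<phi> p q (x p) - x q)"

text \<open>
  Lists may repeat indices: a repetition contributes nothing, and sorted lists stay sorted when
  they are concatenated in order or mapped by a monotone function. For sets of indices such lists
  would first have to be made disjoint or injective.
\<close>

fun variation ::
  "(nat \<Rightarrow> 'a::ab_group_add \<Rightarrow> real) \<Rightarrow> (nat \<Rightarrow> 'a \<Rightarrow> 'a) \<Rightarrow> (nat \<Rightarrow> 'a) \<Rightarrow> nat list \<Rightarrow> real" where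
  "variation N \<phi> x (p # q # ps) = sqrt ((jump N \<phi> x p q)\<^sup>2 + (variation N \<phi> x (q # ps))\<^sup>2)"
| "variation N \<phi> x _ = 0"

text \<open>
  For \<open>I = UNIV\<close> this is the norm \<open>\<nu>\<close> equivalent to \<open>J_norm\<close>. For an interval \<open>I\<close> it is a seminorm
  that sees only the coordinates in \<open>I\<close>.
\<close>

definition variation_norm ::
  "(nat \<Rightarrow> 'a::ab_group_add \<Rightarrow> real) \<Rightarrow> (nat \<Rightarrow> 'a \<Rightarrow> 'a) \<Rightarrow> nat set \<Rightarrow> (nat \<Rightarrow> 'a) \<Rightarrow> real" where
  "variation_norm N \<phi> I x = (SUP ps\<in>{ps. sorted ps \<and> set ps \<subseteq> I}. variation N \<phi> x ps)"

lemma variation_nonneg: "0 \<le> variation N \<phi> x ps"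
  by (induction ps rule: induct_list012) auto

lemma variation_Cons2_squared:
  "(variation N \<phi> x (p # q # ps))\<^sup>2 = (jump N \<phi> x p q)\<^sup>2 + (variation N \<phi> x (q # ps))\<^sup>2"
  by simp

lemma variation_append:
  "(variation N \<phi> x ps)\<^sup>2 + (variation N \<phi> x qs)\<^sup>2 \<le> (variation N \<phi> x (ps @ qs))\<^sup>2"
proof (induction ps rule: induct_list012)
  case (2 p)
  then show ?case by (cases qs) auto
qed auto

lemma variation_sum:
  "(variation N \<phi> x ps)\<^sup>2 = (\<Sum>i<length ps - 1. (jump N \<phi> x (ps ! i) (ps ! Suc i))\<^sup>2)"
proof (induction ps rule: induct_list012)
  case (3 p q ps)
  then show ?case
    by (simp only: variation_Cons2_squared length_Cons diff_Suc_1 sum.lessThan_Suc_shift) simp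
qed auto

lemma variation_map_le:
  assumes "\<And>p q. p \<le> q \<Longrightarrow> jump N \<phi> x p q \<le> jump N \<phi> x (g p) (g q)"
    and "\<And>p q. p \<le> q \<Longrightarrow> 0 \<le> jump N \<phi> x p q" and "sorted ps"
  shows "variation N \<phi> x ps \<le> variation N \<phi> x (map g ps)"
  using assms(3)
proof (induction ps rule: induct_list012)
  case (3 p q ps)
  then show ?case using assms(1,2)[of p q] variation_nonneg
    by (auto intro!: real_sqrt_le_mono add_mono power_mono)
qed auto

lemma variation_cong:
  assumes "\<And>p. p \<in> set ps \<Longrightarrow> x p = y p"
  shows "variation N \<phi> x ps = variation N \<phi> y ps"
  using assms by (induction ps rule: induct_list012) (auto simp: jump_def)

lemma vector_space_seq_scale:
  assumes "vector_space smul"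
  shows "vector_space (seq_scale smul)"
proof -
  interpret vector_space smul by fact
  show ?thesis
    by unfold_locales
      (auto simp: seq_scale_def fun_eq_iff scale_right_distrib scale_left_distrib)
qed

locale contraction_chain =
  fixes smul :: "'k::real_or_complex \<Rightarrow> 'a::ab_group_add \<Rightarrow> 'a"
    and X :: "nat \<Rightarrow> 'a set" and N :: "nat \<Rightarrow> 'a \<Rightarrow> real" and \<phi> :: "nat \<Rightarrow> 'a \<Rightarrow> 'a"
  assumes banach: "banach_space_on smul (X n) (N n)"
    and X0: "X 0 = {0}"
    and phi_in: "v \<in> X n \<Longrightarrow> \<phi> n v \<in> X (Suc n)"
    and phi_linear: "linear_map_on smul smul (X n) (\<phi> n)"
    and phi_contraction: "v \<in> X n \<Longrightarrow> N (Suc n) (\<phi> n v) \<le> N n v"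
begin

sublocale X: banach_space_on smul "X n" "N n" for n
  by (rule banach)

sublocale Seq: vector_space "seq_scale smul"
  by (rule vector_space_seq_scale) (rule X.vector_space_axioms)

abbreviation var where "var \<equiv> variation N \<phi>"
abbreviation vnorm where "vnorm \<equiv> variation_norm N \<phi>"
abbreviation nu where "nu \<equiv> variation_norm N \<phi> UNIV"
abbreviation J where "J \<equiv> J_hat X N \<phi>"

definition seqs :: "(nat \<Rightarrow> 'a) set" where "seqs = {x. \<forall>n. x n \<in> X n}"

lemma seqsD: "x \<in> seqs \<Longrightarrow> x n \<in> X n"
  by (simp add: seqs_def)

sublocale Seqs: linear_carrier "seq_scale smul" seqs
  by unfold_locales
    (auto simp: Seq.subspace_def seqs_def seq_scale_def X.add_in X.scale_in)

lemma phi_comp_refl [simp]: "phi_comp \<phi> n n v = v"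
  by (simp add: phi_comp_def)

lemma phi_comp_Suc: "n \<le> m \<Longrightarrow> phi_comp \<phi> n (Suc m) v = \<phi> m (phi_comp \<phi> n m v)"
  by (simp add: phi_comp_def)

lemma phi_comp_in: "n \<le> m \<Longrightarrow> v \<in> X n \<Longrightarrow> phi_comp \<phi> n m v \<in> X m"
  by (induction m rule: dec_induct) (auto simp: phi_comp_Suc phi_in)

lemma phi_comp_linear: "n \<le> m \<Longrightarrow> linear_map_on smul smul (X n) (phi_comp \<phi> n m)"
proof (induction m rule: dec_induct)
  case (step m)
  then show ?case using phi_linear[of m] phi_comp_in[of n m]
    by (simp add: linear_map_on_def phi_comp_Suc)
qed (simp add: linear_map_on_def)

lemma phi_comp_contraction: "n \<le> m \<Longrightarrow> v \<in> X n \<Longrightarrow> N m (phi_comp \<phi> n m v) \<le> N n v"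
proof (induction m rule: dec_induct)
  case (step m)
  then show ?case using phi_contraction[OF phi_comp_in[of n m v]] by (simp add: phi_comp_Suc)
qed simp

lemma phi_comp_comp:
  assumes "n \<le> k" "k \<le> m"
  shows "phi_comp \<phi> n m v = phi_comp \<phi> k m (phi_comp \<phi> n k v)"
  using assms(2,1) by (induction m rule: dec_induct) (auto simp: phi_comp_Suc)

lemma phi_comp_zero: "n \<le> m \<Longrightarrow> phi_comp \<phi> n m 0 = 0"
  using X.linear_map_zero[OF phi_comp_linear] .

lemma jump_arg_in: "x \<in> seqs \<Longrightarrow> p \<le> q \<Longrightarrow> phi_comp \<phi> p q (x p) - x q \<in> X q"
  by (simp add: X.diff_in phi_comp_in seqsD)

lemma jump_nonneg: "x \<in> seqs \<Longrightarrow> p \<le> q \<Longrightarrow> 0 \<le> jump N \<phi> x p q"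
  unfolding jump_def using X.N_nonneg jump_arg_in by blast

lemma jump_refl: "jump N \<phi> x p p = 0"
  by (simp add: jump_def X.N_zero)

lemma jump_from_zero: "x \<in> seqs \<Longrightarrow> p \<le> q \<Longrightarrow> x p = 0 \<Longrightarrow> jump N \<phi> x p q = N q (x q)"
  by (simp add: jump_def phi_comp_zero X.N_minus seqsD)

lemma jump_le: "x \<in> seqs \<Longrightarrow> p \<le> q \<Longrightarrow> jump N \<phi> x p q \<le> N p (x p) + N q (x q)"
  unfolding jump_def
  by (rule order_trans[OF X.N_diff]) (auto simp: phi_comp_in seqsD phi_comp_contraction)

lemma jump_seminorm:
  assumes "p \<le> q"
  shows "seminorm_on (seq_scale smul) seqs (\<lambda>x. jump N \<phi> x p q)"
  unfolding seminorm_on_def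
proof (intro conjI ballI allI)
  fix x y assume xy: "x \<in> seqs" "y \<in> seqs"
  have "phi_comp \<phi> p q (x p + y p) = phi_comp \<phi> p q (x p) + phi_comp \<phi> p q (y p)"
    using phi_comp_linear[OF assms] seqsD xy by (simp add: linear_map_on_def)
  then have eq: "phi_comp \<phi> p q ((x + y) p) - (x + y) q
      = (phi_comp \<phi> p q (x p) - x q) + (phi_comp \<phi> p q (y p) - y q)" by simp
  show "jump N \<phi> (x + y) p q \<le> jump N \<phi> x p q + jump N \<phi> y p q"
    unfolding jump_def eq using jump_arg_in[OF xy(1) assms] jump_arg_in[OF xy(2) assms]
    by (rule X.N_triangle)
next
  fix c x assume x: "x \<in> seqs"
  have "phi_comp \<phi> p q (smul c (x p)) = smul c (phi_comp \<phi> p q (x p))"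
    using phi_comp_linear[OF assms] seqsD x by (simp add: linear_map_on_def)
  then have eq: "phi_comp \<phi> p q (seq_scale smul c x p) - seq_scale smul c x q
      = smul c (phi_comp \<phi> p q (x p) - x q)"
    by (simp add: seq_scale_def X.scale_right_diff_distrib)
  show "jump N \<phi> (seq_scale smul c x) p q = norm c * jump N \<phi> x p q"
    unfolding jump_def eq using jump_arg_in[OF x assms] by (rule X.N_scale)
qed

lemma variation_triangle:
  assumes "x \<in> seqs" "y \<in> seqs" "sorted ps"
  shows "var (x + y) ps \<le> var x ps + var y ps"
  using assms(3)
proof (induction ps rule: induct_list012)
  case (3 p q ps)
  then have pq: "p \<le> q" and sorted: "sorted (q # ps)" by auto
  have IH: "var (x + y) (q # ps) \<le> var x (q # ps) + var y (q # ps)" by (rule 3(2)[OF sorted])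
  have "jump N \<phi> (x + y) p q \<le> jump N \<phi> x p q + jump N \<phi> y p q"
    using jump_seminorm[OF pq] assms by (simp add: seminorm_on_def)
  moreover have "0 \<le> jump N \<phi> (x + y) p q" using assms pq Seqs.add_in jump_nonneg by blast
  ultimately have "var (x + y) (p # q # ps)
      \<le> sqrt ((jump N \<phi> x p q + jump N \<phi> y p q)\<^sup>2 + (var x (q # ps) + var y (q # ps))\<^sup>2)"
    using IH variation_nonneg[of N \<phi> "x + y" "q # ps"]
    by (simp only: variation.simps) (intro real_sqrt_le_mono add_mono power_mono)
  also have "\<dots> \<le> var x (p # q # ps) + var y (p # q # ps)"
    unfolding variation.simps by (rule real_sqrt_sum_squares_triangle_ineq)
  finally show ?case .
qed auto

lemma variation_scale:
  assumes "x \<in> seqs" "sorted ps"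
  shows "var (seq_scale smul c x) ps = norm c * var x ps"
  using assms(2)
proof (induction ps rule: induct_list012)
  case (3 p q ps)
  have "jump N \<phi> (seq_scale smul c x) p q = norm c * jump N \<phi> x p q"
    using jump_seminorm[of p q] assms 3 by (simp add: seminorm_on_def)
  moreover have "sqrt ((norm c * a)\<^sup>2 + (norm c * b)\<^sup>2) = norm c * sqrt (a\<^sup>2 + b\<^sup>2)" for a b
    by (simp add: power_mult_distrib real_sqrt_mult flip: distrib_left)
  ultimately show ?case using 3 by simp
qed auto

text \<open>
  This is where \<open>X 0 = {0}\<close> enters: a jump that starts at the index 0 measures the norm of a
  coordinate, which also accounts for the last term of \<open>rho\<close>.
\<close>

lemma coordinate_le_variation: "x \<in> seqs \<Longrightarrow> N n (x n) = var x [0, n]"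
proof -
  assume x: "x \<in> seqs"
  then have "x 0 = 0" using seqsD[of x 0] X0 by simp
  then show ?thesis using jump_from_zero[OF x, of 0 n] X.N_nonneg[OF seqsD[OF x]] by simp
qed

lemma rho_squared:
  assumes x: "x \<in> seqs" and S: "finite S" "S \<noteq> {}"
  shows "(rho N \<phi> x S)\<^sup>2
    = (var x (sorted_list_of_set S))\<^sup>2 + (N (Max S) (x (Max S)))\<^sup>2"
proof -
  let ?ps = "sorted_list_of_set S"
  let ?k = "card S - 1"
  have len: "length ?ps = card S" using S by simp
  have card: "card S > 0" using S by (simp add: card_gt_0_iff)
  have last: "?ps ! ?k = Max S"
  proof (rule Max_eqI[symmetric])
    show "?ps ! ?k \<in> S" using nth_mem[of ?k ?ps] len card S by simp
    fix y assume "y \<in> S"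
    then obtain i where i: "i < length ?ps" "?ps ! i = y" using S(1) by (metis in_set_conv_nth set_sorted_list_of_set)
    then show "y \<le> ?ps ! ?k" using sorted_nth_mono[of ?ps i ?k] len card by simp
  qed (rule S)
  have "(\<Sum>i=1..?k. (N (?ps ! i) (phi_comp \<phi> (?ps ! (i - 1)) (?ps ! i) (x (?ps ! (i - 1))) - x (?ps ! i)))\<^sup>2)
      = (var x ?ps)\<^sup>2"
    unfolding variation_sum len jump_def by (subst sum_bounds_lt_plus1[symmetric]) simp
  moreover have "0 \<le> (var x ?ps)\<^sup>2 + (N (Max S) (x (Max S)))\<^sup>2" by simp
  ultimately show ?thesis unfolding rho_def Let_def last by simp
qed

lemma rho_le:
  assumes x: "x \<in> seqs" and B: "\<And>ps. sorted ps \<Longrightarrow> var x ps \<le> B" and S: "finite S" "S \<noteq> {}"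
  shows "rho N \<phi> x S \<le> sqrt 2 * B"
proof -
  have B0: "0 \<le> B" using B[of "[]"] by simp
  have "(var x (sorted_list_of_set S))\<^sup>2 \<le> B\<^sup>2"
    using B[of "sorted_list_of_set S"] variation_nonneg by (intro power_mono) auto
  moreover have "(N (Max S) (x (Max S)))\<^sup>2 \<le> B\<^sup>2"
    using B[of "[0, Max S]"] X.N_nonneg[OF seqsD[OF x]] coordinate_le_variation[OF x, of "Max S"]
    by (intro power_mono) auto
  ultimately have "(rho N \<phi> x S)\<^sup>2 \<le> (sqrt 2 * B)\<^sup>2"
    unfolding rho_squared[OF x S] by (simp add: power_mult_distrib)
  then show ?thesis using B0 by (auto intro: power2_le_imp_le)
qed

text \<open>
  Removing repetitions turns a sorted list into the increasing enumeration of its elements.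
\<close>

lemma variation_le_rho:
  assumes x: "x \<in> seqs" and ps: "sorted ps" "ps \<noteq> []"
  shows "var x ps \<le> rho N \<phi> x (set ps)"
proof -
  have adj: "var x ps = var x (remdups_adj ps)" if "sorted ps" for ps
    using that
  proof (induction ps rule: induct_list012)
    case (3 p q ps)
    obtain r where r: "remdups_adj (q # ps) = q # r"
      by (metis list.exhaust_sel list.sel(1) hd_remdups_adj remdups_adj_Nil_iff list.distinct(1))
    have IH: "var x (q # ps) = var x (remdups_adj (q # ps))" using 3 by auto
    show ?case
    proof (cases "p = q")
      case True
      then show ?thesis using IH by (simp add: jump_refl abs_of_nonneg[OF variation_nonneg])
    next
      case False
      then have "remdups_adj (p # q # ps) = p # q # r" using r by simp
      then show ?thesis using IH r by simp
    qed
  qed auto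
  have "distinct (remdups_adj qs)" if "sorted qs" for qs :: "nat list"
    using that by (induction qs rule: remdups_adj.induct) force+
  then have "remdups_adj ps = sorted_list_of_set (set ps)"
    using ps(1) by (intro sorted_distinct_set_unique) auto
  then have "(var x ps)\<^sup>2 \<le> (rho N \<phi> x (set ps))\<^sup>2"
    using rho_squared[OF x, of "set ps"] ps adj[OF ps(1)] by simp
  moreover have "0 \<le> rho N \<phi> x (set ps)"
    by (simp add: rho_def Let_def add_nonneg_nonneg sum_nonneg)
  ultimately show ?thesis by (rule power2_le_imp_le)
qed

lemma J_iff: "x \<in> J \<longleftrightarrow> x \<in> seqs \<and> (\<exists>B. \<forall>ps. sorted ps \<longrightarrow> var x ps \<le> B)"
proof
  assume x: "x \<in> J"
  then have xs: "x \<in> seqs" by (simp add: J_hat_def seqs_def)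
  obtain B where B: "\<And>S. finite S \<Longrightarrow> S \<noteq> {} \<Longrightarrow> rho N \<phi> x S \<le> B"
    using x by (auto simp: J_hat_def bdd_above_def finite_nonempty_sets_def)
  have "var x ps \<le> max 0 B" if "sorted ps" for ps
    using variation_le_rho[OF xs that] B[of "set ps"] by (cases "ps = []") force+
  then show "x \<in> seqs \<and> (\<exists>B. \<forall>ps. sorted ps \<longrightarrow> var x ps \<le> B)" using xs by blast
next
  assume "x \<in> seqs \<and> (\<exists>B. \<forall>ps. sorted ps \<longrightarrow> var x ps \<le> B)"
  then obtain B where xs: "x \<in> seqs" and B: "\<And>ps. sorted ps \<Longrightarrow> var x ps \<le> B" by blast
  show "x \<in> J" using xs rho_le[OF xs B]
    by (auto simp: J_hat_def seqs_def finite_nonempty_sets_def intro!: bdd_aboveI[of _ "sqrt 2 * B"])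
qed

lemma J_seqs: "x \<in> J \<Longrightarrow> x \<in> seqs"
  by (simp add: J_iff)

lemma J_in: "x \<in> J \<Longrightarrow> x n \<in> X n"
  using J_seqs seqsD by blast

lemma vnorm_le: "(\<And>ps. sorted ps \<Longrightarrow> set ps \<subseteq> I \<Longrightarrow> var x ps \<le> B) \<Longrightarrow> vnorm I x \<le> B"
  unfolding variation_norm_def
  by (rule cSUP_least) (auto intro: exI[of _ "[]"])

lemma variation_le_vnorm:
  assumes "x \<in> J" "sorted ps" "set ps \<subseteq> I"
  shows "var x ps \<le> vnorm I x"
  unfolding variation_norm_def
proof (rule cSUP_upper)
  show "bdd_above (var x ` {ps. sorted ps \<and> set ps \<subseteq> I})"
    using assms(1) unfolding J_iff by (auto intro: bdd_aboveI)
qed (use assms in simp)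

lemma vnorm_nonneg: "x \<in> J \<Longrightarrow> 0 \<le> vnorm I x"
  using variation_le_vnorm[of x "[]" I] by simp

lemma vnorm_mono: "x \<in> J \<Longrightarrow> I \<subseteq> I' \<Longrightarrow> vnorm I x \<le> vnorm I' x"
  by (rule vnorm_le) (auto intro: variation_le_vnorm)

lemma vnorm_eq_0:
  assumes "\<And>n. n \<in> I \<Longrightarrow> x n = 0" "x \<in> J"
  shows "vnorm I x = 0"
proof (rule antisym)
  show "vnorm I x \<le> 0"
  proof (rule vnorm_le)
    fix ps assume ps: "sorted ps" "set ps \<subseteq> I"
    have "0 \<in> seqs" by simp
    have "var x ps = var 0 ps" using assms(1) ps by (intro variation_cong) auto
    also have "\<dots> = var (seq_scale smul 0 0) ps" by simp
    also have "\<dots> = 0" using variation_scale[OF \<open>0 \<in> seqs\<close> ps(1), of 0] by simp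
    finally show "var x ps \<le> 0" by simp
  qed
qed (use assms vnorm_nonneg in auto)

lemma coordinate_le_nu: "x \<in> J \<Longrightarrow> N n (x n) \<le> nu x"
  using variation_le_vnorm[of x "[0, n]" UNIV] coordinate_le_variation[of x n] J_seqs by simp

lemma J_subspace: "Seq.subspace J"
proof (rule Seq.subspaceI)
  have "var 0 ps \<le> 0" if "sorted ps" for ps
    using variation_scale[OF Seqs.zero_in that, of 0] by simp
  then show "0 \<in> J" unfolding J_iff by auto
next
  fix x y assume xy: "x \<in> J" "y \<in> J"
  then obtain B B' where "\<And>ps. sorted ps \<Longrightarrow> var x ps \<le> B" "\<And>ps. sorted ps \<Longrightarrow> var y ps \<le> B'"
    unfolding J_iff by blast
  then have "var (x + y) ps \<le> B + B'" if "sorted ps" for ps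
    using variation_triangle[OF J_seqs[OF xy(1)] J_seqs[OF xy(2)] that] that by (meson add_mono order_trans)
  then show "x + y \<in> J" using xy Seqs.add_in unfolding J_iff by blast
next
  fix c x assume x: "x \<in> J"
  then obtain B where B: "\<And>ps. sorted ps \<Longrightarrow> var x ps \<le> B" unfolding J_iff by blast
  have "var (seq_scale smul c x) ps \<le> norm c * B" if "sorted ps" for ps
    using B[OF that] variation_scale[OF J_seqs[OF x] that] by (simp add: mult_left_mono)
  then show "seq_scale smul c x \<in> J" using x Seqs.scale_in unfolding J_iff by blast
qed

sublocale J: linear_carrier "seq_scale smul" J
  by unfold_locales (rule J_subspace)

lemma vnorm_seminorm: "seminorm_on (seq_scale smul) J (vnorm I)"
  unfolding seminorm_on_def
proof (intro conjI ballI allI)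
  fix x y assume xy: "x \<in> J" "y \<in> J"
  show "vnorm I (x + y) \<le> vnorm I x + vnorm I y"
  proof (rule vnorm_le)
    fix ps assume ps: "sorted ps" "set ps \<subseteq> I"
    have "var (x + y) ps \<le> var x ps + var y ps"
      using variation_triangle[OF J_seqs[OF xy(1)] J_seqs[OF xy(2)] ps(1)] .
    also have "\<dots> \<le> vnorm I x + vnorm I y" using xy ps by (intro add_mono variation_le_vnorm)
    finally show "var (x + y) ps \<le> vnorm I x + vnorm I y" .
  qed
next
  fix c x assume x: "x \<in> J"
  show "vnorm I (seq_scale smul c x) = norm c * vnorm I x"
  proof (rule antisym)
    show "vnorm I (seq_scale smul c x) \<le> norm c * vnorm I x"
      using x by (intro vnorm_le) (auto simp: variation_scale J_seqs intro: mult_left_mono variation_le_vnorm)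
    show "norm c * vnorm I x \<le> vnorm I (seq_scale smul c x)"
    proof (cases "c = 0")
      case False
      have "vnorm I x \<le> vnorm I (seq_scale smul c x) / norm c"
      proof (rule vnorm_le)
        fix ps assume ps: "sorted ps" "set ps \<subseteq> I"
        have "norm c * var x ps \<le> vnorm I (seq_scale smul c x)"
          using variation_le_vnorm[OF J.scale_in[OF x] ps, of c] variation_scale[OF J_seqs[OF x] ps(1)] by simp
        then show "var x ps \<le> vnorm I (seq_scale smul c x) / norm c"
          using False by (simp add: field_simps)
      qed
      then show ?thesis using False by (simp add: field_simps)
    qed (use vnorm_nonneg[OF J.zero_in] in simp)
  qed
qed

sublocale J: normed_space_on "seq_scale smul" J nu
proof unfold_locales
  show "Seq.subspace J" by (rule J_subspace)
  show "nu x = 0 \<longleftrightarrow> x = 0" if x: "x \<in> J" for x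
  proof
    assume "nu x = 0"
    then have "N n (x n) = 0" for n
      using coordinate_le_nu[OF x, of n] X.N_nonneg[OF J_in[OF x]] by (simp add: antisym)
    then have "x n = 0" for n using X.N_eq_zero[OF J_in[OF x]] by blast
    then show "x = 0" by (simp add: fun_eq_iff)
  qed (use J.seminorm_zero[OF vnorm_seminorm] in simp)
qed (use vnorm_seminorm in \<open>auto simp: seminorm_on_def\<close>)

lemma variation_tendsto_0:
  assumes "\<And>m. f m \<in> seqs" "\<And>n. (\<lambda>m. N n (f m n)) \<longlonglongrightarrow> 0" "sorted ps"
  shows "(\<lambda>m. var (f m) ps) \<longlonglongrightarrow> 0"
  using assms(3)
proof (induction ps rule: induct_list012)
  case (3 p q ps)
  then have pq: "p \<le> q" and IH: "(\<lambda>m. var (f m) (q # ps)) \<longlonglongrightarrow> 0" by auto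
  have "(\<lambda>m. jump N \<phi> (f m) p q) \<longlonglongrightarrow> 0"
  proof (rule Lim_null_comparison)
    show "(\<lambda>m. N p (f m p) + N q (f m q)) \<longlonglongrightarrow> 0"
      using tendsto_add[OF assms(2)[of p] assms(2)[of q]] by simp
    show "\<forall>\<^sub>F m in sequentially. norm (jump N \<phi> (f m) p q) \<le> N p (f m p) + N q (f m q)"
      using jump_le[OF assms(1) pq] jump_nonneg[OF assms(1) pq] by simp
  qed
  then have "(\<lambda>m. sqrt ((jump N \<phi> (f m) p q)\<^sup>2 + (var (f m) (q # ps))\<^sup>2)) \<longlonglongrightarrow> sqrt (0\<^sup>2 + 0\<^sup>2)"
    using IH by (intro tendsto_intros)
  then show ?case by simp
qed auto

text \<open>
  Coordinates of a Cauchy sequence converge, and the variation over a fixed finite list depends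
  only on finitely many coordinates. Hence estimates for differences pass to the limit list by
  list, uniformly in the list.
\<close>

sublocale J: banach_space_on "seq_scale smul" J nu
proof unfold_locales
  fix f :: "nat \<Rightarrow> nat \<Rightarrow> 'a"
  assume f: "range f \<subseteq> J" and cauchy: "\<forall>e>0. \<exists>n0. \<forall>m\<ge>n0. \<forall>n\<ge>n0. nu (f m - f n) < e"
  have fJ: "f m \<in> J" for m using f by blast
  have "\<exists>l\<in>X n. (\<lambda>m. N n (f m n - l)) \<longlonglongrightarrow> 0" for n
  proof (rule X.complete)
    show "range (\<lambda>m. f m n) \<subseteq> X n" using fJ J_in by blast
    have "N n (f m n - f m' n) \<le> nu (f m - f m')" for m m'
      using coordinate_le_nu[OF J.diff_in[OF fJ[of m] fJ[of m']], of n] by simp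
    then show "\<forall>e>0. \<exists>n0. \<forall>m\<ge>n0. \<forall>m'\<ge>n0. N n (f m n - f m' n) < e"
      using cauchy by (meson le_less_trans)
  qed
  then obtain l where l: "\<And>n. l n \<in> X n" "\<And>n. (\<lambda>m. N n (f m n - l n)) \<longlonglongrightarrow> 0" by metis
  have ls: "l \<in> seqs" using l(1) by (simp add: seqs_def)
  have lim: "(\<lambda>m. var (f m - l) ps) \<longlonglongrightarrow> 0" if "sorted ps" for ps
    using l(2) that ls fJ J_seqs Seqs.diff_in by (intro variation_tendsto_0) auto
  have close: "\<exists>n0. \<forall>m\<ge>n0. \<forall>ps. sorted ps \<longrightarrow> var (f m - l) ps \<le> e" if "e > 0" for e
  proof -
    obtain n0 where n0: "\<forall>m\<ge>n0. \<forall>n\<ge>n0. nu (f m - f n) < e"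
      using cauchy \<open>e > 0\<close> by blast
    have "var (f m - l) ps \<le> e" if m: "m \<ge> n0" and ps: "sorted ps" for m ps
    proof (rule LIMSEQ_le_const)
      show "(\<lambda>m'. e + var (f m' - l) ps) \<longlonglongrightarrow> e"
        using tendsto_add[OF tendsto_const[of e] lim[OF ps]] by simp
      have "var (f m - l) ps \<le> e + var (f m' - l) ps" if "m' \<ge> n0" for m'
      proof -
        have "var ((f m - f m') + (f m' - l)) ps \<le> var (f m - f m') ps + var (f m' - l) ps"
          using fJ J_seqs ls Seqs.diff_in ps by (intro variation_triangle) auto
        moreover have "var (f m - f m') ps \<le> nu (f m - f m')"
          using fJ ps by (intro variation_le_vnorm J.diff_in) auto
        ultimately show ?thesis using n0 m that by force
      qed
      then show "\<exists>n. \<forall>m'\<ge>n. var (f m - l) ps \<le> e + var (f m' - l) ps" by blast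
    qed
    then show ?thesis by blast
  qed
  have diffJ: "\<exists>n0. \<forall>m\<ge>n0. f m - l \<in> J \<and> nu (f m - l) \<le> e" if "e > 0" for e
  proof -
    obtain n0 where n0: "\<forall>m\<ge>n0. \<forall>ps. sorted ps \<longrightarrow> var (f m - l) ps \<le> e" using close[OF \<open>e > 0\<close>] by blast
    have "f m - l \<in> J \<and> nu (f m - l) \<le> e" if "m \<ge> n0" for m
      using n0 that fJ J_seqs ls Seqs.diff_in unfolding J_iff by (blast intro: vnorm_le)
    then show ?thesis by blast
  qed
  obtain m where "f m - l \<in> J" using diffJ[of 1] by auto
  then have "f m - (f m - l) \<in> J" by (rule J.diff_in[OF fJ])
  then have lJ: "l \<in> J" by simp
  have "(\<lambda>m. nu (f m - l)) \<longlonglongrightarrow> 0"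
  proof (rule LIMSEQ_I)
    fix r :: real assume "0 < r"
    then obtain n0 where "\<forall>m\<ge>n0. nu (f m - l) \<le> r / 2" using diffJ[of "r / 2"] by auto
    then show "\<exists>n0. \<forall>m\<ge>n0. norm (nu (f m - l) - 0) < r"
      using \<open>0 < r\<close> vnorm_nonneg[OF J.diff_in[OF fJ lJ]] by (intro exI[of _ n0]) force
  qed
  with lJ show "\<exists>l\<in>J. (\<lambda>n. nu (f n - l)) \<longlonglongrightarrow> 0" by blast
qed

lemma J_norm_le_nu: "x \<in> J \<Longrightarrow> J_norm N \<phi> x \<le> nu x"
proof -
  assume x: "x \<in> J"
  have "(SUP S\<in>finite_nonempty_sets. rho N \<phi> x S) \<le> sqrt 2 * nu x"
  proof (rule cSUP_least)
    show "finite_nonempty_sets \<noteq> {}" by (auto simp: finite_nonempty_sets_def)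
    show "rho N \<phi> x S \<le> sqrt 2 * nu x" if "S \<in> finite_nonempty_sets" for S
      using that x by (intro rho_le[OF J_seqs[OF x]] variation_le_vnorm) (auto simp: finite_nonempty_sets_def)
  qed
  then show ?thesis by (simp add: J_norm_def field_simps)
qed

lemma nu_le_J_norm: "x \<in> J \<Longrightarrow> nu x \<le> sqrt 2 * J_norm N \<phi> x"
proof -
  assume x: "x \<in> J"
  have bdd: "bdd_above (rho N \<phi> x ` finite_nonempty_sets)" using x by (simp add: J_hat_def)
  have up: "rho N \<phi> x S \<le> sqrt 2 * J_norm N \<phi> x" if "finite S" "S \<noteq> {}" for S
    using cSUP_upper[OF _ bdd, of S] that by (simp add: J_norm_def finite_nonempty_sets_def)
  show ?thesis
  proof (rule vnorm_le)
    fix ps :: "nat list" assume ps: "sorted ps"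
    show "var x ps \<le> sqrt 2 * J_norm N \<phi> x"
    proof (cases "ps = []")
      case True
      have "0 \<le> rho N \<phi> x {0}" by (simp add: rho_def Let_def)
      then show ?thesis using True up[of "{0}"] by simp
    next
      case False
      then show ?thesis using variation_le_rho[OF J_seqs[OF x] ps False] up[of "set ps"] by simp
    qed
  qed
qed

end

context contraction_chain begin

section \<open>Blocks\<close>

text \<open>
  Lists that nearly attain the two variations can be concatenated.
\<close>

lemma vnorm_superadditive:
  assumes x: "x \<in> J" and le: "\<And>i k. i \<in> I \<Longrightarrow> k \<in> K \<Longrightarrow> i \<le> k"
  shows "(vnorm I x)\<^sup>2 + (vnorm K x)\<^sup>2 \<le> (vnorm (I \<union> K) x)\<^sup>2"
proof -
  let ?G = "vnorm (I \<union> K) x"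
  have both: "(var x ps)\<^sup>2 + (var x qs)\<^sup>2 \<le> ?G\<^sup>2"
    if "sorted ps" "set ps \<subseteq> I" "sorted qs" "set qs \<subseteq> K" for ps qs
  proof -
    have "(var x ps)\<^sup>2 + (var x qs)\<^sup>2 \<le> (var x (ps @ qs))\<^sup>2" by (rule variation_append)
    also have "\<dots> \<le> ?G\<^sup>2"
      using that le by (intro power_mono variation_le_vnorm[OF x] variation_nonneg) (auto simp: sorted_append)
    finally show ?thesis .
  qed
  have one: "(vnorm I x)\<^sup>2 + (var x qs)\<^sup>2 \<le> ?G\<^sup>2" if qs: "sorted qs" "set qs \<subseteq> K" for qs
  proof -
    have "vnorm I x \<le> sqrt (?G\<^sup>2 - (var x qs)\<^sup>2)"
    proof (rule vnorm_le)
      fix ps assume "sorted ps" "set ps \<subseteq> I"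
      from both[OF this qs] show "var x ps \<le> sqrt (?G\<^sup>2 - (var x qs)\<^sup>2)"
        by (intro real_le_rsqrt) simp
    qed
    then have "(vnorm I x)\<^sup>2 \<le> (sqrt (?G\<^sup>2 - (var x qs)\<^sup>2))\<^sup>2"
      using vnorm_nonneg[OF x] by (intro power_mono)
    also have "\<dots> = ?G\<^sup>2 - (var x qs)\<^sup>2" using both[of "[]" qs] qs by simp
    finally show ?thesis by simp
  qed
  have "vnorm K x \<le> sqrt (?G\<^sup>2 - (vnorm I x)\<^sup>2)"
  proof (rule vnorm_le)
    fix qs assume "sorted qs" "set qs \<subseteq> K"
    from one[OF this] show "var x qs \<le> sqrt (?G\<^sup>2 - (vnorm I x)\<^sup>2)"
      by (intro real_le_rsqrt) simp
  qed
  then have "(vnorm K x)\<^sup>2 \<le> (sqrt (?G\<^sup>2 - (vnorm I x)\<^sup>2))\<^sup>2"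
    using vnorm_nonneg[OF x] by (intro power_mono)
  also have "\<dots> = ?G\<^sup>2 - (vnorm I x)\<^sup>2" using one[of "[]"] by simp
  finally show ?thesis by simp
qed

lemma vnorm_intervals:
  assumes x: "x \<in> J" and e: "mono (e :: nat \<Rightarrow> nat)"
  shows "L2_set (\<lambda>k. vnorm {e k..e (Suc k)} x) {..<m} \<le> nu x"
proof -
  have "(\<Sum>k<m. (vnorm {e k..e (Suc k)} x)\<^sup>2) \<le> (vnorm {e 0..e m} x)\<^sup>2"
  proof (induction m)
    case (Suc m)
    have "{e 0..e (Suc m)} = {e 0..e m} \<union> {e m..e (Suc m)}"
      using monoD[OF e, of 0 m] monoD[OF e, of m "Suc m"] by auto
    then have "(vnorm {e 0..e m} x)\<^sup>2 + (vnorm {e m..e (Suc m)} x)\<^sup>2 \<le> (vnorm {e 0..e (Suc m)} x)\<^sup>2"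
      using vnorm_superadditive[OF x, of "{e 0..e m}" "{e m..e (Suc m)}"] by auto
    then show ?case using Suc by simp
  qed simp
  also have "\<dots> \<le> (nu x)\<^sup>2" using vnorm_mono[OF x] vnorm_nonneg[OF x] by (intro power_mono) auto
  finally show ?thesis unfolding L2_set_def using vnorm_nonneg[OF x] by (intro real_le_lsqrt) (auto intro: sum_nonneg)
qed

definition single :: "nat \<Rightarrow> 'a \<Rightarrow> nat \<Rightarrow> 'a" where
  "single i v = (\<lambda>n. if n = i then v else 0)"

definition head :: "nat \<Rightarrow> (nat \<Rightarrow> 'a) \<Rightarrow> nat \<Rightarrow> 'a" where
  "head n x = (\<lambda>i. if i < n then x i else 0)"

text \<open>
  A sorted list can enter the index \<open>i\<close> once and leave it once. The case distinction on the first
  element of the list makes this count an induction.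
\<close>

lemma variation_single:
  assumes v: "v \<in> X i" and "sorted ps"
  shows "(var (single i v) ps)\<^sup>2 \<le> (if ps = [] \<or> hd ps > i then 0 else if hd ps = i then 1 else 2) * (N i v)\<^sup>2"
  using assms(2)
proof (induction ps rule: induct_list012)
  case (3 p q ps)
  have s: "single i v \<in> seqs" using v by (simp add: single_def seqs_def)
  have pq: "p \<le> q" and IH: "(var (single i v) (q # ps))\<^sup>2
      \<le> (if q > i then 0 else if q = i then 1 else 2) * (N i v)\<^sup>2"
    using 3 by auto
  have "(jump N \<phi> (single i v) p q)\<^sup>2 \<le> (if p = q then 0 else if p = i \<or> q = i then 1 else 0) * (N i v)\<^sup>2"
  proof (cases "p = q")
    case False
    have nn: "0 \<le> jump N \<phi> (single i v) p q" by (rule jump_nonneg[OF s pq])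
    have "jump N \<phi> (single i v) p q \<le> (if p = i \<or> q = i then N i v else 0)"
      using jump_le[OF s pq] False by (auto simp: single_def X.N_zero)
    then have "(jump N \<phi> (single i v) p q)\<^sup>2 \<le> (if p = i \<or> q = i then N i v else 0)\<^sup>2"
      using nn by (rule power_mono)
    then show ?thesis using False by (auto split: if_splits)
  qed (simp add: jump_refl)
  then show ?case using IH pq unfolding variation_Cons2_squared by (auto split: if_splits)
qed auto

lemma single_in_J:
  assumes v: "v \<in> X i"
  shows "single i v \<in> J" "nu (single i v) \<le> 2 * N i v"
proof -
  have le: "var (single i v) ps \<le> 2 * N i v" if "sorted ps" for ps
  proof (rule power2_le_imp_le)
    have "(var (single i v) ps)\<^sup>2 \<le> 4 * (N i v)\<^sup>2"
      using variation_single[OF v that] by (rule order_trans) auto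
    then show "(var (single i v) ps)\<^sup>2 \<le> (2 * N i v)\<^sup>2" by (simp add: power_mult_distrib)
  qed (use X.N_nonneg[OF v] in simp)
  then show "single i v \<in> J" using v unfolding J_iff seqs_def by (auto simp: single_def)
  show "nu (single i v) \<le> 2 * N i v" by (rule vnorm_le) (rule le)
qed

lemma head_in_J:
  assumes x: "x \<in> seqs"
  shows "head n x \<in> J \<and> nu (head n x) \<le> (\<Sum>i<n. 2 * N i (x i))"
proof (induction n)
  case 0
  have eq: "head 0 x = 0" by (simp add: head_def fun_eq_iff)
  show "head 0 x \<in> J \<and> nu (head 0 x) \<le> (\<Sum>i<0. 2 * N i (x i))" unfolding eq using J.N_zero by simp
next
  case (Suc n)
  have eq: "head (Suc n) x = head n x + single n (x n)"
    by (auto simp: head_def single_def fun_eq_iff less_Suc_eq)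
  note s = single_in_J[OF seqsD[OF x, of n]]
  have IH: "head n x \<in> J" "nu (head n x) \<le> (\<Sum>i<n. 2 * N i (x i))" using Suc by blast+
  show "head (Suc n) x \<in> J \<and> nu (head (Suc n) x) \<le> (\<Sum>i<Suc n. 2 * N i (x i))"
    unfolding eq using IH s J.N_triangle[OF IH(1) s(1)] J.add_in[OF IH(1) s(1)] by simp
qed

text \<open>
  The part of a list before \<open>f\<close> contributes only through the one jump that leads into \<open>{f..}\<close>, and
  that jump measures a coordinate.
\<close>

lemma tail_variation_le:
  assumes y: "y \<in> seqs" and zero: "\<And>i. i < f \<Longrightarrow> y i = 0" and "sorted qs"
    and B: "0 \<le> B" "\<And>b bs. sorted (b # bs) \<Longrightarrow> f \<le> b \<Longrightarrow> (N b (y b))\<^sup>2 + (var y (b # bs))\<^sup>2 \<le> B"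
  shows "(var y qs)\<^sup>2 \<le> B"
  using assms(3)
proof (induction qs rule: induct_list012)
  case (3 p q qs)
  show ?case
  proof (cases "f \<le> p")
    case True
    then show ?thesis using B(2)[OF 3(3)] by (smt (verit) zero_le_power2)
  next
    case False
    then have "y p = 0" using zero by simp
    then have jump: "jump N \<phi> y p q = N q (y q)" using 3 y by (intro jump_from_zero) auto
    show ?thesis
    proof (cases "f \<le> q")
      case True
      then show ?thesis unfolding variation_Cons2_squared jump using 3(3) by (intro B(2)) auto
    next
      case False
      then have "jump N \<phi> y p q = 0" using zero jump X.N_zero by simp
      then show ?thesis unfolding variation_Cons2_squared using 3 by simp
    qed
  qed
qed (use B in auto)

text \<open>
  If a list nearly attains \<open>\<nu> x\<close>, any list to the right of it has small variation, since the two can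
  be concatenated. Cutting off the beginning of \<open>x\<close> creates one new jump, of the size of a
  coordinate; so this needs \<open>x\<^sub>n \<rightarrow> 0\<close>, that is, \<open>x \<in> J(\<Phi>)\<close>.
\<close>

lemma tail_small:
  assumes x: "x \<in> J" and lim: "(\<lambda>n. N n (x n)) \<longlonglongrightarrow> 0" and r: "r > 0"
  obtains m where "\<And>f. m \<le> f \<Longrightarrow> nu (x - head f x) \<le> r"
proof -
  have "\<exists>ps. sorted ps \<and> (nu x)\<^sup>2 - r\<^sup>2 / 2 < (var x ps)\<^sup>2"
  proof (rule ccontr)
    assume "\<not> ?thesis"
    then have bound: "(var x ps)\<^sup>2 \<le> (nu x)\<^sup>2 - r\<^sup>2 / 2" if "sorted ps" for ps
      using that by force
    have le: "var x ps \<le> sqrt ((nu x)\<^sup>2 - r\<^sup>2 / 2)" if "sorted ps" for ps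
      using bound[OF that] by (rule real_le_rsqrt)
    have "0 \<le> (nu x)\<^sup>2 - r\<^sup>2 / 2" using bound[of "[]"] by simp
    moreover have "nu x \<le> sqrt ((nu x)\<^sup>2 - r\<^sup>2 / 2)" by (rule vnorm_le) (rule le)
    then have "(nu x)\<^sup>2 \<le> (sqrt ((nu x)\<^sup>2 - r\<^sup>2 / 2))\<^sup>2"
      using vnorm_nonneg[OF x] by (intro power_mono)
    ultimately show False using r by simp
  qed
  then obtain ps where ps: "sorted ps" "(nu x)\<^sup>2 - r\<^sup>2 / 2 < (var x ps)\<^sup>2" by blast
  have "\<forall>\<^sub>F n in sequentially. N n (x n) < r / 2" by (rule order_tendstoD(2)[OF lim]) (use r in simp)
  then obtain m0 where m0: "\<And>n. n \<ge> m0 \<Longrightarrow> N n (x n) < r / 2" by (auto simp: eventually_sequentially)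
  have "nu (x - head f x) \<le> r" if f: "max m0 (Suc (Max (insert 0 (set ps)))) \<le> f" for f
  proof (rule vnorm_le)
    let ?y = "x - head f x"
    have xs: "x \<in> seqs" using x by (rule J_seqs)
    have ys: "?y \<in> seqs" using xs head_in_J[OF xs] J_seqs by (intro Seqs.diff_in) auto
    fix qs :: "nat list" assume qs: "sorted qs"
    have "(var ?y qs)\<^sup>2 \<le> r\<^sup>2"
    proof (rule tail_variation_le[OF ys _ qs])
      fix b bs assume b: "sorted (b # bs)" "f \<le> b"
      have eq: "var ?y (b # bs) = var x (b # bs)" using b by (intro variation_cong) (auto simp: head_def)
      have "p \<le> b" if "p \<in> set ps" for p
      proof -
        have "p \<le> Max (insert 0 (set ps))" using that by (intro Max_ge) auto
        then show ?thesis using f b(2) by linarith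
      qed
      then have "sorted (ps @ b # bs)" using ps b by (force simp: sorted_append)
      then have "var x (ps @ b # bs) \<le> nu x" by (intro variation_le_vnorm[OF x]) auto
      then have "(var x (ps @ b # bs))\<^sup>2 \<le> (nu x)\<^sup>2" using variation_nonneg by (rule power_mono)
      then have "(var ?y (b # bs))\<^sup>2 \<le> r\<^sup>2 / 2"
        unfolding eq using variation_append[of N \<phi> x ps "b # bs"] ps(2) by linarith
      moreover have "(N b (?y b))\<^sup>2 \<le> (r / 2)\<^sup>2"
        using m0[of b] b(2) f X.N_nonneg[OF seqsD[OF xs]] by (intro power_mono) (auto simp: head_def less_imp_le)
      moreover have "(r / 2)\<^sup>2 = r\<^sup>2 / 4" by (simp add: power_divide)
      ultimately show "(N b (?y b))\<^sup>2 + (var ?y (b # bs))\<^sup>2 \<le> r\<^sup>2"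
        using zero_le_power2[of r] by linarith
    qed (auto simp: head_def)
    then show "var ?y qs \<le> r" using r by (intro power2_le_imp_le[of "var ?y qs" r]) auto
  qed
  then show thesis using that by blast
qed

lemma J_space_closed: "closed_subspace (seq_scale smul) J nu (J_space X N \<phi>)"
proof (rule J.closed_subspaceI)
  show "J_space X N \<phi> \<subseteq> J" by (auto simp: J_space_def)
  show "Seq.subspace (J_space X N \<phi>)"
  proof (rule Seq.subspaceI)
    show "0 \<in> J_space X N \<phi>" by (simp add: J_space_def X.N_zero)
  next
    fix x y assume xy: "x \<in> J_space X N \<phi>" "y \<in> J_space X N \<phi>"
    have "(\<lambda>n. N n ((x + y) n)) \<longlonglongrightarrow> 0"
    proof (rule Lim_null_comparison)
      show "(\<lambda>n. N n (x n) + N n (y n)) \<longlonglongrightarrow> 0"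
        using xy tendsto_add[of "\<lambda>n. N n (x n)" 0 sequentially "\<lambda>n. N n (y n)" 0] by (simp add: J_space_def)
      show "\<forall>\<^sub>F n in sequentially. norm (N n ((x + y) n)) \<le> N n (x n) + N n (y n)"
        using xy J_in X.N_triangle X.N_nonneg X.add_in by (simp add: J_space_def)
    qed
    then show "x + y \<in> J_space X N \<phi>" using xy J.add_in by (simp add: J_space_def)
  next
    fix c x assume x: "x \<in> J_space X N \<phi>"
    have "N n (seq_scale smul c x n) = norm c * N n (x n)" for n
      using x J_in X.N_scale by (simp add: J_space_def seq_scale_def)
    then have "(\<lambda>n. N n (seq_scale smul c x n)) \<longlonglongrightarrow> 0"
      using x tendsto_mult_left[of "\<lambda>n. N n (x n)" 0 sequentially "norm c"] by (simp add: J_space_def)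
    then show "seq_scale smul c x \<in> J_space X N \<phi>" using x J.scale_in by (simp add: J_space_def)
  qed
  fix f l assume f: "\<And>n. f n \<in> J_space X N \<phi>" and l: "l \<in> J" "(\<lambda>n. nu (f n - l)) \<longlonglongrightarrow> 0"
  have fJ: "f m \<in> J" for m using f by (simp add: J_space_def)
  have "(\<lambda>n. N n (l n)) \<longlonglongrightarrow> 0"
  proof (rule LIMSEQ_I)
    fix r :: real assume r: "0 < r"
    have "\<forall>\<^sub>F m in sequentially. nu (f m - l) < r / 2" by (rule order_tendstoD(2)[OF l(2)]) (use r in simp)
    then obtain m where m: "nu (f m - l) < r / 2" by (auto simp: eventually_sequentially)
    have "(\<lambda>n. N n (f m n)) \<longlonglongrightarrow> 0" using f by (simp add: J_space_def)
    then have "\<forall>\<^sub>F n in sequentially. N n (f m n) < r / 2" by (rule order_tendstoD) (use r in simp)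
    then obtain n0 where n0: "\<And>n. n \<ge> n0 \<Longrightarrow> N n (f m n) < r / 2" by (auto simp: eventually_sequentially)
    have "norm (N n (l n) - 0) < r" if "n \<ge> n0" for n
    proof -
      have "N n (l n) \<le> N n (f m n) + N n (l n - f m n)"
        using J_in[OF l(1)] J_in[OF fJ] by (intro X.N_le_add_diff)
      also have "N n (l n - f m n) = N n ((f m - l) n)"
        using X.N_diff_commute[OF J_in[OF l(1)] J_in[OF fJ]] by simp
      also have "\<dots> \<le> nu (f m - l)" by (rule coordinate_le_nu[OF J.diff_in[OF fJ l(1)]])
      finally show ?thesis using m n0[OF that] X.N_nonneg[OF J_in[OF l(1)]] by simp
    qed
    then show "\<exists>n0. \<forall>n\<ge>n0. norm (N n (l n) - 0) < r" by blast
  qed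
  then show "l \<in> J_space X N \<phi>" using l by (simp add: J_space_def)
qed

text \<open>
  A jump from \<open>p\<close> to \<open>q\<close> involves only the at most two vectors that do not vanish at \<open>p\<close> or \<open>q\<close>,
  so its square is at most twice the sum of the squares of their jumps.
\<close>

lemma disjoint_upper_estimate:
  fixes u :: "nat \<Rightarrow> nat \<Rightarrow> 'a"
  assumes u: "\<And>k. u k \<in> J" and disj: "\<And>k l n. k \<noteq> l \<Longrightarrow> u k n = 0 \<or> u l n = 0"
    and B: "\<And>k. nu (u k) \<le> B"
  shows "nu (\<Sum>k<m. seq_scale smul (a k) (u k)) \<le> sqrt 2 * B * L2_set (\<lambda>k. norm (a k)) {..<m}"
proof (rule vnorm_le)
  fix ps :: "nat list" assume ps: "sorted ps"
  let ?x = "\<Sum>k<m. seq_scale smul (a k) (u k)"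
  have us: "u k \<in> seqs" for k using u J_seqs by blast
  have B0: "0 \<le> B" using B[of 0] vnorm_nonneg[OF u[of 0], of UNIV] by simp
  have jump_sq: "(jump N \<phi> ?x p q)\<^sup>2 \<le> 2 * (\<Sum>k<m. (norm (a k))\<^sup>2 * (jump N \<phi> (u k) p q)\<^sup>2)"
    if pq: "p \<le> q" for p q
  proof -
    define F where "F = {k \<in> {..<m}. u k p \<noteq> 0 \<or> u k q \<noteq> 0}"
    have one: "card {k \<in> {..<m}. u k n \<noteq> 0} \<le> 1" for n
    proof -
      have "finite {k \<in> {..<m}. u k n \<noteq> 0}" by simp
      then show ?thesis
        unfolding One_nat_def card_le_Suc0_iff_eq[OF \<open>finite _\<close>] using disj by blast
    qed
    have "F = {k \<in> {..<m}. u k p \<noteq> 0} \<union> {k \<in> {..<m}. u k q \<noteq> 0}" by (auto simp: F_def)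
    then have card: "card F \<le> 2"
      using card_Un_le[of "{k \<in> {..<m}. u k p \<noteq> 0}" "{k \<in> {..<m}. u k q \<noteq> 0}"] one[of p] one[of q] by simp
    have out: "jump N \<phi> (u k) p q = 0" if "k \<in> {..<m} - F" for k
      using that pq us by (auto simp: F_def jump_from_zero X.N_zero)
    have "jump N \<phi> ?x p q \<le> (\<Sum>k<m. jump N \<phi> (seq_scale smul (a k) (u k)) p q)"
      by (rule Seqs.seminorm_sum[OF jump_seminorm[OF pq]]) (auto intro: Seqs.scale_in us)
    also have "\<dots> = (\<Sum>k<m. norm (a k) * jump N \<phi> (u k) p q)"
      using jump_seminorm[OF pq] us by (simp add: seminorm_on_def)
    also have "\<dots> = (\<Sum>k\<in>F. norm (a k) * jump N \<phi> (u k) p q)"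
      using out by (intro sum.mono_neutral_right) (auto simp: F_def)
    finally have "(jump N \<phi> ?x p q)\<^sup>2 \<le> (\<Sum>k\<in>F. norm (a k) * jump N \<phi> (u k) p q)\<^sup>2"
      using pq us by (intro power_mono jump_nonneg Seqs.sum_in Seqs.scale_in) auto
    also have "\<dots> \<le> (\<Sum>k\<in>F. (norm (a k) * jump N \<phi> (u k) p q)\<^sup>2) * real (card F)"
      by (rule sum_squared_le_sum_of_squares)
    also have "\<dots> \<le> (\<Sum>k\<in>F. (norm (a k) * jump N \<phi> (u k) p q)\<^sup>2) * 2"
      using card by (intro mult_left_mono sum_nonneg) auto
    also have "\<dots> \<le> (\<Sum>k<m. (norm (a k) * jump N \<phi> (u k) p q)\<^sup>2) * 2"
      by (intro mult_right_mono sum_mono2) (auto simp: F_def)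
    finally show ?thesis by (simp add: power_mult_distrib mult.commute)
  qed
  have "(var ?x ps)\<^sup>2 \<le> 2 * (\<Sum>k<m. (norm (a k))\<^sup>2 * (var (u k) ps)\<^sup>2)"
    using ps
  proof (induction ps rule: induct_list012)
    case (3 p q ps)
    then have "(var ?x (q # ps))\<^sup>2 \<le> 2 * (\<Sum>k<m. (norm (a k))\<^sup>2 * (var (u k) (q # ps))\<^sup>2)" by simp
    moreover have "p \<le> q" using 3 by simp
    ultimately show ?case
      using jump_sq[of p q] unfolding variation_Cons2_squared distrib_left sum.distrib by linarith
  qed auto
  also have "\<dots> \<le> 2 * (\<Sum>k<m. (norm (a k))\<^sup>2 * B\<^sup>2)"
  proof (intro mult_left_mono sum_mono power_mono)
    show "var (u k) ps \<le> B" for k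
      using variation_le_vnorm[OF u ps, of UNIV] B[of k] by (meson order_trans subset_UNIV)
  qed (auto simp: variation_nonneg)
  also have "\<dots> = (sqrt 2 * B * L2_set (\<lambda>k. norm (a k)) {..<m})\<^sup>2"
    by (simp add: power_mult_distrib L2_set_def sum_nonneg flip: sum_distrib_right)
  finally show "var ?x ps \<le> sqrt 2 * B * L2_set (\<lambda>k. norm (a k)) {..<m}"
    by (rule power2_le_imp_le) (use B0 in simp)
qed

text \<open>
  Moving every index to the nearest point of \<open>[e, f]\<close> does not decrease any jump: \<open>u\<close> vanishes at
  both end points and outside, and a jump from inside to the right of \<open>f\<close> is longest at \<open>f\<close>,
  because the maps of the chain are contractions.
\<close>

lemma block_norm_local:
  assumes u: "u \<in> J" and ef: "e \<le> f" and zero: "\<And>n. n \<le> e \<or> f \<le> n \<Longrightarrow> u n = 0"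
  shows "nu u \<le> vnorm {e..f} u"
proof (rule vnorm_le)
  fix ps :: "nat list" assume ps: "sorted ps"
  define g where "g n = max e (min n f)" for n
  have us: "u \<in> seqs" using u by (rule J_seqs)
  have "var u ps \<le> var u (map g ps)"
  proof (rule variation_map_le)
    fix p q :: nat assume pq: "p \<le> q"
    then have gpq: "g p \<le> g q" by (auto simp: g_def)
    consider "p \<le> e \<or> f \<le> p" | "e < p" "q \<le> f" | "e < p" "p < f" "f < q" by linarith
    then show "jump N \<phi> u p q \<le> jump N \<phi> u (g p) (g q)"
    proof cases
      case 1
      then have "u p = 0" "u (g p) = 0" using zero ef by (auto simp: g_def)
      then have "jump N \<phi> u p q = N q (u q)" "jump N \<phi> u (g p) (g q) = N (g q) (u (g q))"
        using jump_from_zero[OF us pq] jump_from_zero[OF us gpq] by auto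
      moreover have "N q (u q) = N (g q) (u (g q))"
      proof (cases "e < q \<and> q < f")
        case True
        then have "g q = q" by (simp add: g_def)
        then show ?thesis by simp
      next
        case False
        then have "u q = 0" "u (g q) = 0" using zero ef by (auto simp: g_def)
        then show ?thesis by (simp add: X.N_zero)
      qed
      ultimately show ?thesis by simp
    next
      case 2
      then have "g p = p" "g q = q" using pq by (auto simp: g_def)
      then show ?thesis by simp
    next
      case 3
      then have g: "g p = p" "g q = f" using ef by (auto simp: g_def)
      have uf: "u f = 0" "u q = 0" using zero 3 by auto
      have "N q (phi_comp \<phi> p q (u p)) = N q (phi_comp \<phi> f q (phi_comp \<phi> p f (u p)))"
        using phi_comp_comp[of p f q] 3 by simp
      also have "\<dots> \<le> N f (phi_comp \<phi> p f (u p))"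
        using 3 seqsD[OF us] by (intro phi_comp_contraction phi_comp_in) auto
      finally show ?thesis by (simp add: jump_def g uf)
    qed
  qed (use us jump_nonneg ps in auto)
  also have "\<dots> \<le> vnorm {e..f} u"
  proof (rule variation_le_vnorm[OF u])
    have "mono g" by (rule monoI) (auto simp: g_def)
    then show "sorted (map g ps)" using ps by (simp add: sorted_map mono_def sorted_wrt_mono_rel[of _ "(\<le>)"])
    show "set (map g ps) \<subseteq> {e..f}" using ef by (auto simp: g_def)
  qed
  finally show "var u ps \<le> vnorm {e..f} u" .
qed

section \<open>The gliding hump\<close>

text \<open>
  Making the first \<open>m\<close> coordinates small one after the other, each time on a smaller
  infinite-dimensional subspace.
\<close>

lemma small_head:
  assumes M: "closed_subspace (seq_scale smul) J nu M" "infinite_dimensional (seq_scale smul) M"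
    and sing: "\<And>M' n c. M' \<subseteq> M \<Longrightarrow> closed_subspace (seq_scale smul) J nu M' \<Longrightarrow>
      infinite_dimensional (seq_scale smul) M' \<Longrightarrow> c > 0 \<Longrightarrow> \<exists>x\<in>M'. N n (x n) < c * nu x"
    and r: "r > 0"
  obtains x where "x \<in> M" "nu x = 1" "nu (head m x) \<le> r"
proof -
  define d where "d = r / (2 * real m + 1)"
  have d: "d > 0" using r by (simp add: d_def)
  have "\<exists>M'\<subseteq>M. closed_subspace (seq_scale smul) J nu M' \<and> infinite_dimensional (seq_scale smul) M' \<and>
      (\<forall>x\<in>M'. \<forall>i<m. N i (x i) \<le> d * nu x)"
  proof (induction m)
    case 0
    then show ?case using M by auto
  next
    case (Suc m)
    then obtain L where L: "L \<subseteq> M" "closed_subspace (seq_scale smul) J nu L"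
      "infinite_dimensional (seq_scale smul) L" "\<forall>x\<in>L. \<forall>i<m. N i (x i) \<le> d * nu x" by blast
    have "seminorm_on (seq_scale smul) J (\<lambda>x. N m (x m))"
      using J_in X.N_triangle X.N_scale by (simp add: seminorm_on_def seq_scale_def)
    then obtain L' where L': "L' \<subseteq> L" "closed_subspace (seq_scale smul) J nu L'"
      "infinite_dimensional (seq_scale smul) L'" "\<And>x. x \<in> L' \<Longrightarrow> N m (x m) \<le> d * nu x"
    proof (rule J.small_seminorm_subspace[OF L(2,3), where C=1])
      show "N m (x m) \<le> 1 * nu x" if "x \<in> J" for x using coordinate_le_nu[OF that] by simp
      show "\<exists>x\<in>M'. N m (x m) < c * nu x"
        if "M' \<subseteq> L" "closed_subspace (seq_scale smul) J nu M'" "infinite_dimensional (seq_scale smul) M'" "c > 0"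
        for M' c using sing[of M' c m] that L(1) by blast
    qed (use d in auto)
    then show ?case using L by (intro exI[of _ L']) (auto simp: less_Suc_eq)
  qed
  then obtain L where L: "L \<subseteq> M" "closed_subspace (seq_scale smul) J nu L"
    "infinite_dimensional (seq_scale smul) L" "\<And>x i. x \<in> L \<Longrightarrow> i < m \<Longrightarrow> N i (x i) \<le> d * nu x" by blast
  note D = J.closed_subspaceD[OF L(2)]
  have "L \<noteq> {0}" using L(3) unfolding infinite_dimensional_def by (metis Seq.span_empty finite.emptyI)
  moreover have "0 \<in> L" using D(1) by (rule Seq.subspace_0)
  ultimately obtain y where y: "y \<in> L" "y \<noteq> 0" by blast
  have yJ: "y \<in> J" using y D by blast
  have ny: "nu y > 0" using J.N_eq_zero[OF yJ] J.N_nonneg[OF yJ] y(2) by simp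
  define x where "x = seq_scale smul (of_real (1 / nu y)) y"
  have xL: "x \<in> L" unfolding x_def using D(1) y(1) by (rule Seq.subspace_scale)
  have xJ: "x \<in> J" using xL D by blast
  have nx: "nu x = 1" using J.N_scale[OF yJ, of "of_real (1 / nu y)"] ny by (simp add: x_def norm_divide)
  have "nu (head m x) \<le> (\<Sum>i<m. 2 * N i (x i))" using head_in_J[OF J_seqs[OF xJ]] by blast
  also have "\<dots> \<le> (\<Sum>i<m. 2 * d)" using L(4)[OF xL] nx by (intro sum_mono) auto
  also have "\<dots> = 2 * real m * d" by simp
  also have "\<dots> \<le> (2 * real m + 1) * d" using d by simp
  also have "\<dots> = r" by (simp add: d_def)
  finally show thesis using that[of x] xL L(1) nx by blast
qed

text \<open>
  The vectors \<open>x k\<close> are unit vectors of \<open>M\<close> with small head up to \<open>e k\<close> and small tail from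
  \<open>e (Suc k)\<close>, and \<open>u k\<close> is the part of \<open>x k\<close> strictly between. The functionals \<open>f k\<close> are dominated by the
  variation \<open>w k\<close> over \<open>[e k, e (Suc k)]\<close>. Domination by \<open>w k\<close> instead of \<open>\<nu>\<close> gives both
  biorthogonality, as \<open>w k\<close> vanishes on the other blocks, and the Bessel inequality, as the squares
  of the \<open>w k\<close> add up.
\<close>

lemma gliding_hump:
  assumes M: "closed_subspace (seq_scale smul) J nu M" "infinite_dimensional (seq_scale smul) M"
    and MJ: "M \<subseteq> J_space X N \<phi>"
    and sing: "\<And>M' n c. M' \<subseteq> M \<Longrightarrow> closed_subspace (seq_scale smul) J nu M' \<Longrightarrow>
      infinite_dimensional (seq_scale smul) M' \<Longrightarrow> c > 0 \<Longrightarrow> \<exists>x\<in>M'. N n (x n) < c * nu x"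
  obtains x f where "range x \<subseteq> M" "ell2_system (seq_scale smul) J nu x f"
proof -
  \<comment> \<open>The errors sum to 1/32, and the functionals below have norm at most 8.\<close>
  define d where "d k = (1/64) * (1/2 :: real) ^ k" for k
  have d0: "d k > 0" and d1: "d k \<le> 1/64" for k by (auto simp: d_def power_le_one)
  define good where "good k = (\<lambda>(e, x, e'). x \<in> M \<and> nu x = 1 \<and> e < e' \<and>
    nu (head (Suc e) x) \<le> d k / 2 \<and> nu (x - head e' x) \<le> d k / 2)" for k
  have pick: "\<exists>x e'. good k (e, x, e')" for k e
  proof -
    obtain x where x: "x \<in> M" "nu x = 1" "nu (head (Suc e) x) \<le> d k / 2"
      using small_head[OF M sing, of "d k / 2" "Suc e"] d0[of k] by auto
    have xJ: "x \<in> J" "(\<lambda>n. N n (x n)) \<longlonglongrightarrow> 0" using x(1) MJ by (auto simp: J_space_def)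
    obtain m where m: "\<And>f. m \<le> f \<Longrightarrow> nu (x - head f x) \<le> d k / 2"
      using tail_small[OF xJ, of "d k / 2"] d0[of k] by auto
    have "good k (e, x, max m (Suc e))" using x m by (simp add: good_def)
    then show ?thesis by blast
  qed
  have "\<exists>F. \<forall>k. good k (F k) \<and> fst (F (Suc k)) = snd (snd (F k))"
  proof (rule dependent_nat_choice)
    show "\<exists>s. good 0 s" using pick by blast
    show "\<exists>t. good (Suc k) t \<and> fst t = snd (snd s)" for s k
      using pick[of "Suc k" "snd (snd s)"] by force
  qed
  then obtain F where F: "\<And>k. good k (F k)" "\<And>k. fst (F (Suc k)) = snd (snd (F k))" by blast
  define e where "e k = fst (F k)" for k
  define x where "x k = fst (snd (F k))" for k
  have xM: "x k \<in> M" and nx: "nu (x k) = 1" and e_less: "e k < e (Suc k)"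
    and hd: "nu (head (Suc (e k)) (x k)) \<le> d k / 2" and tl: "nu (x k - head (e (Suc k)) (x k)) \<le> d k / 2" for k
    using F(1)[of k] F(2)[of k] by (auto simp: good_def e_def x_def split: prod.splits)
  have "strict_mono e" using e_less by (simp add: strict_mono_Suc_iff)
  then have mono_e: "mono e" by (rule strict_mono_mono)
  have xJ: "x k \<in> J" for k using xM MJ by (auto simp: J_space_def)
  have hJ: "head n (x k) \<in> J" for n k using head_in_J[OF J_seqs[OF xJ]] by blast
  define u where "u k = head (e (Suc k)) (x k) - head (Suc (e k)) (x k)" for k
  have uJ: "u k \<in> J" for k unfolding u_def by (intro J.diff_in hJ)
  have u_apply: "u k n = (if e k < n \<and> n < e (Suc k) then x k n else 0)" for k n
    using e_less[of k] by (auto simp: u_def head_def)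
  have close: "nu (x k - u k) \<le> d k" for k
  proof -
    have eq: "x k - u k = head (Suc (e k)) (x k) + (x k - head (e (Suc k)) (x k))" by (simp add: u_def)
    have "nu (x k - u k) \<le> nu (head (Suc (e k)) (x k)) + nu (x k - head (e (Suc k)) (x k))"
      unfolding eq by (rule J.N_triangle[OF hJ J.diff_in[OF xJ hJ]])
    then show ?thesis using hd[of k] tl[of k] by linarith
  qed
  have u_low: "nu (u k) \<ge> 1/2" and u_up: "nu (u k) \<le> 2" for k
  proof -
    have "nu (x k) \<le> nu (u k) + nu (x k - u k)" by (rule J.N_le_add_diff[OF xJ uJ])
    then show "nu (u k) \<ge> 1/2" using nx[of k] close[of k] d1[of k] by simp
    have "nu (u k) \<le> nu (x k) + nu (u k - x k)" by (rule J.N_le_add_diff[OF uJ xJ])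
    then show "nu (u k) \<le> 2" using nx[of k] close[of k] d1[of k] J.N_diff_commute[OF xJ uJ, of k k] by simp
  qed
  define w where "w k = vnorm {e k..e (Suc k)}" for k
  have w_low: "w k (u k) \<ge> 1/2" for k
  proof -
    have "nu (u k) \<le> w k (u k)" unfolding w_def
      by (rule block_norm_local[OF uJ]) (use e_less[of k] in \<open>auto simp: u_apply\<close>)
    then show ?thesis using u_low[of k] by linarith
  qed
  have w_semi: "seminorm_on (seq_scale smul) J (w k)" for k unfolding w_def by (rule vnorm_seminorm)
  have "\<exists>f. linear_map_on (seq_scale smul) (*) J f \<and> f (u k) = 1 \<and> (\<forall>y\<in>J. norm (f y) \<le> 8 * w k y)" for k
  proof -
    have pos: "0 < w k (u k)" using w_low[of k] by simp
    obtain f where f: "linear_map_on (seq_scale smul) (*) J f" "f (u k) = 1"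
      "\<And>y. y \<in> J \<Longrightarrow> norm (f y) \<le> 4 / w k (u k) * w k y"
      using J.dominated_functional[OF w_semi uJ pos] by blast
    have "4 / w k (u k) \<le> 8" using w_low[of k] pos by (simp add: field_simps)
    then have "norm (f y) \<le> 8 * w k y" if "y \<in> J" for y
      using f(3)[OF that] mult_right_mono[OF \<open>4 / w k (u k) \<le> 8\<close>, of "w k y"] vnorm_nonneg[OF that]
      by (simp add: w_def)
    with f show ?thesis by blast
  qed
  then obtain f where f: "\<And>k. linear_map_on (seq_scale smul) (*) J (f k)" "\<And>k. f k (u k) = 1"
    "\<And>k y. y \<in> J \<Longrightarrow> norm (f k y) \<le> 8 * w k y" by metis
  have off: "f k (u l) = 0" if "k \<noteq> l" for k l
  proof -
    have zero: "u l n = 0" if n: "n \<in> {e k..e (Suc k)}" for n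
    proof (cases "k < l")
      case True
      then have "e (Suc k) \<le> e l" using monoD[OF mono_e, of "Suc k" l] by simp
      then show ?thesis using n by (simp add: u_apply)
    next
      case False
      then have "e (Suc l) \<le> e k" using monoD[OF mono_e, of "Suc l" k] \<open>k \<noteq> l\<close> by simp
      then show ?thesis using n by (simp add: u_apply)
    qed
    have "w k (u l) = 0" unfolding w_def by (rule vnorm_eq_0[OF zero uJ])
    then show ?thesis using f(3)[OF uJ, of k l] by simp
  qed
  have disj: "u k n = 0 \<or> u l n = 0" if "k \<noteq> l" for k l n
  proof -
    have "e (Suc k) \<le> e l \<or> e (Suc l) \<le> e k"
      using monoD[OF mono_e, of "Suc k" l] monoD[OF mono_e, of "Suc l" k] that by linarith
    then show ?thesis by (auto simp: u_apply)
  qed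
  have f_nu: "norm (f k y) \<le> 8 * nu y" if y: "y \<in> J" for k y
    using f(3)[OF y, of k] vnorm_mono[OF y, of "{e k..e (Suc k)}" UNIV] by (simp add: w_def)
  have sys: "ell2_system (seq_scale smul) J nu u f" unfolding ell2_system_def
  proof (intro conjI allI exI[of _ 8] ballI)
    fix a :: "nat \<Rightarrow> 'k" and m
    have "sqrt 2 * 2 \<le> (8 :: real)" using real_sqrt_le_mono[of 2 16] by simp
    then have "sqrt 2 * 2 * L2_set (\<lambda>k. norm (a k)) {..<m} \<le> 8 * L2_set (\<lambda>k. norm (a k)) {..<m}"
      by (rule mult_right_mono) simp
    then show "nu (\<Sum>k<m. seq_scale smul (a k) (u k)) \<le> 8 * L2_set (\<lambda>k. norm (a k)) {..<m}"
      using disjoint_upper_estimate[of u 2 a m] uJ disj u_up by (meson order_trans)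
  next
    fix y m assume y: "y \<in> J"
    have "L2_set (\<lambda>k. norm (f k y)) {..<m} \<le> L2_set (\<lambda>k. 8 * w k y) {..<m}"
      using f(3)[OF y] by (intro L2_set_mono) auto
    also have "\<dots> = 8 * L2_set (\<lambda>k. w k y) {..<m}" by (simp add: L2_set_right_distrib)
    also have "\<dots> \<le> 8 * nu y" using vnorm_intervals[OF y mono_e] by (simp add: w_def)
    finally show "L2_set (\<lambda>k. norm (f k y)) {..<m} \<le> 8 * nu y" .
  qed (use uJ f off in auto)
  have "d sums (1/64 * 2)"
    unfolding d_def using geometric_sums[of "1/2 :: real"] by (intro sums_mult) simp
  then have sum_d: "summable d" "8 * suminf d \<le> 1/2" by (auto simp: sums_iff)
  obtain f' where "ell2_system (seq_scale smul) J nu x f'"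
    by (rule J.ell2_system_perturb[OF sys xJ f_nu sum_d(1) close sum_d(2)])
  then show thesis using that xM by blast
qed

end

section \<open>Operators bounded below on a subspace\<close>

lemma bounded_operatorD:
  assumes "bounded_operator smul V N smul' V' N' T"
  shows "linear_map_on smul smul' V T" "T ` V \<subseteq> V'" "\<exists>C. \<forall>x\<in>V. N' (T x) \<le> C * N x"
  using assms by (auto simp: bounded_operator_def linear_map_on_def)

lemma (in normed_space_on) bounded_operator_nonneg_bound:
  assumes "bounded_operator smul V N smul' V' N' T"
  obtains C where "C \<ge> 0" "\<And>x. x \<in> V \<Longrightarrow> N' (T x) \<le> C * N x"
proof -
  obtain C where C: "\<And>x. x \<in> V \<Longrightarrow> N' (T x) \<le> C * N x"
    using bounded_operatorD(3)[OF assms] by blast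
  have "N' (T x) \<le> max C 0 * N x" if "x \<in> V" for x
    using C[OF that] mult_right_mono[of C "max C 0" "N x"] N_nonneg[OF that] by simp
  then show thesis using that[of "max C 0"] by simp
qed

text \<open>
  \<open>T\<close> is defined on a whole Banach space but bounded below only on \<open>M\<close>. Objects found in the image
  of \<open>M\<close> are pulled back by the inverse of the restriction; because \<open>T\<close> is defined everywhere, so
  are the pulled-back projections and functionals.
\<close>

locale embedding_on = dom: banach_space_on smul V N + cod: normed_space_on smul' V' N'
  for smul :: "'k::real_or_complex \<Rightarrow> 'a::ab_group_add \<Rightarrow> 'a" and V N
    and smul' :: "'k \<Rightarrow> 'b::ab_group_add \<Rightarrow> 'b" and V' N' +
  fixes T :: "'a \<Rightarrow> 'b" and M :: "'a set" and c :: real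
  assumes T: "bounded_operator smul V N smul' V' N' T"
    and M: "closed_subspace smul V N M"
    and c: "c > 0" and below: "x \<in> M \<Longrightarrow> c * N x \<le> N' (T x)"
begin

abbreviation S where "S \<equiv> inv_into M T"

lemma T_lin: "linear_map_on smul smul' V T" and TV: "x \<in> V \<Longrightarrow> T x \<in> V'"
  using bounded_operatorD(1,2)[OF T] by auto

lemmas M_sub = dom.closed_subspaceD(1)[OF M]
  and MV = dom.closed_subspaceD(2)[OF M]
  and M_lim = dom.closed_subspaceD(3)[OF M]

sublocale M: linear_carrier smul M
  by unfold_locales (rule M_sub)

lemma T_lin_M: "linear_map_on smul smul' M T"
  using T_lin MV by (rule linear_map_on_subset)

lemma inj: "inj_on T M"
proof (rule inj_onI)
  fix x y assume xy: "x \<in> M" "y \<in> M" "T x = T y"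
  have d: "x - y \<in> M" using xy by (intro M.diff_in)
  have "T (x - y) = 0" using M.linear_map_diff[OF T_lin_M xy(1,2)] xy(3) by simp
  then have "c * N (x - y) \<le> 0" using below[OF d] cod.N_zero by simp
  then have "N (x - y) = 0" using c dom.N_nonneg[of "x - y"] d MV by (auto simp: mult_le_0_iff)
  then show "x = y" using dom.N_eq_zero[of "x - y"] d MV by auto
qed

lemma ST: "x \<in> M \<Longrightarrow> S (T x) = x"
  using inj by simp

lemma TS: "z \<in> T ` M \<Longrightarrow> T (S z) = z"
  by (rule f_inv_into_f)

lemma SM: "z \<in> T ` M \<Longrightarrow> S z \<in> M"
  by (rule inv_into_into)

lemma image_subspace: "cod.subspace (T ` M)"
  by (rule M.linear_map_image_subspace[OF cod.vector_space_axioms T_lin_M])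

lemma S_lin: "linear_map_on smul' smul (T ` M) S"
  unfolding linear_map_on_def
proof (intro conjI ballI allI)
  fix z w assume z: "z \<in> T ` M" "w \<in> T ` M"
  then have "T (S z + S w) = z + w"
    using T_lin_M SM TS by (simp add: linear_map_on_def)
  then show "S (z + w) = S z + S w" using ST[OF M.add_in[OF SM SM]] z by metis
next
  fix a z assume z: "z \<in> T ` M"
  then have "T (smul a (S z)) = smul' a z" using T_lin_M SM TS by (simp add: linear_map_on_def)
  then show "S (smul' a z) = smul a (S z)" using ST[OF M.scale_in[OF SM]] z by metis
qed

lemma S_add: "z \<in> T ` M \<Longrightarrow> w \<in> T ` M \<Longrightarrow> S (z + w) = S z + S w"
  and S_scale: "z \<in> T ` M \<Longrightarrow> S (smul' a z) = smul a (S z)"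
  using S_lin unfolding linear_map_on_def by blast+

lemma image_in: "T ` M \<subseteq> V'"
  using TV MV by blast

lemma S_bound: "z \<in> T ` M \<Longrightarrow> N (S z) \<le> 1 / c * N' z"
  using below[OF SM] TS c by (simp add: field_simps)

lemma preimage: "Z \<subseteq> T ` M \<Longrightarrow> S ` Z = {x \<in> M. T x \<in> Z}"
  using SM TS ST by (force simp: image_iff)

lemma image_closed: "closed_subspace smul' V' N' (T ` M)"
proof (rule cod.closed_subspaceI[OF image_subspace])
  show "T ` M \<subseteq> V'" by (rule image_in)
  fix f l assume f: "\<And>n. f n \<in> T ` M" and l: "l \<in> V'" "(\<lambda>n. N' (f n - l)) \<longlonglongrightarrow> 0"
  have fV: "f n \<in> V'" for n using image_in f by (rule subsetD)
  have diff: "N (S (f m) - S (f n)) \<le> 1 / c * N' (f m - f n)" for m n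
  proof -
    have "c * N (S (f m) - S (f n)) \<le> N' (T (S (f m) - S (f n)))"
      using SM f by (intro below M.diff_in) auto
    also have "T (S (f m) - S (f n)) = f m - f n"
      using M.linear_map_diff[OF T_lin_M SM SM] f TS by simp
    finally show ?thesis using c by (simp add: field_simps)
  qed
  have "\<exists>y\<in>V. (\<lambda>n. N (S (f n) - y)) \<longlonglongrightarrow> 0"
  proof (rule dom.complete)
    show "range (\<lambda>n. S (f n)) \<subseteq> V" using SM f MV by blast
    show "\<forall>e>0. \<exists>n0. \<forall>m\<ge>n0. \<forall>n\<ge>n0. N (S (f m) - S (f n)) < e"
    proof (intro allI impI)
      fix e :: real assume e: "e > 0"
      have "\<forall>\<^sub>F n in sequentially. N' (f n - l) < c * e / 2"
        by (rule order_tendstoD(2)[OF l(2)]) (use c e in simp)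
      then obtain n0 where n0: "\<And>n. n \<ge> n0 \<Longrightarrow> N' (f n - l) < c * e / 2"
        by (auto simp: eventually_sequentially)
      have "N (S (f m) - S (f n)) < e" if "m \<ge> n0" "n \<ge> n0" for m n
      proof -
        have "N' (f m - f n) \<le> N' (f m - l) + N' (l - f n)" using fV l by (intro cod.N_triangle_via)
        also have "N' (l - f n) = N' (f n - l)" using l fV by (intro cod.N_diff_commute)
        finally have "N' (f m - f n) < c * e" using n0[OF that(1)] n0[OF that(2)] by simp
        then have "1 / c * N' (f m - f n) < e" using c by (simp add: field_simps)
        then show ?thesis using diff[of m n] by linarith
      qed
      then show "\<exists>n0. \<forall>m\<ge>n0. \<forall>n\<ge>n0. N (S (f m) - S (f n)) < e" by blast
    qed
  qed
  then obtain y where y: "y \<in> V" "(\<lambda>n. N (S (f n) - y)) \<longlonglongrightarrow> 0" by blast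
  have yM: "y \<in> M" using M_lim[OF SM[OF f] y] .
  obtain C where C: "\<And>x. x \<in> V \<Longrightarrow> N' (T x) \<le> C * N x"
    using dom.bounded_operator_nonneg_bound[OF T] by blast
  have "(\<lambda>n. N' (f n - T y)) \<longlonglongrightarrow> 0"
  proof (rule Lim_null_comparison)
    show "(\<lambda>n. C * N (S (f n) - y)) \<longlonglongrightarrow> 0" using tendsto_mult_left[OF y(2), of C] by simp
    have "N' (f n - T y) \<le> C * N (S (f n) - y)" for n
    proof -
      have "T (S (f n) - y) = f n - T y"
        using M.linear_map_diff[OF T_lin_M SM[OF f] yM] TS[OF f] by simp
      moreover have "S (f n) - y \<in> V" using SM[OF f] y(1) MV dom.diff_in by blast
      ultimately show ?thesis using C by metis
    qed
    then show "\<forall>\<^sub>F n in sequentially. norm (N' (f n - T y)) \<le> C * N (S (f n) - y)"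
      using cod.N_nonneg[OF cod.diff_in[OF fV TV[OF y(1)]]] by simp
  qed
  then have "T y = l" by (rule cod.limit_unique[OF fV TV[OF y(1)] l(1) _ l(2)])
  then show "l \<in> T ` M" using yM by blast
qed

lemma image_infinite_dimensional:
  "infinite_dimensional smul M \<Longrightarrow> infinite_dimensional smul' (T ` M)"
  by (rule M.infinite_dimensional_image[OF cod.vector_space_axioms T_lin_M inj])

lemma preimage_infinite_dimensional:
  assumes "cod.subspace Z" "Z \<subseteq> T ` M" "infinite_dimensional smul' Z"
  shows "infinite_dimensional smul (S ` Z)"
proof -
  interpret Z: linear_carrier smul' Z by unfold_locales fact
  show ?thesis
    by (rule Z.infinite_dimensional_image[OF dom.vector_space_axioms linear_map_on_subset[OF S_lin assms(2)]
          inj_on_subset[OF inj_on_inv_into[OF order_refl] assms(2)] assms(3)])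
qed

lemma preimage_closed:
  assumes Z: "closed_subspace smul' V' N' Z" "Z \<subseteq> T ` M"
  shows "closed_subspace smul V N (S ` Z)"
proof (rule dom.closed_subspaceI)
  note D = cod.closed_subspaceD[OF Z(1)]
  interpret Z: linear_carrier smul' Z by unfold_locales (rule D)
  show "dom.subspace (S ` Z)"
    by (rule Z.linear_map_image_subspace[OF dom.vector_space_axioms linear_map_on_subset[OF S_lin Z(2)]])
  show "S ` Z \<subseteq> V" using preimage[OF Z(2)] MV by blast
  fix f l assume f: "\<And>n. f n \<in> S ` Z" and l: "l \<in> V" "(\<lambda>n. N (f n - l)) \<longlonglongrightarrow> 0"
  have fM: "f n \<in> M" and fZ: "T (f n) \<in> Z" for n using f preimage[OF Z(2)] by auto
  have fV: "f n \<in> V" for n using fM MV by blast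
  have lM: "l \<in> M" by (rule M_lim[OF fM l])
  obtain C where C: "\<And>x. x \<in> V \<Longrightarrow> N' (T x) \<le> C * N x"
    using dom.bounded_operator_nonneg_bound[OF T] by blast
  have "(\<lambda>n. N' (T (f n) - T l)) \<longlonglongrightarrow> 0"
  proof (rule Lim_null_comparison)
    show "(\<lambda>n. C * N (f n - l)) \<longlonglongrightarrow> 0" using tendsto_mult_left[OF l(2), of C] by simp
    show "\<forall>\<^sub>F n in sequentially. norm (N' (T (f n) - T l)) \<le> C * N (f n - l)"
      using C[OF dom.diff_in[OF fV l(1)]] dom.linear_map_diff[OF T_lin fV l(1)]
        cod.N_nonneg[OF cod.diff_in[OF TV[OF fV] TV[OF l(1)]]] by simp
  qed
  then have "T l \<in> Z" by (rule D(3)[OF fZ TV[OF l(1)]])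
  then show "l \<in> S ` Z" using lM preimage[OF Z(2)] by blast
qed

lemma preimage_complemented:
  assumes Z: "complemented_in smul' V' N' Z" "Z \<subseteq> T ` M"
  shows "complemented_in smul V N (S ` Z)"
proof -
  obtain Q where Q: "bounded_operator smul' V' N' smul' V' N' Q" "\<And>y. y \<in> V' \<Longrightarrow> Q (Q y) = Q y" "Q ` V' = Z"
    using Z(1) unfolding complemented_in_def by blast
  note Ql = bounded_operatorD(1)[OF Q(1)]
  have Qfix: "Q z = z" if "z \<in> Z" for z using that Q(2,3) by blast
  have QT: "Q (T x) \<in> T ` M" if "x \<in> V" for x using that TV Q(3) Z(2) by blast
  obtain C where C: "C \<ge> 0" "\<And>x. x \<in> V \<Longrightarrow> N' (T x) \<le> C * N x"
    using dom.bounded_operator_nonneg_bound[OF T] by blast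
  obtain D where D: "D \<ge> 0" "\<And>y. y \<in> V' \<Longrightarrow> N' (Q y) \<le> D * N' y"
    using cod.bounded_operator_nonneg_bound[OF Q(1)] by blast
  define P where "P x = S (Q (T x))" for x
  show ?thesis unfolding complemented_in_def
  proof (intro exI[of _ P] conjI ballI)
    show "bounded_operator smul V N smul V N P" unfolding bounded_operator_def
    proof (intro conjI ballI allI exI[of _ "1 / c * (D * C)"])
      show "P ` V \<subseteq> V" using QT SM MV by (auto simp: P_def)
      show "P (x + y) = P x + P y" if "x \<in> V" "y \<in> V" for x y
        using that T_lin Ql QT TV by (simp add: P_def linear_map_on_def S_add S_scale)
      show "P (smul a x) = smul a (P x)" if "x \<in> V" for a x
        using that T_lin Ql QT TV by (simp add: P_def linear_map_on_def S_add S_scale)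
      fix x assume x: "x \<in> V"
      have "N (P x) \<le> 1 / c * N' (Q (T x))" unfolding P_def by (rule S_bound[OF QT[OF x]])
      also have "\<dots> \<le> 1 / c * (D * (C * N x))"
        using D(2)[OF TV[OF x]] mult_left_mono[OF C(2)[OF x] D(1)] c
        by (intro mult_left_mono) auto
      finally show "N (P x) \<le> 1 / c * (D * C) * N x" by (simp add: mult.assoc)
    qed
    show "P (P x) = P x" if "x \<in> V" for x
      using QT[OF that] TS Q(2) TV that by (simp add: P_def)
    show "P ` V = S ` Z"
    proof
      show "P ` V \<subseteq> S ` Z" using TV Q(3) by (auto simp: P_def)
      show "S ` Z \<subseteq> P ` V"
      proof
        fix x assume "x \<in> S ` Z"
        then have x: "x \<in> M" "T x \<in> Z" using preimage[OF Z(2)] by auto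
        then have "P x = x" by (simp add: P_def Qfix ST)
        then show "x \<in> P ` V" using x MV by (metis image_eqI subsetD)
      qed
    qed
  qed
qed

lemma preimage_copy_of_ell2:
  assumes Z: "copy_of_ell2 smul' V' N' Z" "Z \<subseteq> T ` M"
  shows "copy_of_ell2 smul V N (S ` Z)"
proof -
  obtain \<tau> where \<tau>: "bij_betw \<tau> ell2 Z"
    "bounded_operator (seq_scale (*)) ell2 ell2_norm smul' Z N' \<tau>"
    "bounded_operator smul' Z N' (seq_scale (*)) ell2 ell2_norm (inv_into ell2 \<tau>)"
    and cl: "closed_subspace smul' V' N' Z"
    using Z(1) unfolding copy_of_ell2_def isomorphic_spaces_def by blast
  have \<tau>Z: "\<tau> a \<in> Z" if "a \<in> ell2" for a using that \<tau>(1) bij_betwE by blast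
  have \<tau>M: "\<tau> a \<in> T ` M" if "a \<in> ell2" for a using \<tau>Z[OF that] Z(2) by blast
  have inj_S: "inj_on S Z" using inj_on_subset[OF inj_on_inv_into[OF order_refl] Z(2)] .
  have bij: "bij_betw (S \<circ> \<tau>) ell2 (S ` Z)"
    using \<tau>(1) inj_on_imp_bij_betw[OF inj_S] by (rule bij_betw_trans)
  have inv: "inv_into ell2 (S \<circ> \<tau>) x = inv_into ell2 \<tau> (T x)" if "x \<in> S ` Z" for x
  proof -
    obtain a where a: "a \<in> ell2" "x = S (\<tau> a)" using \<open>x \<in> S ` Z\<close> \<tau>(1) by (auto simp: bij_betw_def)
    have "inv_into ell2 (S \<circ> \<tau>) x = a"
      using bij_betw_inv_into_left[OF bij a(1)] a(2) by simp
    moreover have "T x = \<tau> a" using a TS \<tau>Z[OF a(1)] Z(2) by auto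
    ultimately show ?thesis using bij_betw_inv_into_left[OF \<tau>(1) a(1)] by simp
  qed
  have pre: "x \<in> M" "T x \<in> Z" if "x \<in> S ` Z" for x using that preimage[OF Z(2)] by auto
  note Zc = preimage_closed[OF cl Z(2)]
  have sub: "x + y \<in> S ` Z" "smul a x \<in> S ` Z" if "x \<in> S ` Z" "y \<in> S ` Z" for x y a
    using dom.closed_subspaceD(1)[OF Zc] that by (auto intro: dom.subspace_add dom.subspace_scale)
  show ?thesis unfolding copy_of_ell2_def isomorphic_spaces_def
  proof (intro conjI exI[of _ "S \<circ> \<tau>"])
    show "closed_subspace smul V N (S ` Z)" by (rule Zc)
    show "bij_betw (S \<circ> \<tau>) ell2 (S ` Z)" by (rule bij)
    obtain C where C: "\<And>a. a \<in> ell2 \<Longrightarrow> N' (\<tau> a) \<le> C * ell2_norm a"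
      using bounded_operatorD(3)[OF \<tau>(2)] by blast
    show "bounded_operator (seq_scale (*)) ell2 ell2_norm smul (S ` Z) N (S \<circ> \<tau>)"
      unfolding bounded_operator_def
    proof (intro conjI ballI allI exI[of _ "1 / c * C"])
      show "(S \<circ> \<tau>) ` ell2 \<subseteq> S ` Z" using \<tau>Z by auto
      show "(S \<circ> \<tau>) (a + b) = (S \<circ> \<tau>) a + (S \<circ> \<tau>) b" if "a \<in> ell2" "b \<in> ell2" for a b
        using that bounded_operatorD(1)[OF \<tau>(2)] by (simp add: linear_map_on_def S_add S_scale \<tau>M)
      show "(S \<circ> \<tau>) (seq_scale (*) r a) = smul r ((S \<circ> \<tau>) a)" if "a \<in> ell2" for r a
        using that bounded_operatorD(1)[OF \<tau>(2)] by (simp add: linear_map_on_def S_add S_scale \<tau>M)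
      show "N ((S \<circ> \<tau>) a) \<le> 1 / c * C * ell2_norm a" if "a \<in> ell2" for a
        using S_bound[of "\<tau> a"] mult_left_mono[OF C[OF that], of "1 / c"] \<tau>Z[OF that] Z(2) c by auto
    qed
    obtain D where D: "\<And>z. z \<in> Z \<Longrightarrow> ell2_norm (inv_into ell2 \<tau> z) \<le> D * N' z"
      using bounded_operatorD(3)[OF \<tau>(3)] by blast
    obtain C' where C': "\<And>x. x \<in> V \<Longrightarrow> N' (T x) \<le> C' * N x"
      using bounded_operatorD(3)[OF T] by blast
    have D0: "ell2_norm (inv_into ell2 \<tau> z) \<le> max D 0 * N' z" if z: "z \<in> Z" for z
      using D[OF z] mult_right_mono[of D "max D 0" "N' z"] cod.N_nonneg[of z] z Z(2) MV TV by fastforce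
    show "bounded_operator smul (S ` Z) N (seq_scale (*)) ell2 ell2_norm (inv_into ell2 (S \<circ> \<tau>))"
      unfolding bounded_operator_def
    proof (intro conjI ballI allI exI[of _ "max D 0 * C'"])
      show "inv_into ell2 (S \<circ> \<tau>) ` (S ` Z) \<subseteq> ell2"
        using bij_betw_inv_into[OF bij] by (auto simp: bij_betw_def)
      show "inv_into ell2 (S \<circ> \<tau>) (x + y) = inv_into ell2 (S \<circ> \<tau>) x + inv_into ell2 (S \<circ> \<tau>) y"
        if "x \<in> S ` Z" "y \<in> S ` Z" for x y
        using that bounded_operatorD(1)[OF \<tau>(3)] T_lin_M pre sub inv by (simp add: linear_map_on_def)
      show "inv_into ell2 (S \<circ> \<tau>) (smul r x) = seq_scale (*) r (inv_into ell2 (S \<circ> \<tau>) x)"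
        if "x \<in> S ` Z" for r x
        using that bounded_operatorD(1)[OF \<tau>(3)] T_lin_M pre sub inv by (simp add: linear_map_on_def)
      show "ell2_norm (inv_into ell2 (S \<circ> \<tau>) x) \<le> max D 0 * C' * N x" if "x \<in> S ` Z" for x
        using D0[OF pre(2)[OF that]] mult_left_mono[OF C'[of x], of "max D 0"] pre(1)[OF that] MV inv[OF that]
        by auto
    qed
  qed
qed

lemma pull_ell2_system:
  assumes sys: "ell2_system smul' V' N' y h" and y: "\<And>k. y k \<in> T ` M"
  shows "ell2_system smul V N (\<lambda>k. S (y k)) (\<lambda>k x. h k (T x))"
proof -
  obtain C where C: "C \<ge> 0" "\<And>x. x \<in> V \<Longrightarrow> N' (T x) \<le> C * N x"
    using dom.bounded_operator_nonneg_bound[OF T] by blast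
  interpret I: linear_carrier smul' "T ` M" by unfold_locales (rule image_subspace)
  show ?thesis
  proof (rule dom.ell2_system_transport[OF sys T_lin _ C(2), where c' = "1 / c"])
    fix a :: "nat \<Rightarrow> 'k" and n
    have "(\<Sum>k<n. smul (a k) (S (y k))) = S (\<Sum>k<n. smul' (a k) (y k))"
      using I.linear_map_sum[OF S_lin, of "{..<n}" "\<lambda>k. smul' (a k) (y k)"] y I.scale_in
      by (simp add: S_scale)
    moreover have "(\<Sum>k<n. smul' (a k) (y k)) \<in> T ` M" using y by (intro I.sum_in I.scale_in)
    ultimately show "N (\<Sum>k<n. smul (a k) (S (y k))) \<le> 1 / c * N' (\<Sum>k<n. smul' (a k) (y k))"
      using S_bound by simp
  qed (use TV SM y MV TS C c in auto)
qed

text \<open>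
  In the other direction functionals need an operator on the whole of \<open>V'\<close>; it is the projection
  onto \<open>Z\<close> followed by the inverse of the embedding.
\<close>

lemma push_ell2_system:
  assumes Z: "complemented_in smul' V' N' Z" "Z \<subseteq> T ` M"
    and sys: "ell2_system smul V N x f" and x: "\<And>k. x k \<in> S ` Z"
  obtains h where "ell2_system smul' V' N' (\<lambda>k. T (x k)) h"
proof -
  obtain Q where Q: "bounded_operator smul' V' N' smul' V' N' Q" "\<And>y. y \<in> V' \<Longrightarrow> Q (Q y) = Q y" "Q ` V' = Z"
    using Z(1) unfolding complemented_in_def by blast
  note Ql = bounded_operatorD(1)[OF Q(1)]
  have Qfix: "Q z = z" if "z \<in> Z" for z using that Q(2,3) by blast
  have QM: "Q y \<in> T ` M" if "y \<in> V'" for y using that Q(3) Z(2) by blast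
  have xM: "x k \<in> M" and Tx: "T (x k) \<in> Z" for k using x preimage[OF Z(2)] by auto
  have xV: "x k \<in> V" for k using xM MV by blast
  obtain C where C: "C \<ge> 0" "\<And>x. x \<in> V \<Longrightarrow> N' (T x) \<le> C * N x"
    using dom.bounded_operator_nonneg_bound[OF T] by blast
  obtain D where D: "D \<ge> 0" "\<And>y. y \<in> V' \<Longrightarrow> N' (Q y) \<le> D * N' y"
    using cod.bounded_operator_nonneg_bound[OF Q(1)] by blast
  have "ell2_system smul' V' N' (\<lambda>k. T (x k)) (\<lambda>k y. f k (S (Q y)))"
  proof (rule cod.ell2_system_transport[OF sys, where R = "\<lambda>y. S (Q y)" and c = "1 / c * D" and c' = C])
    show "linear_map_on smul' smul V' (\<lambda>y. S (Q y))"
      using Ql QM by (simp add: linear_map_on_def S_add S_scale)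
    show "(\<lambda>y. S (Q y)) ` V' \<subseteq> V" using QM SM MV by blast
    show "N (S (Q y)) \<le> 1 / c * D * N' y" if "y \<in> V'" for y
      using S_bound[OF QM[OF that]] mult_left_mono[OF D(2)[OF that], of "1 / c"] c by simp
    show "T (x k) \<in> V'" for k using TV xV by blast
    show "S (Q (T (x k))) = x k" for k using Qfix[OF Tx] ST[OF xM] by simp
    fix a :: "nat \<Rightarrow> 'k" and n
    have "(\<Sum>k<n. smul' (a k) (T (x k))) = T (\<Sum>k<n. smul (a k) (x k))"
      using dom.linear_map_sum[OF T_lin, of "{..<n}" "\<lambda>k. smul (a k) (x k)"] xV T_lin dom.scale_in
      by (simp add: linear_map_on_def)
    then show "N' (\<Sum>k<n. smul' (a k) (T (x k))) \<le> C * N (\<Sum>k<n. smul (a k) (x k))"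
      using C(2)[OF dom.sum_in[OF dom.scale_in[OF xV]]] by simp
  qed (use C D c in auto)
  then show thesis by (rule that)
qed

end

section \<open>Subspaces of \<open>\<ell>\<^sub>2\<close>\<close>

text \<open>
  Real and imaginary parts of a Cauchy sequence are Cauchy. For real scalars the imaginary part
  is not determined by the scalar and is chosen to be 0.
\<close>

lemma real_or_complex_complete:
  fixes f :: "nat \<Rightarrow> 'k::real_or_complex"
  assumes "\<forall>e>0. \<exists>n0. \<forall>m\<ge>n0. \<forall>n\<ge>n0. norm (f m - f n) < e"
  shows "\<exists>l. (\<lambda>n. norm (f n - l)) \<longlonglongrightarrow> 0"
proof -
  obtain j :: 'k where j: "j = 0 \<or> j * j = - 1" and rep: "\<And>z. \<exists>a b. z = scaleR a 1 + scaleR b j"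
    using real_or_complex by metis
  have "\<exists>a b. f n = of_real a + of_real b * j \<and> (j = 0 \<longrightarrow> b = 0)" for n
    using rep[of "f n"] by (cases "j = 0") (auto simp: scaleR_conv_of_real)
  then obtain a b where ab: "\<And>n. f n = of_real (a n) + of_real (b n) * j"
    and b0: "\<And>n. j = 0 \<longrightarrow> b n = 0" by metis
  have le: "\<bar>a m - a n\<bar> + \<bar>b m - b n\<bar> \<le> 2 * norm (f m - f n)" for m n
  proof -
    have eq: "f m - f n = of_real (a m - a n) + of_real (b m - b n) * j"
      by (simp add: ab algebra_simps)
    show ?thesis
    proof (cases "j = 0")
      case True
      then have "norm (f m - f n) = \<bar>a m - a n\<bar>" unfolding eq by (simp del: of_real_diff)
      then show ?thesis using b0 True by simp
    next
      case False
      then show ?thesis unfolding eq using norm_scalar_lower j by blast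
    qed
  qed
  have "\<exists>n0. \<forall>m\<ge>n0. \<forall>n\<ge>n0. \<bar>a m - a n\<bar> < e \<and> \<bar>b m - b n\<bar> < e" if "e > 0" for e
  proof -
    obtain n0 where n0: "\<forall>m\<ge>n0. \<forall>n\<ge>n0. norm (f m - f n) < e / 2"
      using assms \<open>e > 0\<close> by (meson half_gt_zero)
    have "\<bar>a m - a n\<bar> < e \<and> \<bar>b m - b n\<bar> < e" if "m \<ge> n0" "n \<ge> n0" for m n
    proof -
      have "norm (f m - f n) < e / 2" using n0 that by blast
      then show ?thesis using le[of m n] by linarith
    qed
    then show ?thesis by blast
  qed
  then have "Cauchy a" "Cauchy b" unfolding Cauchy_def dist_real_def by blast+
  then obtain la lb where "a \<longlonglongrightarrow> la" "b \<longlonglongrightarrow> lb" by (meson Cauchy_convergent convergent_def)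
  then have "(\<lambda>n. of_real (a n) + of_real (b n) * j) \<longlonglongrightarrow> of_real la + of_real lb * j"
    by (intro tendsto_intros)
  moreover have "f = (\<lambda>n. of_real (a n) + of_real (b n) * j)" using ab by (rule ext)
  ultimately have "f \<longlonglongrightarrow> of_real la + of_real lb * j" by (simp only:)
  then show ?thesis using tendsto_norm_zero LIM_zero by blast
qed

definition scalar_line :: "nat \<Rightarrow> 'k::real_or_complex set" where
  "scalar_line n = (if n = 0 then {0} else UNIV)"

lemma scalar_banach: "banach_space_on (*) (scalar_line n :: 'k::real_or_complex set) norm"
proof unfold_locales
    show "module.subspace (*) (scalar_line n :: 'k set)"
      by (simp add: scalar_line_def vector_space_over_itself.subspace_def)
    fix f :: "nat \<Rightarrow> 'k"
    assume f: "range f \<subseteq> scalar_line n"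
      and cauchy: "\<forall>e>0. \<exists>n0. \<forall>m\<ge>n0. \<forall>n\<ge>n0. norm (f m - f n) < e"
    show "\<exists>l\<in>scalar_line n. (\<lambda>n. norm (f n - l)) \<longlonglongrightarrow> 0"
    proof (cases "n = 0")
      case True
      then have "f m = 0" for m using f by (auto simp: scalar_line_def)
      then show ?thesis by (intro bexI[of _ 0]) (auto simp: scalar_line_def)
    next
      case False
      then show ?thesis using real_or_complex_complete[OF cauchy] by (simp add: scalar_line_def)
    qed
qed (auto simp: norm_mult norm_triangle_ineq)

text \<open>
  With zero maps a jump to a different index is just the norm of the coordinate there. So the
  space \<open>J\<close> of the chain of scalar fields is \<open>\<ell>\<^sub>2\<close>, shifted by one index because the first space has
  to be zero, and the gliding hump applies to subspaces of \<open>\<ell>\<^sub>2\<close>.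
\<close>

interpretation scalar: contraction_chain "(*) :: 'k \<Rightarrow> 'k \<Rightarrow> 'k::real_or_complex" scalar_line "\<lambda>_. norm" "\<lambda>_ _. 0"
proof (rule contraction_chain.intro)
  show "banach_space_on (*) (scalar_line n :: 'k set) norm" for n by (rule scalar_banach)
qed (auto simp: linear_map_on_def scalar_line_def)

lemma scalar_phi_comp: "p \<le> q \<Longrightarrow> phi_comp (\<lambda>_ _. 0) p q v = (if p = q then v else (0 :: 'k::real_or_complex))"
  by (induction q rule: dec_induct) (auto simp: scalar.phi_comp_Suc)

lemma scalar_jump:
  "p \<le> q \<Longrightarrow> jump (\<lambda>_. norm) (\<lambda>_ _. 0) x p q = (if p = q then 0 else norm (x q :: 'k::real_or_complex))"
  by (simp add: jump_def scalar_phi_comp)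

lemma scalar_shift_down:
  assumes x: "x \<in> scalar.J"
  shows "(\<lambda>n. x (Suc n)) \<in> ell2" "ell2_norm (\<lambda>n. x (Suc n)) \<le> scalar.nu x"
proof -
  have le: "L2_set (\<lambda>k. norm (x (Suc k))) {..<n} \<le> scalar.nu x" for n
  proof -
    have "(scalar.var x [0..<Suc n])\<^sup>2 = (\<Sum>i<n. (norm (x (Suc i)))\<^sup>2)"
      unfolding variation_sum by (intro sum.cong) (auto simp: scalar_jump simp del: upt_Suc)
    then have "L2_set (\<lambda>k. norm (x (Suc k))) {..<n} = scalar.var x [0..<Suc n]"
      unfolding L2_set_def by (metis real_sqrt_abs abs_of_nonneg variation_nonneg)
    also have "\<dots> \<le> scalar.nu x" by (rule scalar.variation_le_vnorm[OF x]) (auto simp del: upt_Suc)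
    finally show ?thesis .
  qed
  show "(\<lambda>n. x (Suc n)) \<in> ell2" "ell2_norm (\<lambda>n. x (Suc n)) \<le> scalar.nu x"
    using ell2_bounded_partial[OF le] by auto
qed

lemma scalar_shift_up:
  assumes a: "a \<in> ell2"
  shows "case_nat 0 a \<in> scalar.J" "scalar.nu (case_nat 0 a) \<le> ell2_norm a"
proof -
  let ?x = "case_nat 0 a :: nat \<Rightarrow> 'a"
  have sum_le: "(scalar.var ?x ps)\<^sup>2 \<le> (\<Sum>n\<in>{hd ps<..m}. (norm (?x n))\<^sup>2)"
    if "sorted ps" "\<forall>p\<in>set ps. p \<le> m" for ps m
    using that
  proof (induction ps rule: induct_list012)
    case (3 p q ps)
    then have pq: "p \<le> q" "q \<le> m"
      and IH: "(scalar.var ?x (q # ps))\<^sup>2 \<le> (\<Sum>n\<in>{q<..m}. (norm (?x n))\<^sup>2)" by auto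
    show ?case
    proof (cases "p = q")
      case True
      then show ?thesis unfolding variation_Cons2_squared using IH by (simp add: scalar_jump)
    next
      case False
      then have "(jump (\<lambda>_. norm) (\<lambda>_ _. 0) ?x p q)\<^sup>2 + (scalar.var ?x (q # ps))\<^sup>2
          \<le> (norm (?x q))\<^sup>2 + (\<Sum>n\<in>{q<..m}. (norm (?x n))\<^sup>2)"
        using IH pq by (simp add: scalar_jump)
      also have "\<dots> = (\<Sum>n\<in>insert q {q<..m}. (norm (?x n))\<^sup>2)" by simp
      also have "\<dots> \<le> (\<Sum>n\<in>{p<..m}. (norm (?x n))\<^sup>2)"
        using pq False by (intro sum_mono2) auto
      finally show ?thesis unfolding variation_Cons2_squared by simp
    qed
  qed (auto intro: sum_nonneg)
  have le: "scalar.var ?x ps \<le> ell2_norm a" if ps: "sorted ps" for ps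
  proof -
    define m where "m = Max (insert 0 (set ps))"
    have "p \<le> m" if "p \<in> set ps" for p unfolding m_def using that by (intro Max_ge) auto
    then have "(scalar.var ?x ps)\<^sup>2 \<le> (\<Sum>n\<in>{hd ps<..m}. (norm (?x n))\<^sup>2)"
      using sum_le ps by blast
    also have "\<dots> \<le> (\<Sum>n\<in>Suc ` {..<m}. (norm (?x n))\<^sup>2)"
    proof (rule sum_mono2)
      show "{hd ps<..m} \<subseteq> Suc ` {..<m}"
      proof
        fix n assume "n \<in> {hd ps<..m}"
        then have "n = Suc (n - 1)" "n - 1 < m" by auto
        then show "n \<in> Suc ` {..<m}" by (metis imageI lessThan_iff)
      qed
    qed auto
    also have "\<dots> = (L2_set (\<lambda>k. norm (a k)) {..<m})\<^sup>2"
      by (subst sum.reindex) (auto simp: L2_set_def sum_nonneg)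
    finally have "scalar.var ?x ps \<le> L2_set (\<lambda>k. norm (a k)) {..<m}"
      by (rule power2_le_imp_le) simp
    then show ?thesis using ell2_partial_le[OF a, of m] by linarith
  qed
  have "?x \<in> scalar.seqs" by (auto simp: scalar.seqs_def scalar_line_def split: nat.split)
  then show "?x \<in> scalar.J" using le unfolding scalar.J_iff by blast
  show "scalar.nu ?x \<le> ell2_norm a" by (rule scalar.vnorm_le) (rule le)
qed

lemma scalar_J_null: "(scalar.J :: (nat \<Rightarrow> 'k::real_or_complex) set) \<subseteq> J_space scalar_line (\<lambda>_. norm) (\<lambda>_ _. 0)"
proof
  fix x :: "nat \<Rightarrow> 'k" assume x: "x \<in> scalar.J"
  have "(\<lambda>n. (norm (x (Suc n)))\<^sup>2) \<longlonglongrightarrow> 0"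
    using scalar_shift_down(1)[OF x] unfolding ell2_def mem_Collect_eq by (rule summable_LIMSEQ_zero)
  then have "(\<lambda>n. sqrt ((norm (x (Suc n)))\<^sup>2)) \<longlonglongrightarrow> sqrt 0" by (rule tendsto_real_sqrt)
  then have "(\<lambda>n. norm (x (Suc n))) \<longlonglongrightarrow> 0" by simp
  then have "(\<lambda>n. norm (x n)) \<longlonglongrightarrow> 0" by (rule LIMSEQ_imp_Suc)
  with x show "x \<in> J_space scalar_line (\<lambda>_. norm) (\<lambda>_ _. 0)" by (simp add: J_space_def)
qed

text \<open>
  No coordinate is bounded below on an infinite-dimensional subspace, because its kernel is a
  hyperplane and so contains a nonzero vector.
\<close>

lemma scalar_subspace_system:
  fixes E :: "(nat \<Rightarrow> 'k::real_or_complex) set"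
  assumes E: "closed_subspace (seq_scale (*)) scalar.J scalar.nu E"
    and inf: "infinite_dimensional (seq_scale (*)) E"
  obtains x f where "range x \<subseteq> E" "ell2_system (seq_scale (*)) scalar.J scalar.nu x f"
proof (rule scalar.gliding_hump[OF E inf])
  show "E \<subseteq> J_space scalar_line (\<lambda>_. norm) (\<lambda>_ _. 0)"
    using scalar.J.closed_subspaceD(2)[OF E] scalar_J_null by blast
  fix L :: "(nat \<Rightarrow> 'k) set" and n and c :: real
  assume L: "closed_subspace (seq_scale (*)) scalar.J scalar.nu L"
    "infinite_dimensional (seq_scale (*)) L" and c: "c > 0"
  note D = scalar.J.closed_subspaceD[OF L(1)]
  interpret L: linear_carrier "seq_scale (*)" L by unfold_locales (rule D)
  have "linear_map_on (seq_scale (*)) (*) L (\<lambda>x. x n)" by (simp add: linear_map_on_def seq_scale_def)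
  then have "infinite_dimensional (seq_scale (*)) {x \<in> L. x n = 0}"
    by (rule L.infinite_dimensional_kernel[OF _ L(2)])
  then have "{x \<in> L. x n = 0} \<noteq> {0}"
    unfolding infinite_dimensional_def by (metis scalar.Seq.span_empty finite.emptyI)
  then obtain x where x: "x \<in> L" "x n = 0" "x \<noteq> 0" using L.zero_in by auto
  have xJ: "x \<in> scalar.J" using x D by blast
  have "0 < scalar.nu x" using scalar.J.N_eq_zero[OF xJ] scalar.J.N_nonneg[OF xJ] x(3) by simp
  then show "\<exists>x\<in>L. norm (x n) < c * scalar.nu x" using x c by (intro bexI[of _ x]) auto
qed (rule that)

lemma ell2_linear_carrier: "linear_carrier (seq_scale (*)) (ell2 :: (nat \<Rightarrow> 'k::real_or_complex) set)"
proof unfold_locales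
  have "(0 :: nat \<Rightarrow> 'k) \<in> ell2" by (simp add: ell2_def)
  then show "scalar.Seq.subspace (ell2 :: (nat \<Rightarrow> 'k) set)"
    by (intro scalar.Seq.subspaceI ell2_add ell2_scale)
qed

lemma ell2_infinite_dimensional:
  "infinite_dimensional (seq_scale (*)) (ell2 :: (nat \<Rightarrow> 'k::real_or_complex) set)"
proof -
  interpret linear_carrier "seq_scale (*)" "ell2 :: (nat \<Rightarrow> 'k) set" by (rule ell2_linear_carrier)
  show ?thesis
  proof (rule infinite_dimensional_if_triangular[where y = "\<lambda>k n. if n = k then 1 else 0" and g = "\<lambda>k a. a k"])
    show "(\<lambda>n. if n = k then 1 else 0) \<in> (ell2 :: (nat \<Rightarrow> 'k) set)" for k
      unfolding ell2_def mem_Collect_eq by (rule summable_finite[of "{k}"]) auto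
  qed (auto simp: linear_map_on_def seq_scale_def)
qed

lemma (in normed_space_on) copy_of_ell2_infinite_dimensional:
  assumes "copy_of_ell2 smul V N Z"
  shows "infinite_dimensional smul Z"
proof -
  obtain \<tau> where \<tau>: "bij_betw \<tau> ell2 Z"
    "bounded_operator (seq_scale (*)) ell2 ell2_norm smul Z N \<tau>"
    using assms unfolding copy_of_ell2_def isomorphic_spaces_def by blast
  interpret L: linear_carrier "seq_scale (*)" "ell2 :: (nat \<Rightarrow> 'k) set" by (rule ell2_linear_carrier)
  have "infinite_dimensional smul (\<tau> ` ell2)"
    using \<tau> by (intro L.infinite_dimensional_image[OF vector_space_axioms bounded_operatorD(1)[OF \<tau>(2)]]
        ell2_infinite_dimensional) (simp add: bij_betw_def)
  then show ?thesis using \<tau>(1) by (simp add: bij_betw_def)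
qed

text \<open>
  The preimage of \<open>W\<close> in \<open>\<ell>\<^sub>2\<close> contains a complemented biorthogonal system. Moved to \<open>W\<close>, its
  functionals extend to the whole space along the projection onto \<open>W\<close>.
\<close>

lemma (in banach_space_on) complemented_in_copy_of_ell2_system:
  assumes Z: "copy_of_ell2 smul V N Z" and W: "complemented_in smul V N W" "W \<subseteq> Z"
    "infinite_dimensional smul W"
  obtains y h where "range y \<subseteq> W" "ell2_system smul V N y h"
proof -
  obtain \<tau> where \<tau>: "bij_betw \<tau> ell2 Z"
    "bounded_operator (seq_scale (*)) ell2 ell2_norm smul Z N \<tau>"
    "bounded_operator smul Z N (seq_scale (*)) ell2 ell2_norm (inv_into ell2 \<tau>)"
    and cl: "closed_subspace smul V N Z"
    using Z unfolding copy_of_ell2_def isomorphic_spaces_def by blast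
  have \<tau>Z: "\<tau> a \<in> Z" if "a \<in> ell2" for a using that \<tau>(1) bij_betwE by blast
  note \<tau>l = bounded_operatorD(1)[OF \<tau>(2)]
  have ZV: "Z \<subseteq> V" by (rule closed_subspaceD(2)[OF cl])
  obtain C where C: "\<And>a. a \<in> ell2 \<Longrightarrow> N (\<tau> a) \<le> C * ell2_norm a"
    using bounded_operatorD(3)[OF \<tau>(2)] by blast
  obtain D where D: "\<And>z. z \<in> Z \<Longrightarrow> ell2_norm (inv_into ell2 \<tau> z) \<le> D * N z"
    using bounded_operatorD(3)[OF \<tau>(3)] by blast
  define T where "T x = \<tau> (\<lambda>n. x (Suc n))" for x
  note down = scalar_shift_down
  have up: "x = case_nat 0 (\<lambda>n. x (Suc n))" if "x \<in> scalar.J" for x :: "nat \<Rightarrow> 'k"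
    using scalar.J_in[OF that, of 0] by (auto simp: scalar_line_def fun_eq_iff split: nat.split)
  have TZ: "T x \<in> Z" if "x \<in> scalar.J" for x unfolding T_def using \<tau>Z down(1)[OF that] .
  have T_op: "bounded_operator (seq_scale (*)) scalar.J scalar.nu smul V N T"
    unfolding bounded_operator_def
  proof (intro conjI ballI allI exI[of _ "max C 0"])
    show "T ` scalar.J \<subseteq> V" using TZ ZV by blast
    fix x y :: "nat \<Rightarrow> 'k" and c assume x: "x \<in> scalar.J"
    have "T (seq_scale (*) c x) = \<tau> (seq_scale (*) c (\<lambda>n. x (Suc n)))" by (simp add: T_def seq_scale_def)
    then show "T (seq_scale (*) c x) = smul c (T x)"
      using \<tau>l down(1)[OF x] by (simp add: linear_map_on_def T_def)
    have "N (T x) \<le> C * ell2_norm (\<lambda>n. x (Suc n))" unfolding T_def by (rule C[OF down(1)[OF x]])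
    also have "\<dots> \<le> max C 0 * ell2_norm (\<lambda>n. x (Suc n))"
      using down(1)[OF x] by (intro mult_right_mono) (auto simp: ell2_norm_def ell2_def suminf_nonneg)
    also have "\<dots> \<le> max C 0 * scalar.nu x" using down(2)[OF x] by (intro mult_left_mono) auto
    finally show "N (T x) \<le> max C 0 * scalar.nu x" .
    assume y: "y \<in> scalar.J"
    have "T (x + y) = \<tau> ((\<lambda>n. x (Suc n)) + (\<lambda>n. y (Suc n)))" by (simp add: T_def plus_fun_def)
    then show "T (x + y) = T x + T y"
      using \<tau>l down(1)[OF x] down(1)[OF y] by (simp add: linear_map_on_def T_def)
  qed
  have below: "1 / max D 1 * scalar.nu x \<le> N (T x)" if x: "x \<in> scalar.J" for x
  proof -
    have "scalar.nu x \<le> ell2_norm (\<lambda>n. x (Suc n))"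
      using scalar_shift_up(2)[OF down(1)[OF x]] up[OF x] by simp
    also have "(\<lambda>n. x (Suc n)) = inv_into ell2 \<tau> (T x)"
      unfolding T_def using bij_betw_inv_into_left[OF \<tau>(1) down(1)[OF x]] by simp
    also have "ell2_norm \<dots> \<le> D * N (T x)" by (rule D[OF TZ[OF x]])
    also have "\<dots> \<le> max D 1 * N (T x)" using N_nonneg TZ[OF x] ZV by (intro mult_right_mono) auto
    finally show ?thesis by (simp add: field_simps)
  qed
  interpret E: embedding_on "seq_scale (*)" scalar.J scalar.nu smul V N T scalar.J "1 / max D 1"
  proof unfold_locales
    show "closed_subspace (seq_scale (*)) scalar.J scalar.nu scalar.J"
      by (rule scalar.J.closed_subspaceI) (auto simp: scalar.J_subspace)
  qed (use T_op below in auto)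
  have "Z \<subseteq> T ` scalar.J"
  proof
    fix z assume "z \<in> Z"
    then obtain a where a: "a \<in> ell2" "z = \<tau> a" using \<tau>(1) by (auto simp: bij_betw_def)
    then have "z = T (case_nat 0 a)" by (simp add: T_def)
    then show "z \<in> T ` scalar.J" using scalar_shift_up(1)[OF a(1)] by blast
  qed
  then have WT: "W \<subseteq> T ` scalar.J" using W(2) by blast
  note Wc = complemented_closed[OF W(1)]
  obtain x f where x: "range x \<subseteq> E.S ` W" "ell2_system (seq_scale (*)) scalar.J scalar.nu x f"
    by (rule scalar_subspace_system[OF E.preimage_closed[OF Wc WT]
          E.preimage_infinite_dimensional[OF closed_subspaceD(1)[OF Wc] WT W(3)]])
  obtain h where h: "ell2_system smul V N (\<lambda>k. T (x k)) h"
    by (rule E.push_ell2_system[OF W(1) WT x(2)]) (use x(1) in blast)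
  have "range (\<lambda>k. T (x k)) \<subseteq> W" using x(1) E.preimage[OF WT] by blast
  then show thesis using h by (rule that)
qed

section \<open>The three statements\<close>

context contraction_chain begin

lemma coordinate_operator: "bounded_operator (seq_scale smul) J nu smul (X n) (N n) (\<lambda>x. x n)"
  unfolding bounded_operator_def
  by (intro conjI ballI allI exI[of _ 1])
    (use J_in coordinate_le_nu in \<open>auto simp: seq_scale_def\<close>)

lemma coordinate_embedding:
  assumes "closed_subspace (seq_scale smul) J nu M" "c > 0" "\<And>x. x \<in> M \<Longrightarrow> c * nu x \<le> N n (x n)"
  shows "embedding_on (seq_scale smul) J nu smul (X n) (N n) (\<lambda>x. x n) M c"
  by unfold_locales (use assms coordinate_operator in auto)

lemma coordinate_or_system:
  assumes M: "closed_subspace (seq_scale smul) J nu M" "infinite_dimensional (seq_scale smul) M"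
    and MJ: "M \<subseteq> J_space X N \<phi>"
  obtains (coordinate) L n c where "L \<subseteq> M" "infinite_dimensional (seq_scale smul) L"
      "embedding_on (seq_scale smul) J nu smul (X n) (N n) (\<lambda>x. x n) L c"
  | (system) x f where "range x \<subseteq> M" "ell2_system (seq_scale smul) J nu x f"
proof (cases "\<forall>L n c. L \<subseteq> M \<longrightarrow> closed_subspace (seq_scale smul) J nu L \<longrightarrow>
      infinite_dimensional (seq_scale smul) L \<longrightarrow> c > 0 \<longrightarrow> (\<exists>x\<in>L. N n (x n) < c * nu x)")
  case True
  show thesis
    by (rule gliding_hump[OF M MJ _ system]) (use True in blast)
next
  case False
  then obtain L n c where L: "L \<subseteq> M" "closed_subspace (seq_scale smul) J nu L"
    "infinite_dimensional (seq_scale smul) L" "c > 0" "\<And>x. x \<in> L \<Longrightarrow> c * nu x \<le> N n (x n)"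
    by (meson not_less)
  show thesis by (rule coordinate[OF L(1,3) coordinate_embedding[OF L(2,4,5)]])
qed

lemma complemented_subspace:
  assumes sub: "\<And>n. subprojective smul (X n) (N n)"
    and M: "closed_subspace (seq_scale smul) J nu M" "infinite_dimensional (seq_scale smul) M"
    and MJ: "M \<subseteq> J_space X N \<phi>"
  shows "\<exists>W\<subseteq>M. infinite_dimensional (seq_scale smul) W \<and> complemented_in (seq_scale smul) J nu W"
  using M MJ
proof (cases rule: coordinate_or_system)
  case (coordinate L n c)
  interpret E: embedding_on "seq_scale smul" J nu smul "X n" "N n" "\<lambda>x. x n" L c by fact
  obtain Z where Z: "Z \<subseteq> (\<lambda>x. x n) ` L" "infinite_dimensional smul Z" "complemented_in smul (X n) (N n) Z"
    using sub[of n] E.image_closed E.image_infinite_dimensional[OF coordinate(2)]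
    unfolding subprojective_def by blast
  have "X.subspace Z" using X.closed_subspaceD(1)[OF X.complemented_closed[OF Z(3)]] .
  then have "infinite_dimensional (seq_scale smul) (E.S ` Z)" using Z by (intro E.preimage_infinite_dimensional)
  moreover have "E.S ` Z \<subseteq> M" using E.preimage[OF Z(1)] coordinate(1) by blast
  ultimately show ?thesis using E.preimage_complemented[OF Z(3,1)] by blast
next
  case (system x f)
  then have "x k \<in> M" for k by blast
  from J.ell2_system_span[OF system(2) M(1) this] show ?thesis by metis
qed

lemma copy_subspace:
  assumes her: "\<And>n. hereditarily_ell2 smul (X n) (N n)"
    and M: "closed_subspace (seq_scale smul) J nu M" "infinite_dimensional (seq_scale smul) M"
    and MJ: "M \<subseteq> J_space X N \<phi>"
  shows "\<exists>W\<subseteq>M. copy_of_ell2 (seq_scale smul) J nu W"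
  using M MJ
proof (cases rule: coordinate_or_system)
  case (coordinate L n c)
  interpret E: embedding_on "seq_scale smul" J nu smul "X n" "N n" "\<lambda>x. x n" L c by fact
  obtain Z where Z: "Z \<subseteq> (\<lambda>x. x n) ` L" "copy_of_ell2 smul (X n) (N n) Z"
    using her[of n] E.image_closed E.image_infinite_dimensional[OF coordinate(2)]
    unfolding hereditarily_ell2_def by blast
  have "E.S ` Z \<subseteq> M" using E.preimage[OF Z(1)] coordinate(1) by blast
  then show ?thesis using E.preimage_copy_of_ell2[OF Z(2,1)] by blast
next
  case (system x f)
  then have "x k \<in> M" for k by blast
  from J.ell2_system_span[OF system(2) M(1) this] show ?thesis by metis
qed

text \<open>
  In the first case the order of the choices matters: first a copy \<open>Z\<close> of \<open>\<ell>\<^sub>2\<close> in the image, then a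
  subspace \<open>W\<close> of \<open>Z\<close> complemented in \<open>X n\<close>. A subspace of \<open>W\<close> complemented in \<open>\<ell>\<^sub>2\<close> is then complemented in
  \<open>X n\<close>, whereas a copy of \<open>\<ell>\<^sub>2\<close> inside a complemented subspace need not be complemented.
\<close>

lemma complemented_copy_subspace:
  assumes sub: "\<And>n. subprojective smul (X n) (N n)" and her: "\<And>n. hereditarily_ell2 smul (X n) (N n)"
    and M: "closed_subspace (seq_scale smul) J nu M" "infinite_dimensional (seq_scale smul) M"
    and MJ: "M \<subseteq> J_space X N \<phi>"
  shows "\<exists>W\<subseteq>M. copy_of_ell2 (seq_scale smul) J nu W \<and> complemented_in (seq_scale smul) J nu W"
proof -
  have "\<exists>x f. range x \<subseteq> M \<and> ell2_system (seq_scale smul) J nu x f"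
    using M MJ
  proof (cases rule: coordinate_or_system)
    case (coordinate L n c)
    interpret E: embedding_on "seq_scale smul" J nu smul "X n" "N n" "\<lambda>x. x n" L c by fact
    obtain Z where Z: "Z \<subseteq> (\<lambda>x. x n) ` L" "copy_of_ell2 smul (X n) (N n) Z"
      using her[of n] E.image_closed E.image_infinite_dimensional[OF coordinate(2)]
      unfolding hereditarily_ell2_def by blast
    have "closed_subspace smul (X n) (N n) Z" using Z(2) by (simp add: copy_of_ell2_def)
    moreover have "infinite_dimensional smul Z" by (rule X.copy_of_ell2_infinite_dimensional[OF Z(2)])
    ultimately obtain W where W: "W \<subseteq> Z" "infinite_dimensional smul W" "complemented_in smul (X n) (N n) W"
      using sub[of n] unfolding subprojective_def by blast
    obtain y h where y: "range y \<subseteq> W" "ell2_system smul (X n) (N n) y h"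
      by (rule X.complemented_in_copy_of_ell2_system[OF Z(2) W(3,1,2)])
    have yL: "y k \<in> (\<lambda>x. x n) ` L" for k using y(1) W(1) Z(1) by blast
    have "range (\<lambda>k. E.S (y k)) \<subseteq> M" using E.SM[OF yL] coordinate(1) by blast
    then show ?thesis using E.pull_ell2_system[OF y(2) yL] by blast
  qed blast
  then obtain x f where x: "range x \<subseteq> M" "ell2_system (seq_scale smul) J nu x f" by blast
  then have "x k \<in> M" for k by blast
  from J.ell2_system_span[OF x(2) M(1) this] show ?thesis by metis
qed

end

section \<open>Passing to the norm of the statement\<close>

lemma bounded_operator_equivalent_norms:
  assumes T: "bounded_operator smul V N smul' V' N' T"
    and dom: "0 \<le> B" "\<And>x. x \<in> V \<Longrightarrow> N x \<le> B * N2 x" "\<And>x. x \<in> V \<Longrightarrow> 0 \<le> N x"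
    and cod: "0 \<le> A" "\<And>y. y \<in> V' \<Longrightarrow> N2' y \<le> A * N' y"
  shows "bounded_operator smul V N2 smul' V' N2' T"
proof -
  obtain C where C: "\<And>x. x \<in> V \<Longrightarrow> N' (T x) \<le> C * N x" using bounded_operatorD(3)[OF T] by blast
  have "N2' (T x) \<le> (A * max C 0 * B) * N2 x" if x: "x \<in> V" for x
  proof -
    have "N2' (T x) \<le> A * N' (T x)" using x bounded_operatorD(2)[OF T] by (intro cod) auto
    also have "\<dots> \<le> A * (max C 0 * N x)"
      using C[OF x] dom(3)[OF x] cod(1)
      by (intro mult_left_mono order_trans[OF C[OF x]] mult_right_mono) auto
    also have "\<dots> \<le> A * (max C 0 * (B * N2 x))"
      using dom(2)[OF x] cod(1) by (intro mult_left_mono) auto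
    finally show ?thesis by (simp add: mult.assoc)
  qed
  then show ?thesis using T unfolding bounded_operator_def by blast
qed

context contraction_chain begin

lemma J_norm_nonneg: "x \<in> J \<Longrightarrow> 0 \<le> J_norm N \<phi> x"
proof -
  assume x: "x \<in> J"
  then have "0 \<le> sqrt 2 * J_norm N \<phi> x" using nu_le_J_norm[OF x] vnorm_nonneg[OF x, of UNIV] by linarith
  then show ?thesis by (simp add: zero_le_mult_iff)
qed

lemma tendsto_nu_iff:
  assumes "\<And>n. f n \<in> J"
  shows "(\<lambda>n. nu (f n)) \<longlonglongrightarrow> 0 \<longleftrightarrow> (\<lambda>n. J_norm N \<phi> (f n)) \<longlonglongrightarrow> 0"
proof
  assume "(\<lambda>n. nu (f n)) \<longlonglongrightarrow> 0"
  then show "(\<lambda>n. J_norm N \<phi> (f n)) \<longlonglongrightarrow> 0"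
    by (rule Lim_null_comparison[rotated]) (simp add: J_norm_le_nu J_norm_nonneg assms)
next
  assume "(\<lambda>n. J_norm N \<phi> (f n)) \<longlonglongrightarrow> 0"
  then have "(\<lambda>n. sqrt 2 * J_norm N \<phi> (f n)) \<longlonglongrightarrow> 0"
    using tendsto_mult_left[of "\<lambda>n. J_norm N \<phi> (f n)" 0 sequentially "sqrt 2"] by simp
  then show "(\<lambda>n. nu (f n)) \<longlonglongrightarrow> 0"
    by (rule Lim_null_comparison[rotated]) (simp add: nu_le_J_norm vnorm_nonneg assms)
qed

text \<open>
  A subspace closed in \<open>J(\<Phi>)\<close> is closed in the larger space, since \<open>J(\<Phi>)\<close> is.
\<close>

lemma closed_subspace_J_space:
  "closed_subspace (seq_scale smul) (J_space X N \<phi>) (J_norm N \<phi>) M \<longleftrightarrow>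
    closed_subspace (seq_scale smul) J nu M \<and> M \<subseteq> J_space X N \<phi>"
proof -
  have lim: "(\<lambda>n. nu (f n - l)) \<longlonglongrightarrow> 0 \<longleftrightarrow> (\<lambda>n. J_norm N \<phi> (f n - l)) \<longlonglongrightarrow> 0"
    if "range f \<subseteq> J" "l \<in> J" for f l
    using that by (intro tendsto_nu_iff J.diff_in) auto
  have sub: "J_space X N \<phi> \<subseteq> J" by (auto simp: J_space_def)
  show ?thesis
  proof
    assume M: "closed_subspace (seq_scale smul) (J_space X N \<phi>) (J_norm N \<phi>) M"
    then have MJ: "M \<subseteq> J_space X N \<phi>" and Ms: "Seq.subspace M" by (auto simp: closed_subspace_def)
    have "closed_subspace (seq_scale smul) J nu M"
    proof (rule J.closed_subspaceI[OF Ms])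
      show "M \<subseteq> J" using MJ sub by blast
      fix f l assume f: "\<And>n. f n \<in> M" and l: "l \<in> J" "(\<lambda>n. nu (f n - l)) \<longlonglongrightarrow> 0"
      have "l \<in> J_space X N \<phi>"
        by (rule J.closed_subspaceD(3)[OF J_space_closed _ l]) (use f MJ in blast)
      moreover have "(\<lambda>n. J_norm N \<phi> (f n - l)) \<longlonglongrightarrow> 0"
        using lim[of f l] f l MJ sub by blast
      ultimately show "l \<in> M" using M f unfolding closed_subspace_def by blast
    qed
    then show "closed_subspace (seq_scale smul) J nu M \<and> M \<subseteq> J_space X N \<phi>" using MJ by blast
  next
    assume M: "closed_subspace (seq_scale smul) J nu M \<and> M \<subseteq> J_space X N \<phi>"
    show "closed_subspace (seq_scale smul) (J_space X N \<phi>) (J_norm N \<phi>) M"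
      unfolding closed_subspace_def
    proof (intro conjI allI impI)
      fix f l assume f: "range f \<subseteq> M" and l: "l \<in> J_space X N \<phi>" "(\<lambda>n. J_norm N \<phi> (f n - l)) \<longlonglongrightarrow> 0"
      have lJ: "l \<in> J" using l sub by blast
      moreover have "(\<lambda>n. nu (f n - l)) \<longlonglongrightarrow> 0"
        using lim[of f l] f l lJ M sub by blast
      ultimately show "l \<in> M" using M f unfolding closed_subspace_def by blast
    qed (use M in \<open>auto simp: closed_subspace_def\<close>)
  qed
qed

lemma complemented_in_J_norm:
  assumes "complemented_in (seq_scale smul) J nu W"
  shows "complemented_in (seq_scale smul) J (J_norm N \<phi>) W"
proof -
  obtain P where P: "bounded_operator (seq_scale smul) J nu (seq_scale smul) J nu P"
    "\<forall>x\<in>J. P (P x) = P x" "P ` J = W"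
    using assms unfolding complemented_in_def by blast
  have "bounded_operator (seq_scale smul) J (J_norm N \<phi>) (seq_scale smul) J (J_norm N \<phi>) P"
    by (rule bounded_operator_equivalent_norms[OF P(1), where A = 1 and B = "sqrt 2"])
      (auto simp: nu_le_J_norm J_norm_le_nu vnorm_nonneg)
  with P(2,3) show ?thesis unfolding complemented_in_def by blast
qed

lemma copy_of_ell2_J_norm:
  assumes W: "copy_of_ell2 (seq_scale smul) J nu W" "W \<subseteq> J_space X N \<phi>"
  shows "copy_of_ell2 (seq_scale smul) (J_space X N \<phi>) (J_norm N \<phi>) W"
proof -
  obtain \<tau> where \<tau>: "bij_betw \<tau> ell2 W"
    "bounded_operator (seq_scale (*)) ell2 ell2_norm (seq_scale smul) W nu \<tau>"
    "bounded_operator (seq_scale smul) W nu (seq_scale (*)) ell2 ell2_norm (inv_into ell2 \<tau>)"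
    and cl: "closed_subspace (seq_scale smul) J nu W"
    using W(1) unfolding copy_of_ell2_def isomorphic_spaces_def by blast
  have WJ: "x \<in> J" if "x \<in> W" for x using that W(2) by (auto simp: J_space_def)
  show ?thesis unfolding copy_of_ell2_def isomorphic_spaces_def
  proof (intro conjI exI[of _ \<tau>] \<tau>(1))
    show "closed_subspace (seq_scale smul) (J_space X N \<phi>) (J_norm N \<phi>) W"
      using closed_subspace_J_space cl W(2) by blast
    show "bounded_operator (seq_scale (*)) ell2 ell2_norm (seq_scale smul) W (J_norm N \<phi>) \<tau>"
      by (rule bounded_operator_equivalent_norms[OF \<tau>(2), where A = 1 and B = 1])
        (auto simp: J_norm_le_nu WJ ell2_norm_def ell2_def suminf_nonneg)
    show "bounded_operator (seq_scale smul) W (J_norm N \<phi>) (seq_scale (*)) ell2 ell2_norm (inv_into ell2 \<tau>)"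
      by (rule bounded_operator_equivalent_norms[OF \<tau>(3), where A = 1 and B = "sqrt 2"])
        (auto simp: nu_le_J_norm WJ vnorm_nonneg)
  qed
qed

end

lemma operator_norm_le_1D:
  assumes V: "normed_space_on smul V N" and T: "bounded_operator smul V N smul' V' N' T"
    and V': "normed_space_on smul' V' N'" and le: "operator_norm V N N' T \<le> 1" and x: "x \<in> V"
  shows "N' (T x) \<le> N x"
proof -
  interpret V: normed_space_on smul V N by fact
  interpret V': normed_space_on smul' V' N' by fact
  obtain C where C: "C \<ge> 0" "\<And>x. x \<in> V \<Longrightarrow> N' (T x) \<le> C * N x"
    using V.bounded_operator_nonneg_bound[OF T] by blast
  have bdd: "bdd_above ((\<lambda>x. N' (T x)) ` {x \<in> V. N x \<le> 1})"
  proof (rule bdd_aboveI2)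
    fix y assume y: "y \<in> {x \<in> V. N x \<le> 1}"
    then have "N' (T y) \<le> C * N y" using C by simp
    also have "\<dots> \<le> C * 1" using y C by (intro mult_left_mono) auto
    finally show "N' (T y) \<le> C" by simp
  qed
  show ?thesis
  proof (cases "N x = 0")
    case True
    then show ?thesis using C(2)[OF x] by simp
  next
    case False
    then have pos: "N x > 0" using V.N_nonneg[OF x] by simp
    define y where "y = smul (of_real (1 / N x)) x"
    have yV: "y \<in> V" unfolding y_def by (rule V.scale_in[OF x])
    have Ny: "N y = 1" using V.N_scale[OF x, of "of_real (1 / N x)"] pos by (simp add: y_def norm_divide)
    have "N' (T y) \<le> 1"
      using cSUP_upper[OF _ bdd, of y] yV Ny le by (simp add: operator_norm_def)
    moreover have "T y = smul' (of_real (1 / N x)) (T x)"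
      unfolding y_def using bounded_operatorD(1)[OF T] x by (simp add: linear_map_on_def)
    then have "N' (T y) = 1 / N x * N' (T x)"
      using V'.N_scale[of "T x" "of_real (1 / N x)"] bounded_operatorD(2)[OF T] x pos
      by (simp add: image_subset_iff norm_divide)
    ultimately show ?thesis using pos by (simp add: field_simps)
  qed
qed

theorem theorem5p2:
  fixes smul :: "'k::real_or_complex \<Rightarrow> 'a::ab_group_add \<Rightarrow> 'a"
    and X :: "nat \<Rightarrow> 'a set"
    and N :: "nat \<Rightarrow> 'a \<Rightarrow> real"
    and \<phi> :: "nat \<Rightarrow> 'a \<Rightarrow> 'a"
  assumes banach: "\<And>n. banach_space_on smul (X n) (N n)"
    and X0: "X 0 = {0}"
    and phi_operator:
      "\<And>n. bounded_operator smul (X n) (N n) smul (X (Suc n)) (N (Suc n)) (\<phi> n)"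
    and phi_norm: "\<And>n. operator_norm (X n) (N n) (N (Suc n)) (\<phi> n) \<le> 1"
  shows
    "((\<forall>n. subprojective smul (X n) (N n)) \<longrightarrow>
       (\<forall>M. closed_subspace (seq_scale smul) (J_space X N \<phi>) (J_norm N \<phi>) M \<and>
            infinite_dimensional (seq_scale smul) M \<longrightarrow>
         (\<exists>W\<subseteq>M. infinite_dimensional (seq_scale smul) W \<and>
            complemented_in (seq_scale smul) (J_hat X N \<phi>) (J_norm N \<phi>) W)))
     \<and>
     ((\<forall>n. hereditarily_ell2 smul (X n) (N n)) \<longrightarrow>
       hereditarily_ell2 (seq_scale smul) (J_space X N \<phi>) (J_norm N \<phi>))
     \<and>
     ((\<forall>n. subprojective smul (X n) (N n) \<and> hereditarily_ell2 smul (X n) (N n)) \<longrightarrow>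
       (\<forall>M. closed_subspace (seq_scale smul) (J_space X N \<phi>) (J_norm N \<phi>) M \<and>
            infinite_dimensional (seq_scale smul) M \<longrightarrow>
         (\<exists>W\<subseteq>M. copy_of_ell2 (seq_scale smul) (J_space X N \<phi>) (J_norm N \<phi>) W \<and>
            complemented_in (seq_scale smul) (J_hat X N \<phi>) (J_norm N \<phi>) W)))"
proof -
  have normed: "normed_space_on smul (X n) (N n)" for n
    using banach[of n] by (rule banach_space_on.axioms)
  interpret contraction_chain smul X N \<phi>
  proof (rule contraction_chain.intro)
    show "banach_space_on smul (X n) (N n)" for n by (rule banach)
    show "X 0 = {0}" by (rule X0)
    show "\<phi> n v \<in> X (Suc n)" if "v \<in> X n" for n v
      using bounded_operatorD(2)[OF phi_operator] that by blast
    show "linear_map_on smul smul (X n) (\<phi> n)" for n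
      by (rule bounded_operatorD(1)[OF phi_operator])
    show "N (Suc n) (\<phi> n v) \<le> N n v" if "v \<in> X n" for n v
      by (rule operator_norm_le_1D[OF normed phi_operator normed phi_norm that])
  qed
  note closed = closed_subspace_J_space
  show ?thesis
  proof (intro conjI impI allI)
    fix M
    assume sub: "\<forall>n. subprojective smul (X n) (N n)"
      and M: "closed_subspace (seq_scale smul) (J_space X N \<phi>) (J_norm N \<phi>) M \<and>
        infinite_dimensional (seq_scale smul) M"
    obtain W where "W \<subseteq> M" "infinite_dimensional (seq_scale smul) W"
      "complemented_in (seq_scale smul) J nu W"
      using complemented_subspace[of M] sub M closed[of M] by blast
    then show "\<exists>W\<subseteq>M. infinite_dimensional (seq_scale smul) W \<and>
        complemented_in (seq_scale smul) J (J_norm N \<phi>) W"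
      using complemented_in_J_norm by blast
  next
    assume her: "\<forall>n. hereditarily_ell2 smul (X n) (N n)"
    show "hereditarily_ell2 (seq_scale smul) (J_space X N \<phi>) (J_norm N \<phi>)"
      unfolding hereditarily_ell2_def
    proof (intro allI impI)
      fix M assume M: "closed_subspace (seq_scale smul) (J_space X N \<phi>) (J_norm N \<phi>) M \<and>
        infinite_dimensional (seq_scale smul) M"
      then have MJ: "M \<subseteq> J_space X N \<phi>" using closed[of M] by blast
      obtain W where "W \<subseteq> M" "copy_of_ell2 (seq_scale smul) J nu W"
        using copy_subspace[of M] her M closed[of M] by blast
      then show "\<exists>W\<subseteq>M. copy_of_ell2 (seq_scale smul) (J_space X N \<phi>) (J_norm N \<phi>) W"
        using copy_of_ell2_J_norm MJ by blast
    qed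
  next
    fix M
    assume both: "\<forall>n. subprojective smul (X n) (N n) \<and> hereditarily_ell2 smul (X n) (N n)"
      and M: "closed_subspace (seq_scale smul) (J_space X N \<phi>) (J_norm N \<phi>) M \<and>
        infinite_dimensional (seq_scale smul) M"
    then have MJ: "M \<subseteq> J_space X N \<phi>" using closed[of M] by blast
    obtain W where "W \<subseteq> M" "copy_of_ell2 (seq_scale smul) J nu W"
      "complemented_in (seq_scale smul) J nu W"
      using complemented_copy_subspace[of M] both M closed[of M] by blast
    then show "\<exists>W\<subseteq>M. copy_of_ell2 (seq_scale smul) (J_space X N \<phi>) (J_norm N \<phi>) W \<and>
        complemented_in (seq_scale smul) J (J_norm N \<phi>) W"
      using copy_of_ell2_J_norm complemented_in_J_norm MJ by blast
  qed
qed

end
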